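(* For any monomial module $M\subseteq T$, all $i$ and all $\mathbf b\in\mathbb Z^n$, $$\mu_{i,\mathbf b}(T/M)=\beta_{i,-\mathbf b}(M^T).$$
   Context: $k$ is a field, $n\ge 2$, $S=k[x_1,\ldots,x_n]\subseteq T=S[x_1^{-1},\ldots,x_n^{-1}]$, with the $\mathbb Z^n$-grading. All modules are $\mathbb Z^n$-graded. A monomial module is a $\mathbb Z^n$-graded $S$-submodule $M\subseteq T$. Its $T$-dual $M^T\subseteq T$ is the monomial module determined by $x^{-\mathbf b}\in M^T\Leftrightarrow x^{\mathbf b}\notin M$. Let $\underline{\mathrm{Ext}}$ and $\underline{\mathrm{Tor}}$ be the derived functors of the $\mathbb Z^n$-graded $\underline{\mathrm{Hom}}$ and of $\otimes$ in the category of $\mathbb Z^n$-graded $S$-modules. The $i$th Bass and Betti numbers of a module $N$ in degree $\mathbf b$ are $\mu_{i,\mathbf b}(N)=\dim_k\underline{\mathrm{Ext}}^i_S(k,N)_{\mathbf b}$ and $\beta_{i,\mathbf b}(N)=\dim_k\underline{\mathrm{Tor}}_i^S(k,N)_{\mathbf b}$, where $k=S/\langle x_1,\ldots,x_n\rangle$ sits in degree $\mathbf 0$. *)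

theory Defs
  imports
    "HOL-Library.Poly_Mapping"
    "HOL-Library.Extended_Nat"
    "HOL-Analysis.Finite_Cartesian_Product"
    "HOL-Algebra.Ideal"
    "HOL-Algebra.Generated_Groups"
    "Jordan_Normal_Form.VS_Connect"
begin

section \<open>Graded modules\<close>

text \<open>
  A graded module is a module record together with its homogeneous components.  The ring
  fields \<open>mult\<close> and \<open>one\<close>, which every module record inherits, carry no information unless
  the module is itself a ring.  In particular a graded ring \<open>R\<close> is given as a
  graded module over itself, of type \<open>('r, 'r, 'g) gmodule\<close>.
\<close>

record ('r, 'm, 'g) gmodule = "('r, 'm) module" +
  homog :: "'g \<Rightarrow> 'm set"

definition gsub :: "('r, 'm, 'g) gmodule \<Rightarrow> 'm set \<Rightarrow> ('r, 'm, 'g) gmodule" where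
  "gsub M H = M\<lparr>carrier := H, homog := (\<lambda>b. H \<inter> homog M b)\<rparr>"

definition quot_module :: "('r, 'm, 'z) module_scheme \<Rightarrow> 'm set \<Rightarrow> ('r, 'm set) module" where
  "quot_module M H =
    \<lparr>carrier = a_rcosets\<^bsub>M\<^esub> H, mult = undefined, one = undefined,
     zero = H, add = set_add M,
     smult = (\<lambda>r X. \<Union>x\<in>X. H +>\<^bsub>M\<^esub> (r \<odot>\<^bsub>M\<^esub> x))\<rparr>"

definition gquot :: "('r, 'm, 'g) gmodule \<Rightarrow> 'm set \<Rightarrow> ('r, 'm set, 'g) gmodule" where
  "gquot M H = module.extend (quot_module M H)
     (gmodule.fields (\<lambda>b. (\<lambda>x. H +>\<^bsub>M\<^esub> x) ` homog M b))"


subsection \<open>Graded Hom\<close>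

definition hom_module ::
  "('r, 'z) ring_scheme \<Rightarrow> ('r, 'm, 'y) module_scheme \<Rightarrow> ('r, 'n, 'x) module_scheme
    \<Rightarrow> ('r, 'm \<Rightarrow> 'n) module" where
  "hom_module R M N =
    \<lparr>carrier = module_hom R M N \<inter> extensional (carrier M),
     mult = undefined, one = undefined,
     zero = (\<lambda>x\<in>carrier M. \<zero>\<^bsub>N\<^esub>),
     add = (\<lambda>f g. \<lambda>x\<in>carrier M. f x \<oplus>\<^bsub>N\<^esub> g x),
     smult = (\<lambda>r f. \<lambda>x\<in>carrier M. r \<odot>\<^bsub>N\<^esub> f x)\<rparr>"

definition hom_deg ::
  "('r, 'r, 'g) gmodule \<Rightarrow> ('r, 'm, 'g) gmodule \<Rightarrow> ('r, 'n, 'g) gmodule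
    \<Rightarrow> 'g::ab_group_add \<Rightarrow> ('m \<Rightarrow> 'n) set" where
  "hom_deg R M N b =
    {f \<in> carrier (hom_module R M N). \<forall>a. f ` homog M a \<subseteq> homog N (a + b)}"

text \<open>The graded Hom consists of the finite sums of homogeneous homomorphisms.\<close>

definition gHom ::
  "('r, 'r, 'g) gmodule \<Rightarrow> ('r, 'm, 'g) gmodule \<Rightarrow> ('r, 'n, 'g::ab_group_add) gmodule
    \<Rightarrow> ('r, 'm \<Rightarrow> 'n, 'g) gmodule" where
  "gHom R M N = module.extend
     ((hom_module R M N)
        \<lparr>carrier := generate (add_monoid (hom_module R M N)) (\<Union>b. hom_deg R M N b)\<rparr>)
     (gmodule.fields (hom_deg R M N))"


subsection \<open>Free modules\<close>

definition free_module :: "('r, 'z) ring_scheme \<Rightarrow> 'x set \<Rightarrow> ('r, 'x \<Rightarrow> 'r) module" where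
  "free_module R I =
    \<lparr>carrier = {c. range c \<subseteq> carrier R \<and> finite {x. c x \<noteq> \<zero>\<^bsub>R\<^esub>} \<and> {x. c x \<noteq> \<zero>\<^bsub>R\<^esub>} \<subseteq> I},
     mult = undefined, one = undefined,
     zero = (\<lambda>x. \<zero>\<^bsub>R\<^esub>),
     add = (\<lambda>c c'. \<lambda>x. c x \<oplus>\<^bsub>R\<^esub> c' x),
     smult = (\<lambda>r c. \<lambda>x. r \<otimes>\<^bsub>R\<^esub> c x)\<rparr>"

definition free_basis :: "('r, 'z) ring_scheme \<Rightarrow> 'x \<Rightarrow> 'x \<Rightarrow> 'r" where
  "free_basis R x = (\<lambda>y. if y = x then \<one>\<^bsub>R\<^esub> else \<zero>\<^bsub>R\<^esub>)"

text \<open>The linear map sending the basis element of \<open>x\<close> to the basis element of \<open>h x\<close>.\<close>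

definition free_map :: "('r, 'z) ring_scheme \<Rightarrow> ('x \<Rightarrow> 'y) \<Rightarrow> ('x \<Rightarrow> 'r) \<Rightarrow> 'y \<Rightarrow> 'r" where
  "free_map R h c = (\<lambda>y. \<Oplus>\<^bsub>R\<^esub>x\<in>{x. h x = y \<and> c x \<noteq> \<zero>\<^bsub>R\<^esub>}. c x)"

text \<open>The graded free module with basis \<open>I\<close>, where the basis element of \<open>x\<close> has degree \<open>\<delta> x\<close>.\<close>

definition free_gmodule ::
  "('r, 'r, 'g) gmodule \<Rightarrow> 'x set \<Rightarrow> ('x \<Rightarrow> 'g::ab_group_add) \<Rightarrow> ('r, 'x \<Rightarrow> 'r, 'g) gmodule" where
  "free_gmodule R I \<delta> = module.extend (free_module R I)
     (gmodule.fields (\<lambda>b. {c \<in> carrier (free_module R I). \<forall>x\<in>I. c x \<in> homog R (b - \<delta> x)}))"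


subsection \<open>Tensor products\<close>

text \<open>
  \<open>M \<otimes> N\<close> is the free module on the pairs \<open>(m, n)\<close> modulo the relations of bilinearity; its
  component of degree \<open>b\<close> consists of the sums of \<open>m \<otimes> n\<close> with \<open>m\<close> and \<open>n\<close> homogeneous of
  degrees adding up to \<open>b\<close>.
\<close>

definition tensor_free ::
  "('r, 'r, 'g) gmodule \<Rightarrow> ('r, 'm, 'g) gmodule \<Rightarrow> ('r, 'n, 'g) gmodule
    \<Rightarrow> ('r, 'm \<times> 'n \<Rightarrow> 'r) module" where
  "tensor_free R M N = free_module R (carrier M \<times> carrier N)"

definition tensor_rel ::
  "('r, 'r, 'g) gmodule \<Rightarrow> ('r, 'm, 'g) gmodule \<Rightarrow> ('r, 'n, 'g) gmodule
    \<Rightarrow> ('m \<times> 'n \<Rightarrow> 'r) set" where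
  "tensor_rel R M N =
    (let F = tensor_free R M N; e = free_basis R in
     LinearCombinations.module.span R F
      ({e (m \<oplus>\<^bsub>M\<^esub> m', n) \<ominus>\<^bsub>F\<^esub> (e (m, n) \<oplus>\<^bsub>F\<^esub> e (m', n)) | m m' n.
          m \<in> carrier M \<and> m' \<in> carrier M \<and> n \<in> carrier N} \<union>
       {e (m, n \<oplus>\<^bsub>N\<^esub> n') \<ominus>\<^bsub>F\<^esub> (e (m, n) \<oplus>\<^bsub>F\<^esub> e (m, n')) | m n n'.
          m \<in> carrier M \<and> n \<in> carrier N \<and> n' \<in> carrier N} \<union>
       {e (r \<odot>\<^bsub>M\<^esub> m, n) \<ominus>\<^bsub>F\<^esub> (r \<odot>\<^bsub>F\<^esub> e (m, n)) | r m n.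
          r \<in> carrier R \<and> m \<in> carrier M \<and> n \<in> carrier N} \<union>
       {e (m, r \<odot>\<^bsub>N\<^esub> n) \<ominus>\<^bsub>F\<^esub> (r \<odot>\<^bsub>F\<^esub> e (m, n)) | r m n.
          r \<in> carrier R \<and> m \<in> carrier M \<and> n \<in> carrier N}))"

definition tensor_elt ::
  "('r, 'r, 'g) gmodule \<Rightarrow> ('r, 'm, 'g) gmodule \<Rightarrow> ('r, 'n, 'g) gmodule
    \<Rightarrow> 'm \<Rightarrow> 'n \<Rightarrow> ('m \<times> 'n \<Rightarrow> 'r) set" where
  "tensor_elt R M N m n = tensor_rel R M N +>\<^bsub>tensor_free R M N\<^esub> free_basis R (m, n)"

definition gtensor ::
  "('r, 'r, 'g) gmodule \<Rightarrow> ('r, 'm, 'g) gmodule \<Rightarrow> ('r, 'n, 'g::ab_group_add) gmodule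
    \<Rightarrow> ('r, ('m \<times> 'n \<Rightarrow> 'r) set, 'g) gmodule" where
  "gtensor R M N =
    (let Q = quot_module (tensor_free R M N) (tensor_rel R M N) in
     module.extend Q (gmodule.fields (\<lambda>b.
       generate (add_monoid Q)
         {tensor_elt R M N m n | m n a a'. m \<in> homog M a \<and> n \<in> homog N a' \<and> a + a' = b})))"

text \<open>\<open>f \<otimes> N : M \<otimes> N \<rightarrow> M' \<otimes> N\<close> for \<open>f : M \<rightarrow> M'\<close>, on cosets.\<close>

definition tensor_map ::
  "('r, 'r, 'g) gmodule \<Rightarrow> ('r, 'm', 'g) gmodule \<Rightarrow> ('r, 'n, 'g) gmodule
    \<Rightarrow> ('m \<Rightarrow> 'm') \<Rightarrow> ('m \<times> 'n \<Rightarrow> 'r) set \<Rightarrow> ('m' \<times> 'n \<Rightarrow> 'r) set" where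
  "tensor_map R M' N f X =
    (\<Union>c\<in>X. tensor_rel R M' N +>\<^bsub>tensor_free R M' N\<^esub> free_map R (map_prod f id) c)"


section \<open>Graded Ext and Tor\<close>

record ('x, 'r, 'm, 'g) resolution =
  base :: "nat \<Rightarrow> 'x set"
  deg :: "nat \<Rightarrow> 'x \<Rightarrow> 'g"
  diff :: "nat \<Rightarrow> ('x \<Rightarrow> 'r) \<Rightarrow> 'x \<Rightarrow> 'r"
  aug :: "('x \<Rightarrow> 'r) \<Rightarrow> 'm"

definition res_module ::
  "('r, 'r, 'g) gmodule \<Rightarrow> ('x, 'r, 'm, 'g::ab_group_add) resolution \<Rightarrow> nat
    \<Rightarrow> ('r, 'x \<Rightarrow> 'r, 'g) gmodule" where
  "res_module R P i = free_gmodule R (base P i) (deg P i)"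

text \<open>
  An exact sequence \<open>\<dots> \<rightarrow> F\<^sub>2 \<rightarrow> F\<^sub>1 \<rightarrow> F\<^sub>0 \<rightarrow> M \<rightarrow> 0\<close> of graded modules and maps of degree \<open>0\<close>, with
  \<open>F\<^sub>i\<close> graded free and \<open>diff P i : F\<^sub>i\<^sub>+\<^sub>1 \<rightarrow> F\<^sub>i\<close>.
\<close>

definition free_resolution ::
  "('r, 'r, 'g) gmodule \<Rightarrow> ('r, 'm, 'g::ab_group_add) gmodule \<Rightarrow> ('x, 'r, 'm, 'g) resolution
    \<Rightarrow> bool" where
  "free_resolution R M P \<longleftrightarrow>
    (let F = res_module R P in
     aug P \<in> hom_deg R (F 0) M 0 \<and>
     (\<forall>i. diff P i \<in> hom_deg R (F (Suc i)) (F i) 0) \<and>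
     aug P ` carrier (F 0) = carrier M \<and>
     diff P 0 ` carrier (F 1) = a_kernel (F 0) M (aug P) \<and>
     (\<forall>i. diff P (Suc i) ` carrier (F (Suc (Suc i))) = a_kernel (F (Suc i)) (F i) (diff P i)))"

text \<open>
  As usual, derived functors are computed from a chosen resolution.  The bases of the free modules
  are taken in \<open>nat \<times> 'm\<close>.  When \<open>R\<close> is a polynomial ring in finitely many variables over a field
  with its fine grading, this type is large enough for a resolution of any graded module
  with elements in \<open>'m\<close>: the homogeneous components of the ring have dimension at most one and there
  are countably many degrees, so a free module on at most \<open>\<bar>nat \<times> 'm\<bar>\<close> homogeneous generators has
  all its graded submodules generated by at most \<open>\<bar>nat \<times> 'm\<bar>\<close> homogeneous elements.
\<close>

definition some_resolution ::
  "('r, 'r, 'g) gmodule \<Rightarrow> ('r, 'm, 'g::ab_group_add) gmodule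
    \<Rightarrow> (nat \<times> 'm, 'r, 'm, 'g) resolution" where
  "some_resolution R M = (SOME P. free_resolution R M P)"

text \<open>\<open>Ext\<^sup>i(M,N) = H\<^sup>i(Hom(F,N))\<close>, where \<open>F\<close> is the resolution of \<open>M\<close>.\<close>

definition gExt ::
  "('r, 'r, 'g) gmodule \<Rightarrow> nat \<Rightarrow> ('r, 'm, 'g) gmodule \<Rightarrow> ('r, 'n, 'g::ab_group_add) gmodule
    \<Rightarrow> ('r, ((nat \<times> 'm \<Rightarrow> 'r) \<Rightarrow> 'n) set, 'g) gmodule" where
  "gExt R i M N =
    (let P = some_resolution R M;
         F = res_module R P;
         C = (\<lambda>j. gHom R (F j) N);
         D = (\<lambda>j \<phi>. \<lambda>x\<in>carrier (F (Suc j)). \<phi> (diff P j x));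
         Z = a_kernel (C i) (C (Suc i)) (D i);
         B = (case i of 0 \<Rightarrow> {\<zero>\<^bsub>C 0\<^esub>} | Suc j \<Rightarrow> D j ` carrier (C j))
     in gquot (gsub (C i) Z) B)"

text \<open>\<open>Tor\<^sub>i(M,N) = H\<^sub>i(F \<otimes> N)\<close>, where \<open>F\<close> is the resolution of \<open>M\<close>.\<close>

definition gTor ::
  "('r, 'r, 'g) gmodule \<Rightarrow> nat \<Rightarrow> ('r, 'm, 'g) gmodule \<Rightarrow> ('r, 'n, 'g::ab_group_add) gmodule
    \<Rightarrow> ('r, ((nat \<times> 'm \<Rightarrow> 'r) \<times> 'n \<Rightarrow> 'r) set set, 'g) gmodule" where
  "gTor R i M N =
    (let P = some_resolution R M;
         F = res_module R P;
         C = (\<lambda>j. gtensor R (F j) N);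
         D = (\<lambda>j. tensor_map R (F j) N (diff P j));
         Z = (case i of 0 \<Rightarrow> carrier (C 0) | Suc j \<Rightarrow> a_kernel (C (Suc j)) (C j) (D j));
         B = D i ` carrier (C (Suc i))
     in gquot (gsub (C i) Z) B)"


section \<open>Laurent polynomials and monomial modules\<close>

text \<open>
  The Laurent polynomial ring \<open>T = k[x\<^sub>1\<^sup>\<plusminus>\<^sup>1, \<dots>, x\<^sub>n\<^sup>\<plusminus>\<^sup>1]\<close> is the group algebra of \<open>\<int>\<^sup>n\<close>, whose type is
  \<open>(int ^ 'n) \<Rightarrow>\<^sub>0 'k\<close> with convolution as multiplication.
\<close>

type_synonym ('k, 'n) laurent = "(int ^ 'n) \<Rightarrow>\<^sub>0 'k"

abbreviation xpow :: "int ^ 'n \<Rightarrow> ('k::field, 'n::finite) laurent" where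
  "xpow b \<equiv> Poly_Mapping.single b 1"

definition laurent_ring ::
  "(('k::field, 'n::finite) laurent, ('k, 'n) laurent, int ^ 'n) gmodule" where
  "laurent_ring =
    \<lparr>carrier = UNIV, mult = (*), one = 1, zero = 0, add = (+), smult = (*),
     homog = (\<lambda>b. range (Poly_Mapping.single b))\<rparr>"

definition poly_ring ::
  "(('k::field, 'n::finite) laurent, ('k, 'n) laurent, int ^ 'n) gmodule" where
  "poly_ring =
    gsub laurent_ring {f. \<forall>b\<in>Poly_Mapping.keys f. \<forall>j. 0 \<le> vec_nth b j}"

definition residue_module ::
  "(('k::field, 'n::finite) laurent, ('k, 'n) laurent set, int ^ 'n) gmodule" where
  "residue_module = gquot poly_ring (Idl\<^bsub>poly_ring\<^esub> (range (\<lambda>j. xpow (axis j 1))))"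

definition monomial_module :: "('k::field, 'n::finite) laurent set \<Rightarrow> bool" where
  "monomial_module M \<longleftrightarrow>
    Module.submodule M poly_ring laurent_ring \<and>
    (\<forall>f\<in>M. \<forall>b. Poly_Mapping.single b (Poly_Mapping.lookup f b) \<in> M)"

definition T_dual :: "('k::field, 'n::finite) laurent set \<Rightarrow> ('k, 'n) laurent set" where
  "T_dual M = {f. \<forall>b\<in>Poly_Mapping.keys f. xpow (- b) \<notin> M}"

lemma xpow_in_T_dual_iff: "xpow (- b) \<in> T_dual M \<longleftrightarrow> xpow b \<notin> M"
  by (simp add: T_dual_def)

lemma poly_ring_cring:
  "cring (poly_ring :: (('k::field, 'n::finite) laurent, ('k, 'n) laurent, int ^ 'n) gmodule)"
proof -
  let ?R = "poly_ring :: (('k, 'n) laurent, ('k, 'n) laurent, int ^ 'n) gmodule"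
  have mult_closed: "f * g \<in> carrier ?R" if "f \<in> carrier ?R" "g \<in> carrier ?R" for f g
  proof -
    have "0 \<le> vec_nth c j" if c: "c \<in> Poly_Mapping.keys (f * g)" for c j
    proof -
      obtain a b where "c = a + b" "a \<in> Poly_Mapping.keys f" "b \<in> Poly_Mapping.keys g"
        using keys_mult[of f g] c by auto
      then show ?thesis
        using \<open>f \<in> carrier ?R\<close> \<open>g \<in> carrier ?R\<close>
        by (auto simp: poly_ring_def gsub_def)
    qed
    then show ?thesis by (simp add: poly_ring_def gsub_def)
  qed
  have add_closed: "f + g \<in> carrier ?R" if "f \<in> carrier ?R" "g \<in> carrier ?R" for f g
    using that keys_add[of f g] by (fastforce simp: poly_ring_def gsub_def)
  have uminus: "- f \<in> carrier ?R" if "f \<in> carrier ?R" for f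
    using that by (simp add: poly_ring_def gsub_def)
  have ops: "mult ?R = (*)" "one ?R = 1" "zero ?R = 0" "add ?R = (+)"
    by (simp_all add: poly_ring_def gsub_def laurent_ring_def)
  have zero_one: "0 \<in> carrier ?R" "1 \<in> carrier ?R"
    by (simp_all add: poly_ring_def gsub_def)
  show ?thesis
  proof (rule cringI)
    show "abelian_group ?R"
    proof (rule abelian_groupI)
      show "\<exists>y\<in>carrier ?R. y \<oplus>\<^bsub>?R\<^esub> x = \<zero>\<^bsub>?R\<^esub>" if "x \<in> carrier ?R" for x
        using uminus[OF that] by (auto simp: ops intro!: bexI[of _ "- x"])
    qed (auto simp: ops zero_one add_closed algebra_simps)
    show "comm_monoid ?R"
      by (rule comm_monoidI) (auto simp: ops zero_one mult_closed algebra_simps)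
  qed (auto simp: ops algebra_simps)
qed

lemma laurent_ring_module:
  "Module.module poly_ring
     (laurent_ring :: (('k::field, 'n::finite) laurent, ('k, 'n) laurent, int ^ 'n) gmodule)"
proof (rule moduleI[OF poly_ring_cring])
  let ?T = "laurent_ring :: (('k, 'n) laurent, ('k, 'n) laurent, int ^ 'n) gmodule"
  show "abelian_group ?T"
  proof (rule abelian_groupI)
    show "\<exists>y\<in>carrier ?T. y \<oplus>\<^bsub>?T\<^esub> x = \<zero>\<^bsub>?T\<^esub>" if "x \<in> carrier ?T" for x
      by (auto simp: laurent_ring_def intro!: exI[of _ "- x"])
  qed (auto simp: laurent_ring_def algebra_simps)
qed (auto simp: laurent_ring_def poly_ring_def gsub_def algebra_simps)

lemma laurent_ring_uminus: "\<ominus>\<^bsub>laurent_ring\<^esub> f = - f"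
proof -
  interpret Module.module poly_ring laurent_ring
    by (rule laurent_ring_module)
  show ?thesis
    by (rule minus_equality) (simp_all add: laurent_ring_def)
qed

lemma monomial_moduleD:
  assumes "monomial_module M"
  shows "0 \<in> M" "\<And>f g. f \<in> M \<Longrightarrow> g \<in> M \<Longrightarrow> f + g \<in> M"
    "\<And>r f. r \<in> carrier poly_ring \<Longrightarrow> f \<in> M \<Longrightarrow> r * f \<in> M"
proof -
  interpret M: Module.submodule M poly_ring laurent_ring
    using assms by (simp add: monomial_module_def)
  show "0 \<in> M" "\<And>f g. f \<in> M \<Longrightarrow> g \<in> M \<Longrightarrow> f + g \<in> M"
    using M.one_closed M.m_closed by (simp_all add: laurent_ring_def)
  show "\<And>r f. r \<in> carrier poly_ring \<Longrightarrow> f \<in> M \<Longrightarrow> r * f \<in> M"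
    using M.smult_closed by (simp add: laurent_ring_def)
qed

lemma single_zero_in_poly_ring: "Poly_Mapping.single 0 c \<in> carrier poly_ring"
  by (simp add: poly_ring_def gsub_def)

lemma monomial_module_mem_iff:
  assumes "monomial_module M"
  shows "f \<in> M \<longleftrightarrow> (\<forall>b\<in>Poly_Mapping.keys f. xpow b \<in> M)"
proof
  assume f: "f \<in> M"
  show "\<forall>b\<in>Poly_Mapping.keys f. xpow b \<in> M"
  proof
    fix b assume b: "b \<in> Poly_Mapping.keys f"
    let ?c = "Poly_Mapping.lookup f b"
    have "Poly_Mapping.single b ?c \<in> M"
      using assms f by (simp add: monomial_module_def)
    from monomial_moduleD(3)[OF assms single_zero_in_poly_ring this, of "inverse ?c"]
    show "xpow b \<in> M"
      using b by (simp add: mult_single in_keys_iff)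
  qed
next
  assume keys: "\<forall>b\<in>Poly_Mapping.keys f. xpow b \<in> M"
  have *: "Poly_Mapping.single b c \<in> M" if "b \<in> Poly_Mapping.keys f" for b c
    using monomial_moduleD(3)[OF assms single_zero_in_poly_ring, of "xpow b" c] keys that
    by (simp add: mult_single)
  have "(\<Sum>b\<in>B. Poly_Mapping.single b (Poly_Mapping.lookup f b)) \<in> M"
    if "finite B" "B \<subseteq> Poly_Mapping.keys f" for B
    using that by (induction B) (auto intro: monomial_moduleD[OF assms] *)
  from this[OF finite_keys order_refl]
  have "(\<Sum>b\<in>Poly_Mapping.keys f. Poly_Mapping.single b (Poly_Mapping.lookup f b)) \<in> M" .
  moreover have "(\<Sum>b\<in>Poly_Mapping.keys f. Poly_Mapping.single b (Poly_Mapping.lookup f b)) = f"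
    by (rule poly_mapping_eqI) (simp add: lookup_sum lookup_single when_def in_keys_iff)
  ultimately show "f \<in> M" by simp
qed

lemma monomial_module_T_dual:
  fixes M :: "('k::field, 'n::finite) laurent set"
  assumes "monomial_module M"
  shows "monomial_module (T_dual M)"
  unfolding monomial_module_def
proof (intro conjI ballI allI)
  interpret Module.module poly_ring "laurent_ring :: (('k, 'n) laurent, ('k, 'n) laurent, int ^ 'n) gmodule"
    by (rule laurent_ring_module)
  show "Module.submodule (T_dual M) poly_ring laurent_ring"
  proof (rule submoduleI)
    fix r f :: "('k, 'n) laurent" assume r: "r \<in> carrier poly_ring" and f: "f \<in> T_dual M"
    have "xpow (- c) \<notin> M" if c: "c \<in> Poly_Mapping.keys (r * f)" for c
    proof
      assume xc: "xpow (- c) \<in> M"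
      obtain a b where ab: "c = a + b" "a \<in> Poly_Mapping.keys r" "b \<in> Poly_Mapping.keys f"
        using keys_mult[of r f] c by auto
      have "xpow a \<in> carrier poly_ring"
        using r ab by (simp add: poly_ring_def gsub_def)
      from monomial_moduleD(3)[OF assms this xc] have "xpow (- b) \<in> M"
        using ab by (simp add: mult_single)
      then show False
        using f ab by (simp add: T_dual_def)
    qed
    then show "r \<odot>\<^bsub>laurent_ring\<^esub> f \<in> T_dual M"
      by (simp add: T_dual_def laurent_ring_def)
  next
    fix f g assume "f \<in> T_dual M" "g \<in> T_dual M"
    then show "f \<oplus>\<^bsub>laurent_ring\<^esub> g \<in> T_dual M"
      using keys_add[of f g] by (fastforce simp: T_dual_def laurent_ring_def)
  qed (auto simp: T_dual_def laurent_ring_uminus, auto simp: laurent_ring_def)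
next
  fix f b assume "f \<in> T_dual M"
  then show "Poly_Mapping.single b (Poly_Mapping.lookup f b) \<in> T_dual M"
    by (auto simp: T_dual_def in_keys_iff)
qed

lemma T_dual_unique:
  assumes "monomial_module N" and "\<And>b. xpow (- b) \<in> N \<longleftrightarrow> xpow b \<notin> M"
  shows "N = T_dual M"
proof -
  have "xpow b \<in> N \<longleftrightarrow> xpow (- b) \<notin> M" for b
    using assms(2)[of "- b"] by simp
  then have "f \<in> N \<longleftrightarrow> f \<in> T_dual M" for f
    by (subst monomial_module_mem_iff[OF assms(1)]) (simp add: T_dual_def)
  then show ?thesis by blast
qed


section \<open>Bass and Betti numbers\<close>

text \<open>The component of degree \<open>b\<close>, a vector space over the constants \<open>k \<subseteq> S\<^sub>0\<close>.\<close>

definition component ::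
  "(('k::field, 'n::finite) laurent, 'm, int ^ 'n) gmodule \<Rightarrow> int ^ 'n \<Rightarrow> ('k, 'm) module" where
  "component N b =
    \<lparr>carrier = homog N b, mult = undefined, one = undefined, zero = \<zero>\<^bsub>N\<^esub>, add = add N,
     smult = (\<lambda>c x. Poly_Mapping.single 0 c \<odot>\<^bsub>N\<^esub> x)\<rparr>"

text \<open>\<open>vectorspace.dim\<close> is only meaningful for finite-dimensional spaces.\<close>

definition kdim :: "('k::field, 'm) module \<Rightarrow> enat" where
  "kdim V =
    (if vectorspace.fin_dim class_ring V then enat (vectorspace.dim class_ring V) else \<infinity>)"

definition bass_number ::
  "nat \<Rightarrow> int ^ 'n \<Rightarrow> (('k::field, 'n::finite) laurent, 'm, int ^ 'n) gmodule \<Rightarrow> enat" where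
  "bass_number i b N = kdim (component (gExt poly_ring i residue_module N) b)"

definition betti_number ::
  "nat \<Rightarrow> int ^ 'n \<Rightarrow> (('k::field, 'n::finite) laurent, 'm, int ^ 'n) gmodule \<Rightarrow> enat" where
  "betti_number i b N = kdim (component (gTor poly_ring i residue_module N) b)"

end

theory Submission
  imports Defs "HOL-Library.Function_Algebras"
begin

text \<open>
  Write \<open>N\<close> for the \<open>T\<close>-dual of \<open>M\<close>.  The graded module \<open>T/M\<close> is the graded \<open>k\<close>-dual of \<open>N\<close>: the
  product of \<open>t + M\<close> and \<open>n \<in> N\<close> has a well-defined coefficient at the monomial \<open>1\<close>, since no monomial of
  \<open>N\<close> is inverse to one of \<open>M\<close>, and in each degree this is a perfect pairing.  Let \<open>F\<close> be a graded
  free resolution of \<open>k\<close>.  Adjunction makes \<open>Hom(F, T/M)\<close> in degree \<open>b\<close> the \<open>k\<close>-dual of \<open>F \<otimes> N\<close> in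
  degree \<open>-b\<close>, and this identification respects the differentials.  Dualising vector spaces is exact, so
  \<open>Ext\<^sup>i(k, T/M)\<close> in degree \<open>b\<close> is the dual of \<open>Tor\<^sub>i(k, N)\<close> in degree \<open>-b\<close>.  A vector space and its dual
  have the same dimension when one of them is finite-dimensional, and otherwise both are
  infinite-dimensional.

  The calculations use representatives that are functions with values in \<open>T\<close>.  A homomorphism
  \<open>F \<rightarrow> T/M\<close> is represented by a lift \<open>g : F \<rightarrow> T\<close>, which exists because \<open>F\<close> is free (\<open>hom_lift\<close>), an
  element of \<open>F \<otimes> N\<close> by a formal linear combination \<open>c\<close> of pairs, and the duality by the \<open>pairing\<close> of \<open>g\<close>
  with \<open>c\<close>.  Adjunction is \<open>functional_is_pairing\<close>: every functional on the tensor product is, in a given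
  degree, the pairing with some \<open>g\<close>.  Exactness of the dual is the extension of functionals from a
  subspace (\<open>functional_extending_graph\<close>).  Together they show that the pairing of cocycles with cycles
  has the coboundaries (\<open>coboundaries_radical\<close>) and the boundaries (\<open>boundaries_radical\<close>) as its two
  radicals, and \<open>kdim_eq_by_pairing_of_representatives\<close> turns this into the equality of dimensions.

  Ext and Tor are taken from a chosen resolution, so one has to be exhibited.  The bar resolution serves
  for this (\<open>free_resolution_bar\<close>): its differential is defined by recursion so as to have a
  contracting homotopy, and its bases are countable.
\<close>

type_synonym ('k, 'n) poly_gmodule = "(('k, 'n) laurent, ('k, 'n) laurent, int ^ 'n) gmodule"

abbreviation "monomial \<equiv> Poly_Mapping.single"

section \<open>Dimensions through a perfect pairing\<close>

lemma nontrivial_relation: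
  fixes f :: "'v \<Rightarrow> 'w \<Rightarrow> 'k::field"
  assumes "finite A" "finite S" "card A < card S"
  shows "\<exists>a. (\<exists>w\<in>S. a w \<noteq> 0) \<and> (\<forall>v\<in>A. (\<Sum>w\<in>S. a w * f v w) = 0)"
  using assms
proof (induction A arbitrary: S f rule: finite_induct)
  case empty
  then have "S \<noteq> {}" by auto
  then show ?case by (auto intro!: exI[of _ "\<lambda>_. 1"])
next
  case (insert v A)
  show ?case
  proof (cases "\<forall>w\<in>S. f v w = 0")
    case True
    from insert.prems insert.hyps have "card A < card S" by simp
    from insert.IH[OF insert.prems(1) this, of f] True show ?thesis by auto
  next
    case False
    then obtain w0 where w0: "w0 \<in> S" "f v w0 \<noteq> 0" by auto
    define S' where "S' = S - {w0}"
    have S: "S = insert w0 S'" "w0 \<notin> S'" "finite S'" using w0 insert.prems by (auto simp: S'_def)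
    have "card A < card S'" using insert.prems insert.hyps S by simp
    \<comment> \<open>Gaussian elimination: row \<open>v\<close> is used to remove the unknown \<open>w0\<close>.\<close>
    define f' where "f' u w = f u w - f u w0 * f v w / f v w0" for u w
    obtain a where a: "\<exists>w\<in>S'. a w \<noteq> 0" "\<forall>u\<in>A. (\<Sum>w\<in>S'. a w * f' u w) = 0"
      using insert.IH[OF S(3) \<open>card A < card S'\<close>, of f'] by auto
    define c where "c = - (\<Sum>w\<in>S'. a w * f v w) / f v w0"
    define a' where "a' = a(w0 := c)"
    have sum: "(\<Sum>w\<in>S. a' w * f u w) = c * f u w0 + (\<Sum>w\<in>S'. a w * f u w)" for u
    proof -
      have "(\<Sum>w\<in>S'. a' w * f u w) = (\<Sum>w\<in>S'. a w * f u w)"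
        using S by (intro sum.cong) (auto simp: a'_def)
      then show ?thesis using S by (simp add: a'_def)
    qed
    have "(\<Sum>w\<in>S. a' w * f u w) = 0" if "u \<in> insert v A" for u
    proof (cases "u = v")
      case True
      then show ?thesis using w0 by (simp add: sum c_def)
    next
      case False
      have "(\<Sum>w\<in>S'. a w * f' u w) = (\<Sum>w\<in>S'. a w * f u w) - (\<Sum>w\<in>S'. a w * f v w) * (f u w0 / f v w0)"
        unfolding f'_def by (simp add: sum_subtractf sum_distrib_right right_diff_distrib mult.assoc)
         (simp add: sum_divide_distrib mult_ac)
      with a False that show ?thesis using w0 by (simp add: sum c_def field_simps)
    qed
    moreover have "\<exists>w\<in>S. a' w \<noteq> 0" using a(1) S by (auto simp: a'_def)
    ultimately show ?thesis by blast
  qed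
qed

lemma linear_lincomb:
  fixes V :: "('k::field, 'v) module" and h :: "'v \<Rightarrow> 'k"
  assumes V: "vectorspace class_ring V" and "finite A" "A \<subseteq> carrier V"
    and add: "\<And>v v'. v \<in> carrier V \<Longrightarrow> v' \<in> carrier V \<Longrightarrow> h (v \<oplus>\<^bsub>V\<^esub> v') = h v + h v'"
    and smult: "\<And>c v. v \<in> carrier V \<Longrightarrow> h (c \<odot>\<^bsub>V\<^esub> v) = c * h v"
  shows "h (LinearCombinations.module.lincomb V a A) = (\<Sum>v\<in>A. a v * h v)"
proof -
  interpret V: vectorspace class_ring V by (rule V)
  show ?thesis using assms(2,3)
  proof (induction A rule: finite_induct)
    case empty
    have "h (0 \<odot>\<^bsub>V\<^esub> \<zero>\<^bsub>V\<^esub>) = 0" by (subst smult) auto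
    then show ?case by (simp add: V.lincomb_def)
  next
    case (insert v A)
    have "V.lincomb a (insert v A) = a v \<odot>\<^bsub>V\<^esub> v \<oplus>\<^bsub>V\<^esub> V.lincomb a A"
      using insert.prems insert.hyps
      by (intro V.lincomb_insert2[folded insert_is_Un[of v A]]) auto
    moreover have "V.lincomb a A \<in> carrier V" using insert by (intro V.lincomb_closed) auto
    moreover have "a v \<odot>\<^bsub>V\<^esub> v \<in> carrier V" using insert by (intro V.smult_closed) auto
    ultimately show ?case
      using insert by (simp add: add smult)
  qed
qed

text \<open>
  More independent vectors of \<open>W\<close> than there are vectors in a basis of \<open>V\<close> would have a nontrivial
  combination orthogonal to that basis, hence to \<open>V\<close>.
\<close>

lemma nondegenerate_pairing_dim_le:
  fixes V :: "('k::field, 'v) module" and W :: "('k, 'w) module" and B :: "'v \<Rightarrow> 'w \<Rightarrow> 'k"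
  assumes V: "vectorspace class_ring V" and W: "vectorspace class_ring W"
    and addV: "\<And>v v' w. v \<in> carrier V \<Longrightarrow> v' \<in> carrier V \<Longrightarrow> w \<in> carrier W \<Longrightarrow>
      B (v \<oplus>\<^bsub>V\<^esub> v') w = B v w + B v' w"
    and smultV: "\<And>c v w. v \<in> carrier V \<Longrightarrow> w \<in> carrier W \<Longrightarrow> B (c \<odot>\<^bsub>V\<^esub> v) w = c * B v w"
    and addW: "\<And>v w w'. v \<in> carrier V \<Longrightarrow> w \<in> carrier W \<Longrightarrow> w' \<in> carrier W \<Longrightarrow>
      B v (w \<oplus>\<^bsub>W\<^esub> w') = B v w + B v w'"
    and smultW: "\<And>c v w. v \<in> carrier V \<Longrightarrow> w \<in> carrier W \<Longrightarrow> B v (c \<odot>\<^bsub>W\<^esub> w) = c * B v w"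
    and nondeg: "\<And>w. w \<in> carrier W \<Longrightarrow> (\<And>v. v \<in> carrier V \<Longrightarrow> B v w = 0) \<Longrightarrow> w = \<zero>\<^bsub>W\<^esub>"
    and fin: "vectorspace.fin_dim class_ring V"
  shows "vectorspace.fin_dim class_ring W \<and>
    vectorspace.dim class_ring W \<le> vectorspace.dim class_ring V"
proof -
  interpret V: vectorspace class_ring V by (rule V)
  interpret W: vectorspace class_ring W by (rule W)
  obtain A where A: "finite A" "V.basis A" using V.finite_basis_exists[OF fin] by auto
  have Ac: "A \<subseteq> carrier V" "V.span A = carrier V" using A by (auto simp: V.basis_def)
  have le: "card S \<le> card A" if S: "S \<subseteq> carrier W" "finite S" "W.lin_indpt S" for S
  proof (rule ccontr)
    assume "\<not> card S \<le> card A"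
    then have "card A < card S" by simp
    from nontrivial_relation[OF A(1) S(2) this, of B] obtain a where
      a: "\<exists>w\<in>S. a w \<noteq> 0" "\<forall>v\<in>A. (\<Sum>w\<in>S. a w * B v w) = 0" by auto
    define z where "z = W.lincomb a S"
    have z: "z \<in> carrier W" unfolding z_def using S by (intro W.lincomb_closed) auto
    have "B v z = 0" if v: "v \<in> A" for v
      unfolding z_def using v a Ac S by (subst linear_lincomb[OF W]) (auto simp: addW smultW)
    then have "B (V.lincomb c A) z = 0" for c
      using Ac A z by (subst linear_lincomb[OF V, where h = "\<lambda>v. B v z"]) (auto simp: addV smultV)
    then have "B v z = 0" if "v \<in> carrier V" for v
      using that V.finite_span[OF A(1) Ac(1)] Ac(2) by auto
    with nondeg[OF z] have "z = \<zero>\<^bsub>W\<^esub>" by simp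
    then show False using S a unfolding z_def W.lin_dep_def by auto
  qed
  have bound: "finite S \<and> card S \<le> card A" if S: "S \<subseteq> carrier W \<and> W.lin_indpt S" for S
  proof (cases "finite S")
    case True
    then show ?thesis using le S by auto
  next
    case False
    then obtain S' where S': "S' \<subseteq> S" "finite S'" "card S' = Suc (card A)"
      by (metis infinite_arbitrarily_large)
    then have "W.lin_indpt S'" using S W.supset_ld_is_ld by blast
    with le[of S'] S S' show ?thesis by auto
  qed
  have "{} \<subseteq> carrier W \<and> W.lin_indpt {}" by (auto simp: W.lin_dep_def)
  from maximal_exists[of "\<lambda>S. S \<subseteq> carrier W \<and> W.lin_indpt S" "card A" "{}", OF bound this]
  obtain S where S: "finite S" "maximal S (\<lambda>S. S \<subseteq> carrier W \<and> W.lin_indpt S)" by auto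
  have bas: "W.basis S" by (rule W.max_li_is_basis[OF S(2)])
  then have "W.fin_dim" using S unfolding W.fin_dim_def W.basis_def by auto
  moreover have "W.dim \<le> V.dim"
    using W.dim_basis[OF S(1) bas] V.dim_basis[OF A] bound[of S] bas unfolding W.basis_def by auto
  ultimately show ?thesis ..
qed

lemma kdim_eq_by_nondegenerate_pairing:
  fixes V :: "('k::field, 'v) module" and W :: "('k, 'w) module" and B :: "'v \<Rightarrow> 'w \<Rightarrow> 'k"
  assumes V: "vectorspace class_ring V" and W: "vectorspace class_ring W"
    and addV: "\<And>v v' w. v \<in> carrier V \<Longrightarrow> v' \<in> carrier V \<Longrightarrow> w \<in> carrier W \<Longrightarrow>
      B (v \<oplus>\<^bsub>V\<^esub> v') w = B v w + B v' w"
    and smultV: "\<And>c v w. v \<in> carrier V \<Longrightarrow> w \<in> carrier W \<Longrightarrow> B (c \<odot>\<^bsub>V\<^esub> v) w = c * B v w"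
    and addW: "\<And>v w w'. v \<in> carrier V \<Longrightarrow> w \<in> carrier W \<Longrightarrow> w' \<in> carrier W \<Longrightarrow>
      B v (w \<oplus>\<^bsub>W\<^esub> w') = B v w + B v w'"
    and smultW: "\<And>c v w. v \<in> carrier V \<Longrightarrow> w \<in> carrier W \<Longrightarrow> B v (c \<odot>\<^bsub>W\<^esub> w) = c * B v w"
    and nondegW: "\<And>w. w \<in> carrier W \<Longrightarrow> (\<And>v. v \<in> carrier V \<Longrightarrow> B v w = 0) \<Longrightarrow> w = \<zero>\<^bsub>W\<^esub>"
    and nondegV: "\<And>v. v \<in> carrier V \<Longrightarrow> (\<And>w. w \<in> carrier W \<Longrightarrow> B v w = 0) \<Longrightarrow> v = \<zero>\<^bsub>V\<^esub>"
  shows "kdim V = kdim W"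
proof -
  let ?fin = "vectorspace.fin_dim class_ring" and ?dim = "vectorspace.dim class_ring"
  have VW: "?fin W \<and> ?dim W \<le> ?dim V" if "?fin V"
    by (rule nondegenerate_pairing_dim_le[OF V W, of B])
      (fact addV smultV addW smultW nondegW that)+
  have WV: "?fin V \<and> ?dim V \<le> ?dim W" if "?fin W"
    by (rule nondegenerate_pairing_dim_le[OF W V, of "\<lambda>w v. B v w"])
      (auto simp: addV smultV addW smultW that intro: nondegV)
  have "?fin V \<longleftrightarrow> ?fin W" using VW WV by blast
  moreover have "?dim V = ?dim W" if "?fin V"
    using VW[OF that] WV by (intro antisym) blast+
  ultimately show ?thesis by (simp add: kdim_def)
qed


section \<open>Vector spaces presented by representatives\<close>

text \<open>
  All vector spaces of representatives consist of functions with values in \<open>T\<close>, on which \<open>k\<close> acts through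
  the constants of \<open>T\<close>.  The advantage over carrier-based spaces is that their addition is total
  and known.
\<close>

definition fscale :: "'k::field \<Rightarrow> ('p \<Rightarrow> ('k, 'n::finite) laurent) \<Rightarrow> 'p \<Rightarrow> ('k, 'n) laurent" where
  "fscale c u = (\<lambda>p. monomial 0 c * u p)"

lemma fscale_apply: "fscale c u p = monomial 0 c * u p"
  by (simp add: fscale_def)

interpretation fs: vector_space "fscale :: 'k::field \<Rightarrow> ('p \<Rightarrow> ('k, 'n::finite) laurent) \<Rightarrow> _"
  by unfold_locales
    (auto simp: fscale_def fun_eq_iff algebra_simps single_add mult_single mult.assoc[symmetric])

text \<open>
  The map \<open>\<rho>\<close> from representatives onto \<open>V\<close> is linear but need not be injective.
\<close>

definition presents ::
  "('p \<Rightarrow> ('k::field, 'n::finite) laurent) set \<Rightarrow> (('p \<Rightarrow> ('k, 'n) laurent) \<Rightarrow> 'v)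
    \<Rightarrow> ('k, 'v) module \<Rightarrow> bool" where
  "presents U \<rho> V \<longleftrightarrow> fs.subspace U \<and> carrier V = \<rho> ` U \<and> \<zero>\<^bsub>V\<^esub> = \<rho> 0 \<and>
     (\<forall>a\<in>U. \<forall>b\<in>U. \<rho> a \<oplus>\<^bsub>V\<^esub> \<rho> b = \<rho> (a + b)) \<and>
     (\<forall>c. \<forall>a\<in>U. c \<odot>\<^bsub>V\<^esub> \<rho> a = \<rho> (fscale c a))"

lemma presents_vectorspace:
  fixes V :: "('k::field, 'v) module" and U :: "('p \<Rightarrow> ('k, 'n::finite) laurent) set"
  assumes "presents U \<rho> V"
  shows "vectorspace class_ring V"
proof -
  have sub: "fs.subspace U" and car: "carrier V = \<rho> ` U" and zero: "\<zero>\<^bsub>V\<^esub> = \<rho> 0"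
    and add: "\<And>a b. a \<in> U \<Longrightarrow> b \<in> U \<Longrightarrow> \<rho> a \<oplus>\<^bsub>V\<^esub> \<rho> b = \<rho> (a + b)"
    and smult: "\<And>c a. a \<in> U \<Longrightarrow> c \<odot>\<^bsub>V\<^esub> \<rho> a = \<rho> (fscale c a)"
    using assms by (auto simp: presents_def)
  note mem = fs.subspace_0[OF sub] fs.subspace_add[OF sub] fs.subspace_scale[OF sub] fs.subspace_neg[OF sub]
  have field: "field (class_ring :: 'k ring)" by (rule class_field.field_axioms)
  have neg: "\<forall>v\<in>carrier V. \<exists>neg_v\<in>carrier V. v \<oplus>\<^bsub>V\<^esub> neg_v = \<zero>\<^bsub>V\<^esub>"
  proof
    fix v assume "v \<in> carrier V"
    then obtain a where a: "a \<in> U" "v = \<rho> a" by (auto simp: car)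
    then have "v \<oplus>\<^bsub>V\<^esub> \<rho> (- a) = \<zero>\<^bsub>V\<^esub>" using mem by (simp add: add zero)
    then show "\<exists>neg_v\<in>carrier V. v \<oplus>\<^bsub>V\<^esub> neg_v = \<zero>\<^bsub>V\<^esub>" using a mem by (auto simp: car)
  qed
  have comm: "\<forall>v w. v \<in> carrier V \<and> w \<in> carrier V \<longrightarrow> v \<oplus>\<^bsub>V\<^esub> w = w \<oplus>\<^bsub>V\<^esub> v"
    by (auto simp: car add add.commute)
  show ?thesis
    by (rule vs_criteria[OF field _ _ neg _ comm])
      (auto simp: car add smult zero mem add.assoc fs.scale_left_distrib fs.scale_right_distrib)
qed

text \<open>
  A pairing of representatives whose radicals are the kernels of \<open>\<rho>\<close> and \<open>\<sigma>\<close> descends to a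
  nondegenerate pairing of \<open>V\<close> and \<open>W\<close>.
\<close>

lemma kdim_eq_by_pairing_of_representatives:
  fixes V :: "('k::field, 'v) module" and U :: "('p \<Rightarrow> ('k, 'n::finite) laurent) set"
    and W :: "('k, 'w) module" and X :: "('q \<Rightarrow> ('k, 'n) laurent) set"
  assumes V: "presents U \<rho> V" and W: "presents X \<sigma> W"
    and addU: "\<And>a b x. a \<in> U \<Longrightarrow> b \<in> U \<Longrightarrow> x \<in> X \<Longrightarrow> \<beta> (a + b) x = \<beta> a x + (\<beta> b x :: 'k)"
    and scaleU: "\<And>c a x. a \<in> U \<Longrightarrow> x \<in> X \<Longrightarrow> \<beta> (fscale c a) x = c * \<beta> a x"
    and addX: "\<And>a x y. a \<in> U \<Longrightarrow> x \<in> X \<Longrightarrow> y \<in> X \<Longrightarrow> \<beta> a (x + y) = \<beta> a x + \<beta> a y"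
    and scaleX: "\<And>c a x. a \<in> U \<Longrightarrow> x \<in> X \<Longrightarrow> \<beta> a (fscale c x) = c * \<beta> a x"
    and radU: "\<And>a. a \<in> U \<Longrightarrow> \<rho> a = \<rho> 0 \<longleftrightarrow> (\<forall>x\<in>X. \<beta> a x = 0)"
    and radX: "\<And>x. x \<in> X \<Longrightarrow> \<sigma> x = \<sigma> 0 \<longleftrightarrow> (\<forall>a\<in>U. \<beta> a x = 0)"
  shows "kdim V = kdim W"
proof -
  note pres = V[unfolded presents_def] W[unfolded presents_def]
  have sub: "fs.subspace U" "fs.subspace X" using pres by auto
  note memU = fs.subspace_add[OF sub(1)] fs.subspace_scale[OF sub(1)] fs.subspace_neg[OF sub(1)]
  note memX = fs.subspace_add[OF sub(2)] fs.subspace_scale[OF sub(2)] fs.subspace_neg[OF sub(2)]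
  define r where "r v = (SOME a. a \<in> U \<and> \<rho> a = v)" for v
  define s where "s w = (SOME x. x \<in> X \<and> \<sigma> x = w)" for w
  have r: "r (\<rho> a) \<in> U \<and> \<rho> (r (\<rho> a)) = \<rho> a" if "a \<in> U" for a
    unfolding r_def by (rule someI[of _ a]) (use that in auto)
  have s: "s (\<sigma> x) \<in> X \<and> \<sigma> (s (\<sigma> x)) = \<sigma> x" if "x \<in> X" for x
    unfolding s_def by (rule someI[of _ x]) (use that in auto)
  have opV: "\<rho> a \<oplus>\<^bsub>V\<^esub> \<rho> b = \<rho> (a + b)" "c \<odot>\<^bsub>V\<^esub> \<rho> a = \<rho> (fscale c a)" "\<zero>\<^bsub>V\<^esub> = \<rho> 0"
    if "a \<in> U" "b \<in> U" for a b c using pres that by auto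
  have opW: "\<sigma> a \<oplus>\<^bsub>W\<^esub> \<sigma> b = \<sigma> (a + b)" "c \<odot>\<^bsub>W\<^esub> \<sigma> a = \<sigma> (fscale c a)" "\<zero>\<^bsub>W\<^esub> = \<sigma> 0"
    if "a \<in> X" "b \<in> X" for a b c using pres that by auto
  have U_cong: "\<beta> a x = \<beta> b x" if "a \<in> U" "b \<in> U" "\<rho> a = \<rho> b" "x \<in> X" for a b x
  proof -
    have nb: "- b \<in> U" using that memU by auto
    have "\<rho> (a + - b) = \<rho> (b + - b)"
      using opV(1)[OF that(1) nb] opV(1)[OF that(2) nb] that(3) by simp
    then have "\<beta> (a + - b) x = 0" using radU[of "a + - b"] memU(1)[OF that(1) nb] that(4) by simp
    moreover have "\<beta> (- b) x = - \<beta> b x" using scaleU[OF that(2,4), of "-1"] by simp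
    ultimately show ?thesis using addU[OF that(1) nb that(4)] by simp
  qed
  have X_cong: "\<beta> a x = \<beta> a y" if "a \<in> U" "x \<in> X" "y \<in> X" "\<sigma> x = \<sigma> y" for a x y
  proof -
    have ny: "- y \<in> X" using that memX by auto
    have "\<sigma> (x + - y) = \<sigma> (y + - y)"
      using opW(1)[OF that(2) ny] opW(1)[OF that(3) ny] that(4) by simp
    then have "\<beta> a (x + - y) = 0" using radX[of "x + - y"] memX(1)[OF that(2) ny] that(1) by simp
    moreover have "\<beta> a (- y) = - \<beta> a y" using scaleX[OF that(1,3), of "-1"] by simp
    ultimately show ?thesis using addX[OF that(1,2) ny] by simp
  qed
  define B where "B v w = \<beta> (r v) (s w)" for v w
  have B: "B (\<rho> a) (\<sigma> x) = \<beta> a x" if "a \<in> U" "x \<in> X" for a x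
    using U_cong[of "r (\<rho> a)" a "s (\<sigma> x)"] X_cong[of a "s (\<sigma> x)" x] r s that by (auto simp: B_def)
  have carV: "v \<in> carrier V \<longleftrightarrow> (\<exists>a\<in>U. v = \<rho> a)" and carW: "w \<in> carrier W \<longleftrightarrow> (\<exists>x\<in>X. w = \<sigma> x)" for v w
    using pres by auto
  show ?thesis
  proof (rule kdim_eq_by_nondegenerate_pairing[OF presents_vectorspace[OF V] presents_vectorspace[OF W], of B])
    fix w assume "w \<in> carrier W" and *: "\<And>v. v \<in> carrier V \<Longrightarrow> B v w = 0"
    then obtain x where x: "x \<in> X" "w = \<sigma> x" by (auto simp: carW)
    have "\<forall>a\<in>U. \<beta> a x = 0"
    proof
      fix a assume "a \<in> U"
      then show "\<beta> a x = 0" using *[of "\<rho> a"] B[of a x] x carV by auto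
    qed
    then show "w = \<zero>\<^bsub>W\<^esub>" using radX x opW(3) by auto
  next
    fix v assume "v \<in> carrier V" and *: "\<And>w. w \<in> carrier W \<Longrightarrow> B v w = 0"
    then obtain a where a: "a \<in> U" "v = \<rho> a" by (auto simp: carV)
    have "\<forall>x\<in>X. \<beta> a x = 0"
    proof
      fix x assume "x \<in> X"
      then show "\<beta> a x = 0" using *[of "\<sigma> x"] B[of a x] a carW by auto
    qed
    then show "v = \<zero>\<^bsub>V\<^esub>" using radU a opV(3) by auto
  qed (auto simp: carV carW opV opW B addU addX scaleU scaleX memU memX)
qed


lemma gmodule_record_simps:
  "carrier (gsub C Z) = Z" "add (gsub C Z) = add C" "smult (gsub C Z) = smult C"
  "zero (gsub C Z) = zero C" "homog (gsub C Z) b = Z \<inter> homog C b"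
  "carrier (gquot C H) = a_rcosets\<^bsub>C\<^esub> H" "add (gquot C H) = set_add C" "zero (gquot C H) = H"
  "smult (gquot C H) = (\<lambda>r X. \<Union>x\<in>X. H +>\<^bsub>C\<^esub> (r \<odot>\<^bsub>C\<^esub> x))"
  "homog (gquot C H) b = (\<lambda>x. H +>\<^bsub>C\<^esub> x) ` homog C b"
  by (simp_all add: gsub_def gquot_def quot_module_def module.defs gmodule.defs)

lemma coset_gsub: "H +>\<^bsub>gsub C Z\<^esub> x = H +>\<^bsub>C\<^esub> x"
  by (simp add: a_r_coset_def r_coset_def gmodule_record_simps)

lemma set_add_gsub: "set_add (gsub C Z) = set_add C"
  by (simp add: fun_eq_iff set_add_def set_mult_def gmodule_record_simps)

text \<open>
  The modules below are nested quotients (\<open>Tor\<close> consists of cosets of cosets).  Every layer is named by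
  the same functions, and what changes from layer to layer is when two of them name the same element.
\<close>

locale represented =
  fixes A :: "('p \<Rightarrow> ('k::field, 'n::finite) laurent) set"
    and lam :: "('p \<Rightarrow> ('k, 'n) laurent) \<Rightarrow> 'm"
    and G :: "(('k, 'n) laurent, 'm, 'z) module_scheme" (structure)
  assumes subspace_A: "fs.subspace A"
    and carrier_eq: "carrier G = lam ` A"
    and zero_eq: "\<zero> = lam 0"
    and add_eq: "a \<in> A \<Longrightarrow> b \<in> A \<Longrightarrow> lam a \<oplus> lam b = lam (a + b)"
    and smult_eq: "a \<in> A \<Longrightarrow> monomial 0 c \<odot> lam a = lam (fscale c a)"
begin

lemmas mem = fs.subspace_0[OF subspace_A] fs.subspace_add[OF subspace_A]
  fs.subspace_scale[OF subspace_A] fs.subspace_neg[OF subspace_A]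

lemma inv_eq:
  assumes a: "a \<in> A"
  shows "inv\<^bsub>add_monoid G\<^esub> lam a = lam (- a)"
  unfolding m_inv_def
proof (rule the_equality)
  show "lam (- a) \<in> carrier (add_monoid G) \<and> lam a \<otimes>\<^bsub>add_monoid G\<^esub> lam (- a) = \<one>\<^bsub>add_monoid G\<^esub> \<and>
    lam (- a) \<otimes>\<^bsub>add_monoid G\<^esub> lam a = \<one>\<^bsub>add_monoid G\<^esub>"
    using a mem by (auto simp: carrier_eq add_eq zero_eq)
  fix y assume "y \<in> carrier (add_monoid G) \<and> lam a \<otimes>\<^bsub>add_monoid G\<^esub> y = \<one>\<^bsub>add_monoid G\<^esub> \<and>
    y \<otimes>\<^bsub>add_monoid G\<^esub> lam a = \<one>\<^bsub>add_monoid G\<^esub>"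
  then obtain b where b: "b \<in> A" "y = lam b" "lam a \<oplus> y = \<zero>" by (auto simp: carrier_eq)
  then have "lam (a + b) = lam 0" using a by (simp add: add_eq zero_eq)
  then have "lam (- a) \<oplus> lam (a + b) = lam (- a) \<oplus> lam 0" by simp
  then show "y = lam (- a)" using a b mem by (simp add: add_eq)
qed

text \<open>
  The components of the graded Hom and of the tensor product are defined as generated subgroups.  A
  generating set that is closed under scaling generates its linear span.
\<close>

lemma generate_image:
  assumes S: "S \<subseteq> A" and scale: "\<And>c s. s \<in> S \<Longrightarrow> fscale c s \<in> S"
  shows "generate (add_monoid G) (lam ` S) = lam ` fs.span S"
proof
  have span: "fs.span S \<subseteq> A" using fs.span_minimal[OF S subspace_A] .
  show "generate (add_monoid G) (lam ` S) \<subseteq> lam ` fs.span S"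
  proof
    fix x assume "x \<in> generate (add_monoid G) (lam ` S)"
    then show "x \<in> lam ` fs.span S"
    proof induction
      case one
      then show ?case using fs.span_zero zero_eq by auto
    next
      case (incl h)
      then show ?case using fs.span_base by auto
    next
      case (inv h)
      then obtain s where s: "s \<in> S" "h = lam s" by auto
      have "- s \<in> fs.span S" by (intro fs.span_neg fs.span_base s(1))
      then show ?case using s S by (auto simp: inv_eq subsetD)
    next
      case (eng h1 h2)
      then obtain a b where "a \<in> fs.span S" "h1 = lam a" "b \<in> fs.span S" "h2 = lam b" by auto
      then show ?case using span fs.span_add[of a S b] by (auto simp: add_eq subsetD)
    qed
  qed
  have "x \<in> A \<and> lam x \<in> generate (add_monoid G) (lam ` S)" if "x \<in> fs.span S" for x
    using that
  proof (induction rule: fs.span_induct_alt)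
    case base
    show ?case using generate.one[of "add_monoid G" "lam ` S"] mem(1) by (simp add: zero_eq zero_fun_def)
  next
    case (step c s y)
    have "lam (fscale c s) \<in> generate (add_monoid G) (lam ` S)"
      using scale[OF step(1)] by (intro generate.incl) auto
    moreover have "fscale c s \<in> A" using scale[OF step(1)] S by auto
    ultimately show ?case
      using step(2) generate.eng[of "lam (fscale c s)" "add_monoid G" "lam ` S" "lam y"]
        add_eq[of "fscale c s" y] mem(2)[of "fscale c s" y] by (simp add: plus_fun_def)
  qed
  then show "lam ` fs.span S \<subseteq> generate (add_monoid G) (lam ` S)" by auto
qed

context
  fixes H
  assumes H: "fs.subspace H" "H \<subseteq> A"
begin

lemma coset_eq: "a \<in> A \<Longrightarrow> lam ` H +> lam a = (\<lambda>h. lam (h + a)) ` H"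
  using H by (auto simp: a_r_coset_def r_coset_def add_eq subset_iff)

lemma mem_H: "0 \<in> H" "h \<in> H \<Longrightarrow> h' \<in> H \<Longrightarrow> h + h' \<in> H" "h \<in> H \<Longrightarrow> fscale c h \<in> H"
  using fs.subspace_0[OF H(1)] fs.subspace_add[OF H(1)] fs.subspace_scale[OF H(1)] by auto

lemma set_add_coset:
  assumes a: "a \<in> A" and b: "b \<in> A"
  shows "(lam ` H +> lam a) <+> (lam ` H +> lam b) = lam ` H +> lam (a + b)"
proof -
  have "lam (h + a) \<oplus> lam (h' + b) = lam ((h + h') + (a + b))" if "h \<in> H" "h' \<in> H" for h h'
    using that H mem a b by (subst add_eq) (auto simp: add_ac)
  then have "(lam ` H +> lam a) <+> (lam ` H +> lam b)
      = (\<Union>h\<in>H. \<Union>h'\<in>H. {lam ((h + h') + (a + b))})"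
    by (simp add: coset_eq a b set_add_def set_mult_def)
  also have "\<dots> = (\<lambda>h. lam (h + (a + b))) ` H"
  proof
    show "(\<Union>h\<in>H. \<Union>h'\<in>H. {lam ((h + h') + (a + b))}) \<subseteq> (\<lambda>h. lam (h + (a + b))) ` H"
      using mem_H(2) by auto
    show "(\<lambda>h. lam (h + (a + b))) ` H \<subseteq> (\<Union>h\<in>H. \<Union>h'\<in>H. {lam ((h + h') + (a + b))})"
      using mem_H(1) by force
  qed
  finally show ?thesis using mem a b by (simp add: coset_eq)
qed

text \<open>
  The map \<open>lam\<close> may fail to be injective, so a coset is trivial as soon as \<open>a\<close> has the same image as some
  element of \<open>H\<close>, whether or not \<open>a\<close> itself lies in \<open>H\<close>.
\<close>

lemma coset_eq_iff:
  assumes a: "a \<in> A"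
  shows "lam ` H +> lam a = lam ` H +> lam 0 \<longleftrightarrow> (\<exists>h\<in>H. lam a = lam h)"
proof
  assume "lam ` H +> lam a = lam ` H +> lam 0"
  then have "lam (0 + a) \<in> (\<lambda>h. lam (h + 0)) ` H"
    using coset_eq[OF a] coset_eq[OF mem(1)] mem_H(1) by blast
  then show "\<exists>h\<in>H. lam a = lam h" by auto
next
  assume "\<exists>h\<in>H. lam a = lam h"
  then obtain h where h: "h \<in> H" "lam a = lam h" by auto
  have *: "lam (k + a) = lam (k + h)" if "k \<in> H" for k
    using add_eq[of k a] add_eq[of k h] that h H a by auto
  have "(\<lambda>k. lam (k + a)) ` H = lam ` (\<lambda>k. k + h) ` H"
    unfolding image_image using * by (auto intro!: image_cong)
  also have "(\<lambda>k. k + h) ` H = H"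
  proof
    show "(\<lambda>k. k + h) ` H \<subseteq> H" using h mem_H by auto
    show "H \<subseteq> (\<lambda>k. k + h) ` H"
    proof
      fix k assume k: "k \<in> H"
      have "k - h \<in> H" using fs.subspace_diff[OF H(1) k h(1)] .
      moreover have "k = (k - h) + h" by simp
      ultimately show "k \<in> (\<lambda>k. k + h) ` H" by blast
    qed
  qed
  finally show "lam ` H +> lam a = lam ` H +> lam 0"
    unfolding coset_eq[OF a] coset_eq[OF mem(1)] by (simp only: add_0_right)
qed

lemma coset_zero: "lam ` H +> lam 0 = lam ` H"
  unfolding coset_eq[OF mem(1)] by (simp only: add_0_right)

lemma smult_coset:
  assumes a: "a \<in> A"
  shows "(\<Union>x\<in>lam ` H +> lam a. lam ` H +> (monomial 0 c \<odot> x)) = lam ` H +> lam (fscale c a)"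
proof -
  have sa: "fscale c a \<in> A" using mem a by auto
  have "lam ` H +> (monomial 0 c \<odot> lam (h + a)) = lam ` H +> lam (fscale c a)"
    if h: "h \<in> H" for h
  proof -
    have hA: "h + a \<in> A" "fscale c h \<in> A" using h H mem a by auto
    have "monomial 0 c \<odot> lam (h + a) = lam (fscale c h + fscale c a)"
      using hA by (simp add: smult_eq fs.scale_right_distrib)
    also have "lam ` H +> \<dots> = (lam ` H +> lam (fscale c h)) <+> (lam ` H +> lam (fscale c a))"
      using hA sa by (simp add: set_add_coset)
    also have "lam ` H +> lam (fscale c h) = lam ` H +> lam 0"
      using hA(2) mem_H(3)[OF h] by (subst coset_eq_iff) auto
    also have "(lam ` H +> lam 0) <+> (lam ` H +> lam (fscale c a)) = lam ` H +> lam (fscale c a)"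
      using sa mem(1) by (simp add: set_add_coset)
    finally show ?thesis .
  qed
  then show ?thesis using mem_H(1) a by (auto simp: coset_eq)
qed

end

end

lemma (in represented) represented_quotient:
  assumes H: "fs.subspace H" "H \<subseteq> A"
  shows "represented A (\<lambda>a. lam ` H +> lam a) (quot_module G (lam ` H))"
proof
  show "carrier (quot_module G (lam ` H)) = (\<lambda>a. lam ` H +> lam a) ` A"
    by (auto simp: quot_module_def A_RCOSETS_def RCOSETS_def a_r_coset_def carrier_eq)
qed (use set_add_coset[OF H] smult_coset[OF H] coset_zero[OF H] subspace_A in
      \<open>simp_all add: quot_module_def\<close>)

lemma represented_cong:
  assumes "represented A lam G" and "carrier G' = lam ` A" "zero G' = zero G" "add G' = add G" "smult G' = smult G"
  shows "represented A lam G'"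
  using assms by (simp add: represented_def)

text \<open>
  This is the shape of the graded components of Ext and Tor: \<open>Z\<close> are the cocycles or cycles, and \<open>B\<close> are
  the coboundaries or boundaries of all degrees.
\<close>

lemma presents_component_subquotient:
  fixes C :: "(('k::field, 'n::finite) laurent, 'm, int ^ 'n) gmodule"
  assumes "represented A lam C" and "fs.subspace H" "H \<subseteq> A" and "fs.subspace U" "U \<subseteq> A"
    and Z: "Z \<inter> homog C b = lam ` U" and B: "B = lam ` H"
  shows "presents U (\<lambda>u. B +>\<^bsub>C\<^esub> lam u) (component (gquot (gsub C Z) B) b)"
proof -
  interpret represented A lam C by (rule assms(1))
  note in_A = subsetD[OF assms(5)]
  have "homog (gquot (gsub C Z) B) b = (\<lambda>u. B +>\<^bsub>C\<^esub> lam u) ` U"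
    by (simp add: gmodule_record_simps coset_gsub Z image_image)
  moreover have "(B +>\<^bsub>C\<^esub> lam a) <+>\<^bsub>C\<^esub> (B +>\<^bsub>C\<^esub> lam a') = B +>\<^bsub>C\<^esub> lam (a + a')" if "a \<in> U" "a' \<in> U" for a a'
    unfolding B using set_add_coset[OF assms(2,3)] in_A that by blast
  moreover have "(\<Union>x\<in>B +>\<^bsub>C\<^esub> lam a. B +>\<^bsub>C\<^esub> (monomial 0 c \<odot>\<^bsub>C\<^esub> x)) = B +>\<^bsub>C\<^esub> lam (fscale c a)"
    if "a \<in> U" for a c
    unfolding B using smult_coset[OF assms(2,3)] in_A that by blast
  moreover have "B +>\<^bsub>C\<^esub> lam 0 = B"
    unfolding B by (rule coset_zero[OF assms(2,3)])
  ultimately show ?thesis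
    using assms(4) by (simp add: presents_def component_def gmodule_record_simps coset_gsub set_add_gsub)
qed


subsection \<open>Extending a functional\<close>

interpretation fs_pair: vector_space_pair
  "fscale :: 'k::field \<Rightarrow> ('p \<Rightarrow> ('k, 'n::finite) laurent) \<Rightarrow> _" "(*) :: 'k \<Rightarrow> 'k \<Rightarrow> 'k"
  by unfold_locales (auto simp: algebra_simps)

definition functional :: "(('p \<Rightarrow> ('k::field, 'n::finite) laurent) \<Rightarrow> 'k) \<Rightarrow> bool" where
  "functional L \<longleftrightarrow> (\<forall>u v. L (u + v) = L u + L v) \<and> (\<forall>c u. L (fscale c u) = c * L u)"

text \<open>
  A single-valued linear relation is the graph of a functional on a subspace; its values on a basis of that
  subspace, and \<open>0\<close> on the rest of a basis of the whole space, define an extension.  With the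
  functional given by its graph, well-definedness on a sum of subspaces is just single-valuedness at \<open>0\<close>.
\<close>

lemma functional_extending_graph:
  fixes R :: "(('p \<Rightarrow> ('k::field, 'n::finite) laurent) \<times> 'k) set"
  assumes zero: "(0, 0) \<in> R"
    and add: "\<And>u s v t. (u, s) \<in> R \<Longrightarrow> (v, t) \<in> R \<Longrightarrow> (u + v, s + t) \<in> R"
    and scale: "\<And>c u s. (u, s) \<in> R \<Longrightarrow> (fscale c u, c * s) \<in> R"
    and single_valued: "\<And>s. (0, s) \<in> R \<Longrightarrow> s = 0"
  shows "\<exists>L. functional L \<and> (\<forall>(u, s)\<in>R. L u = s)"
proof -
  define D where "D = fst ` R"
  have subD: "fs.subspace D"
  proof (rule fs.subspaceI)
    show "0 \<in> D" unfolding D_def by (rule image_eqI[OF _ zero]) simp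
    show "u + v \<in> D" if uv: "u \<in> D" "v \<in> D" for u v
    proof -
      obtain s t where "(u, s) \<in> R" "(v, t) \<in> R" using uv by (auto simp: D_def)
      from add[OF this] show ?thesis unfolding D_def by (metis fst_conv image_eqI)
    qed
    show "fscale c u \<in> D" if u: "u \<in> D" for c u
    proof -
      obtain s where "(u, s) \<in> R" using u by (auto simp: D_def)
      from scale[OF this] show ?thesis unfolding D_def by (metis fst_conv image_eqI)
    qed
  qed
  have unique: "s = t" if "(u, s) \<in> R" "(u, t) \<in> R" for u s t
  proof -
    have "(u + fscale (-1) u, s + - 1 * t) \<in> R" using add[OF that(1) scale[OF that(2), of "-1"]] .
    then have "s - t = 0" by (intro single_valued) simp
    then show ?thesis by simp
  qed
  define f where "f u = (THE s. (u, s) \<in> R)" for u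
  have f: "f u = s" if "(u, s) \<in> R" for u s
    unfolding f_def by (rule the_equality) (use that unique in \<open>auto\<close>)
  obtain B where B: "B \<subseteq> D" "fs.independent B" "D \<subseteq> fs.span B"
    by (rule fs.maximal_independent_subset[of D]) (rule that)
  define L where "L = fs_pair.construct B f"
  have lin: "Vector_Spaces.linear fscale (*) L"
    unfolding L_def by (rule fs_pair.linear_construct[OF B(2)])
  have func: "functional L"
    by (simp add: functional_def fs_pair.linear_add[OF lin] fs_pair.linear_scale[OF lin])
  have "(u, L u) \<in> R" if "u \<in> fs.span B" for u
    using that
  proof (induction rule: fs.span_induct_alt)
    case base
    have "L 0 = 0" using fs_pair.linear_0[OF lin] .
    then show ?case using zero by (simp add: zero_fun_def)
  next
    case (step c x y)
    have "x \<in> D" using B(1) step by auto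
    then obtain s where "(x, s) \<in> R" by (auto simp: D_def)
    with f[OF this] have "(x, f x) \<in> R" by simp
    moreover have "f x = L x" unfolding L_def by (rule fs_pair.construct_basis[OF B(2) step(1), symmetric])
    ultimately have "(fscale c x + y, c * L x + L y) \<in> R"
      using add[OF scale step(2)] by simp
    then show ?case using func by (simp add: functional_def plus_fun_def)
  qed
  note graph = this
  have "L u = s" if "(u, s) \<in> R" for u s
  proof (rule unique[OF graph that])
    have "u \<in> D" using that unfolding D_def by (metis fst_conv image_eqI)
    then show "u \<in> fs.span B" using B(3) by blast
  qed
  then show ?thesis using func by auto
qed


section \<open>Free modules over the polynomial ring\<close>

abbreviation polys :: "('k::field, 'n::finite) laurent set" where
  "polys \<equiv> carrier poly_ring"

lemma poly_ring_simps:
  "mult poly_ring = (*)" "add poly_ring = (+)" "zero poly_ring = 0" "one poly_ring = 1"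
  "homog poly_ring b = polys \<inter> range (monomial b)"
  by (simp_all add: poly_ring_def gsub_def laurent_ring_def)

lemma polys_closed:
  "0 \<in> polys" "1 \<in> polys" "r \<in> polys \<Longrightarrow> s \<in> polys \<Longrightarrow> r + s \<in> polys"
  "r \<in> polys \<Longrightarrow> s \<in> polys \<Longrightarrow> r * s \<in> polys" "r \<in> polys \<Longrightarrow> - r \<in> polys"
proof -
  interpret cring "poly_ring :: ('k::field, 'n::finite) poly_gmodule"
    by (rule poly_ring_cring)
  show "0 \<in> (polys :: ('k, 'n) laurent set)" "1 \<in> (polys :: ('k, 'n) laurent set)"
    using zero_closed one_closed by (simp_all only: poly_ring_simps)
  show "r + s \<in> polys" "r * s \<in> polys" if "r \<in> polys" "s \<in> polys" for r s :: "('k, 'n) laurent"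
    using a_closed[OF that] m_closed[OF that] by (simp_all only: poly_ring_simps)
  show "- r \<in> polys" if "r \<in> polys" for r :: "('k, 'n) laurent"
    using that by (simp add: poly_ring_def gsub_def)
qed

lemma finsum_poly_ring:
  assumes "finite A" "f \<in> A \<rightarrow> polys"
  shows "finsum poly_ring f A = sum f A"
proof -
  interpret cring "poly_ring :: ('k::field, 'n::finite) poly_gmodule"
    by (rule poly_ring_cring)
  show ?thesis using assms
    by (induction A rule: finite_induct) (auto simp: poly_ring_simps Pi_iff)
qed

abbreviation free_vectors :: "'x set \<Rightarrow> ('x \<Rightarrow> ('k::field, 'n::finite) laurent) set" where
  "free_vectors I \<equiv> carrier (free_module poly_ring I)"

lemma free_vectors_iff:
  "c \<in> free_vectors I \<longleftrightarrow> (\<forall>x. c x \<in> polys) \<and> finite {x. c x \<noteq> 0} \<and> {x. c x \<noteq> 0} \<subseteq> I"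
  by (auto simp: free_module_def poly_ring_simps)

lemma free_vectorsD:
  assumes "c \<in> free_vectors I"
  shows "c x \<in> polys" "finite {x. c x \<noteq> 0}" "c x \<noteq> 0 \<Longrightarrow> x \<in> I"
  using assms by (auto simp: free_vectors_iff)

lemma free_module_simps:
  "zero (free_module poly_ring I) = 0" "add (free_module poly_ring I) = (+)"
  "smult (free_module poly_ring I) = (\<lambda>r c x. r * c x)"
  by (auto simp: free_module_def poly_ring_simps fun_eq_iff)

lemma free_vectors_closed:
  "0 \<in> free_vectors I"
  "c \<in> free_vectors I \<Longrightarrow> c' \<in> free_vectors I \<Longrightarrow> c + c' \<in> free_vectors I"
  "r \<in> polys \<Longrightarrow> c \<in> free_vectors I \<Longrightarrow> (\<lambda>x. r * c x) \<in> free_vectors I"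
  "c \<in> free_vectors I \<Longrightarrow> - c \<in> free_vectors I"
proof -
  show "c + c' \<in> free_vectors I" if "c \<in> free_vectors I" "c' \<in> free_vectors I" for c c'
  proof -
    have "{x. (c + c') x \<noteq> 0} \<subseteq> {x. c x \<noteq> 0} \<union> {x. c' x \<noteq> 0}" by auto
    then show ?thesis using that
      unfolding free_vectors_iff by (auto simp: polys_closed intro: finite_subset)
  qed
  show "(\<lambda>x. r * c x) \<in> free_vectors I" if "r \<in> polys" "c \<in> free_vectors I" for r c
  proof -
    have "{x. r * c x \<noteq> 0} \<subseteq> {x. c x \<noteq> 0}" by auto
    then show ?thesis using that
      unfolding free_vectors_iff by (auto simp: polys_closed intro: finite_subset)
  qed
qed (auto simp: free_vectors_iff polys_closed)

lemma free_vectors_diff: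
  assumes "c \<in> free_vectors I" "c' \<in> free_vectors I"
  shows "c - c' \<in> free_vectors I"
  unfolding diff_conv_add_uminus[of c c'] by (intro free_vectors_closed assms)

lemma free_vectors_subspace: "fs.subspace (free_vectors I)"
  by (rule fs.subspaceI) (auto simp: free_vectors_closed fscale_def single_zero_in_poly_ring)

lemma free_module_represented: "represented (free_vectors I) id (free_module poly_ring I)"
  by unfold_locales (auto simp: free_vectors_subspace free_module_simps fscale_def)

lemma free_module_minus:
  "a \<in> free_vectors I \<Longrightarrow> b \<in> free_vectors I \<Longrightarrow> a \<ominus>\<^bsub>free_module poly_ring I\<^esub> b = a - b"
  using represented.inv_eq[OF free_module_represented, of b I]
  by (simp add: a_minus_def a_inv_def free_module_simps del: fun_diff_def)

lemma free_module_module: "Module.module poly_ring (free_module poly_ring I)"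
proof (rule moduleI[OF poly_ring_cring])
  show "abelian_group (free_module poly_ring I)"
  proof (rule abelian_groupI)
    fix x assume "x \<in> free_vectors I"
    then show "\<exists>y\<in>free_vectors I. y \<oplus>\<^bsub>free_module poly_ring I\<^esub> x = \<zero>\<^bsub>free_module poly_ring I\<^esub>"
      by (intro bexI[of _ "- x"]) (auto simp: free_module_simps free_vectors_closed)
  qed (auto simp: free_module_simps free_vectors_closed add_ac)
qed (auto simp: free_module_simps free_vectors_closed poly_ring_simps fun_eq_iff algebra_simps)

definition bvec :: "('k::field, 'n::finite) laurent \<Rightarrow> 'x \<Rightarrow> 'x \<Rightarrow> ('k, 'n) laurent" where
  "bvec r x = (\<lambda>y. if y = x then r else 0)"

lemma free_basis_eq: "free_basis poly_ring x = bvec 1 x"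
  by (simp add: free_basis_def bvec_def poly_ring_simps fun_eq_iff)

lemma bvec_mem: "r \<in> polys \<Longrightarrow> x \<in> I \<Longrightarrow> bvec r x \<in> free_vectors I"
  by (auto simp: free_vectors_iff bvec_def polys_closed)

lemma bvec_smult: "(\<lambda>y. r * bvec s x y) = bvec (r * s) x"
  by (auto simp: bvec_def)

lemma bvec_scale: "fscale c (bvec s x) = bvec (monomial 0 c * s) x"
  by (auto simp: bvec_def fscale_def)

lemma free_vectors_induct [consumes 1, case_names zero step]:
  assumes "f \<in> free_vectors I" and "P 0"
    and step: "\<And>f r x. f \<in> free_vectors I \<Longrightarrow> P f \<Longrightarrow> r \<in> polys \<Longrightarrow> x \<in> I \<Longrightarrow>
      f x = 0 \<Longrightarrow> P (f + bvec r x)"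
  shows "P f"
proof -
  have "P f" if "finite A" "f \<in> free_vectors A" "A \<subseteq> I" for A
    using that
  proof (induction A arbitrary: f rule: finite_induct)
    case empty
    then have "f = 0" by (auto simp: free_vectors_iff fun_eq_iff)
    show ?case unfolding \<open>f = 0\<close> by (rule \<open>P 0\<close>)
  next
    case (insert x A)
    have "{y. (f(x := 0)) y \<noteq> 0} \<subseteq> {y. f y \<noteq> 0}" by auto
    then have 1: "f(x := 0) \<in> free_vectors A"
      using insert.prems unfolding free_vectors_iff by (auto simp: polys_closed intro: finite_subset)
    then have 2: "f(x := 0) \<in> free_vectors I" using insert.prems by (auto simp: free_vectors_iff)
    have "f \<in> free_vectors A \<Longrightarrow> A \<subseteq> I \<Longrightarrow> P f" for f by (rule insert.IH)
    then have 3: "P (f(x := 0))" using 1 insert.prems(2) by blast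
    have "P (f(x := 0) + bvec (f x) x)"
      by (rule step[OF 2 3]) (use insert.prems in \<open>auto simp: free_vectors_iff\<close>)
    moreover have "f(x := 0) + bvec (f x) x = f" by (auto simp: bvec_def)
    ultimately show ?case by simp
  qed
  from this[of "{x. f x \<noteq> 0}"] assms(1) show ?thesis by (auto simp: free_vectors_iff)
qed

text \<open>
  As a function of \<open>c\<close>, this is the linear map on a free module with prescribed values \<open>w\<close> on the basis.
\<close>

definition wsum :: "('x \<Rightarrow> ('k::field, 'n::finite) laurent) \<Rightarrow> ('x \<Rightarrow> ('k, 'n) laurent) \<Rightarrow> ('k, 'n) laurent" where
  "wsum w c = (\<Sum>x | c x \<noteq> 0. c x * w x)"

lemma wsum_superset: "finite A \<Longrightarrow> {x. c x \<noteq> 0} \<subseteq> A \<Longrightarrow> wsum w c = (\<Sum>x\<in>A. c x * w x)"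
  unfolding wsum_def by (rule sum.mono_neutral_left) auto

lemma wsum_zero [simp]: "wsum w 0 = 0"
  by (simp add: wsum_def)

lemma wsum_add:
  assumes "c \<in> free_vectors I" "c' \<in> free_vectors I"
  shows "wsum w (c + c') = wsum w c + wsum w c'"
proof -
  let ?A = "{x. c x \<noteq> 0} \<union> {x. c' x \<noteq> 0}"
  have "finite ?A" using assms by (auto simp: free_vectors_iff)
  then show ?thesis
    by (subst (1 2 3) wsum_superset[of ?A]) (auto simp: sum.distrib distrib_right)
qed

lemma wsum_smult:
  assumes "c \<in> free_vectors I"
  shows "wsum w (\<lambda>x. r * c x) = r * wsum w c"
proof -
  have "finite {x. c x \<noteq> 0}" using assms by (auto simp: free_vectors_iff)
  then show ?thesis
    by (subst (1 2) wsum_superset[of "{x. c x \<noteq> 0}"]) (auto simp: sum_distrib_left mult.assoc)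
qed

lemma wsum_minus: "c \<in> free_vectors I \<Longrightarrow> wsum w (- c) = - wsum w c"
  using wsum_smult[of c I w "-1"] by (simp add: fun_Compl_def)

lemma wsum_diff:
  "c \<in> free_vectors I \<Longrightarrow> c' \<in> free_vectors I \<Longrightarrow> wsum w (c - c') = wsum w c - wsum w c'"
  using wsum_add[of c I "- c'" w] by (simp add: wsum_minus free_vectors_closed del: fun_diff_def)

lemma wsum_bvec [simp]: "wsum w (bvec r x) = r * w x"
  by (subst wsum_superset[of "{x}"]) (auto simp: bvec_def)

lemma wsum_add_left: "wsum (\<lambda>x. w x + w' x) c = wsum w c + wsum w' c"
  by (simp add: wsum_def distrib_left sum.distrib)

lemma wsum_smult_left: "wsum (\<lambda>x. r * w x) c = r * wsum w c"
  by (simp add: wsum_def sum_distrib_left algebra_simps)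

lemma free_map_eq:
  assumes "c \<in> free_vectors I"
  shows "free_map poly_ring h c y = wsum (\<lambda>x. if h x = y then 1 else 0) c"
proof -
  have fin: "finite {x. c x \<noteq> 0}" using assms by (auto simp: free_vectors_iff)
  have "free_map poly_ring h c y = (\<Sum>x | h x = y \<and> c x \<noteq> 0. c x)"
    unfolding free_map_def poly_ring_simps
    by (rule finsum_poly_ring) (use fin assms in \<open>auto simp: free_vectors_iff\<close>)
  also have "\<dots> = (\<Sum>x | c x \<noteq> 0. if h x = y then c x else 0)"
    using fin by (simp add: sum.inter_filter[symmetric] conj_commute)
  also have "\<dots> = wsum (\<lambda>x. if h x = y then 1 else 0) c"
    unfolding wsum_def by (rule sum.cong) auto
  finally show ?thesis .
qed

lemma free_map_zero: "free_map poly_ring h 0 = 0"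
  by (rule ext) (simp add: free_map_eq[OF free_vectors_closed(1)])

lemma free_map_add:
  assumes "c \<in> free_vectors I" "c' \<in> free_vectors I"
  shows "free_map poly_ring h (c + c') = free_map poly_ring h c + free_map poly_ring h c'"
  unfolding fun_eq_iff plus_fun_apply free_map_eq[OF free_vectors_closed(2)[OF assms]]
    free_map_eq[OF assms(1)] free_map_eq[OF assms(2)] wsum_add[OF assms] by simp

lemma free_map_smult:
  assumes "r \<in> polys" "c \<in> free_vectors I"
  shows "free_map poly_ring h (\<lambda>x. r * c x) = (\<lambda>y. r * free_map poly_ring h c y)"
  by (rule ext) (simp add: free_map_eq[OF free_vectors_closed(3)[OF assms]] free_map_eq[OF assms(2)]
      wsum_smult[OF assms(2)])

lemma free_map_diff:
  assumes "c \<in> free_vectors I" "c' \<in> free_vectors I"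
  shows "free_map poly_ring h (c - c') = free_map poly_ring h c - free_map poly_ring h c'"
  unfolding fun_eq_iff minus_apply free_map_eq[OF free_vectors_diff[OF assms]]
    free_map_eq[OF assms(1)] free_map_eq[OF assms(2)] wsum_diff[OF assms] by simp

lemma free_map_bvec:
  assumes "r \<in> polys"
  shows "free_map poly_ring h (bvec r x) = bvec r (h x)"
  by (rule ext) (auto simp: free_map_eq[OF bvec_mem[OF assms UNIV_I]] bvec_def[of r "h x"])

lemma free_map_mem:
  assumes "c \<in> free_vectors I" and "h ` I \<subseteq> J"
  shows "free_map poly_ring h c \<in> free_vectors J"
  using assms(1)
proof (induction rule: free_vectors_induct)
  case zero
  show ?case unfolding free_map_zero by (rule free_vectors_closed)
next
  case (step f r x)
  have "free_map poly_ring h (f + bvec r x) = free_map poly_ring h f + bvec r (h x)"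
    using free_map_add[OF step(1) bvec_mem[OF step(2,3)]] free_map_bvec[OF step(2)] by metis
  moreover have "bvec r (h x) \<in> free_vectors J" using step assms(2) by (intro bvec_mem) auto
  ultimately show ?case using free_vectors_closed(2)[OF step(5)] by metis
qed

lemma wsum_free_map:
  assumes "c \<in> free_vectors I"
  shows "wsum w (free_map poly_ring h c) = wsum (\<lambda>x. w (h x)) c"
  using assms
proof (induction rule: free_vectors_induct)
  case zero
  then show ?case unfolding free_map_zero wsum_zero ..
next
  case (step f r x)
  have 1: "bvec r x \<in> free_vectors I" by (rule bvec_mem[OF step(2,3)])
  have 2: "free_map poly_ring h f \<in> free_vectors UNIV" "bvec r (h x) \<in> free_vectors UNIV"
    by (rule free_map_mem[OF step(1) subset_UNIV], rule bvec_mem[OF step(2) UNIV_I])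
  show ?case
    unfolding free_map_add[OF step(1) 1] free_map_bvec[OF step(2)] wsum_add[OF 2] wsum_add[OF step(1) 1]
      step(5) wsum_bvec ..
qed

lemma free_gmodule_simps:
  "carrier (free_gmodule poly_ring I \<delta>) = free_vectors I"
  "zero (free_gmodule poly_ring I \<delta>) = 0" "add (free_gmodule poly_ring I \<delta>) = (+)"
  "smult (free_gmodule poly_ring I \<delta>) = (\<lambda>r c x. r * c x)"
  "homog (free_gmodule poly_ring I \<delta>) b =
    {c \<in> free_vectors I. \<forall>x\<in>I. c x \<in> range (monomial (b - \<delta> x))}"
  using free_module_simps[of I] free_vectorsD(1)
  by (auto simp: free_gmodule_def module.defs gmodule.defs poly_ring_simps)


section \<open>Tensor products with a monomial module\<close>

locale tensor_with =
  fixes I :: "'x set" and \<delta> :: "'x \<Rightarrow> int ^ 'n::finite" and N :: "('k::field, 'n) laurent set"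
  assumes monomial_N: "monomial_module N"
begin

abbreviation "FI \<equiv> free_gmodule (poly_ring :: ('k, 'n) poly_gmodule) I \<delta>"
abbreviation "NT \<equiv> gsub laurent_ring N"
abbreviation "pairs \<equiv> (free_vectors I :: ('x \<Rightarrow> ('k, 'n) laurent) set) \<times> N"
abbreviation "TF \<equiv> free_module (poly_ring :: ('k, 'n) poly_gmodule) pairs"
abbreviation "rel \<equiv> tensor_rel poly_ring FI NT"

lemmas N_closed = monomial_moduleD[OF monomial_N]

lemma NT_simps: "carrier NT = N" "add NT = (+)" "smult NT = (*)"
  "homog NT a = N \<inter> range (monomial a)"
  by (simp_all add: gsub_def laurent_ring_def)

lemma tensor_free_eq: "tensor_free poly_ring FI NT = TF"
  by (simp add: tensor_free_def free_gmodule_simps NT_simps)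

text \<open>
  The generators of the relations in \<open>tensor_rel\<close>, with the operations of the module records evaluated.
\<close>

definition gens :: "(('x \<Rightarrow> ('k, 'n) laurent) \<times> ('k, 'n) laurent \<Rightarrow> ('k, 'n) laurent) set" where
  "gens =
     {bvec 1 (f + f', n) - (bvec 1 (f, n) + bvec 1 (f', n)) | f f' n.
        f \<in> free_vectors I \<and> f' \<in> free_vectors I \<and> n \<in> N} \<union>
     {bvec 1 (f, n + n') - (bvec 1 (f, n) + bvec 1 (f, n')) | f n n'.
        f \<in> free_vectors I \<and> n \<in> N \<and> n' \<in> N} \<union>
     {bvec 1 (\<lambda>x. r * f x, n) - bvec r (f, n) | r f n.
        r \<in> polys \<and> f \<in> free_vectors I \<and> n \<in> N} \<union>
     {bvec 1 (f, r * n) - bvec r (f, n) | r f n.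
        r \<in> polys \<and> f \<in> free_vectors I \<and> n \<in> N}"

lemma gens_cases [consumes 1, case_names add_left add_right smult_left smult_right]:
  assumes "c \<in> gens"
  obtains f f' n where "c = bvec 1 (f + f', n) - (bvec 1 (f, n) + bvec 1 (f', n))"
      "f \<in> free_vectors I" "f' \<in> free_vectors I" "n \<in> N"
    | f n n' where "c = bvec 1 (f, n + n') - (bvec 1 (f, n) + bvec 1 (f, n'))"
      "f \<in> free_vectors I" "n \<in> N" "n' \<in> N"
    | r f n where "c = bvec 1 (\<lambda>x. r * f x, n) - bvec r (f, n)"
      "r \<in> polys" "f \<in> free_vectors I" "n \<in> N"
    | r f n where "c = bvec 1 (f, r * n) - bvec r (f, n)"
      "r \<in> polys" "f \<in> free_vectors I" "n \<in> N"
  using assms unfolding gens_def by blast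

lemma e_mem: "r \<in> polys \<Longrightarrow> f \<in> free_vectors I \<Longrightarrow> n \<in> N \<Longrightarrow> bvec r (f, n) \<in> free_vectors pairs"
  by (intro bvec_mem) auto

lemma gens_subset: "gens \<subseteq> free_vectors pairs"
  unfolding gens_def
  by (auto intro!: free_vectors_diff free_vectors_closed e_mem N_closed polys_closed simp del: fun_diff_def)

lemma conj_cong_left: "(Q \<Longrightarrow> P \<longleftrightarrow> P') \<Longrightarrow> P \<and> Q \<longleftrightarrow> P' \<and> Q"
  by blast

lemma rel_eq: "rel = LinearCombinations.module.span poly_ring TF gens"
proof -
  have *: "bvec 1 (f + f', n) \<ominus>\<^bsub>TF\<^esub> (bvec 1 (f, n) + bvec 1 (f', n))
      = bvec 1 (f + f', n) - (bvec 1 (f, n) + bvec 1 (f', n))"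
    if "f \<in> free_vectors I" "f' \<in> free_vectors I" "n \<in> N" for f f' n
    by (rule free_module_minus) (intro free_vectors_closed e_mem polys_closed that)+
  have **: "bvec 1 (f, n + n') \<ominus>\<^bsub>TF\<^esub> (bvec 1 (f, n) + bvec 1 (f, n'))
      = bvec 1 (f, n + n') - (bvec 1 (f, n) + bvec 1 (f, n'))"
    if "f \<in> free_vectors I" "n \<in> N" "n' \<in> N" for f n n'
    by (rule free_module_minus) (intro free_vectors_closed e_mem polys_closed N_closed that)+
  have ***: "bvec 1 (\<lambda>x. r * f x, n) \<ominus>\<^bsub>TF\<^esub> bvec r (f, n) = bvec 1 (\<lambda>x. r * f x, n) - bvec r (f, n)"
    if "r \<in> polys" "f \<in> free_vectors I" "n \<in> N" for r f n
    by (rule free_module_minus) (intro free_vectors_closed e_mem polys_closed that)+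
  have ****: "bvec 1 (f, r * n) \<ominus>\<^bsub>TF\<^esub> bvec r (f, n) = bvec 1 (f, r * n) - bvec r (f, n)"
    if "r \<in> polys" "f \<in> free_vectors I" "n \<in> N" for r f n
    by (rule free_module_minus) (intro free_vectors_closed e_mem polys_closed N_closed that)+
  show ?thesis
    unfolding tensor_rel_def Let_def tensor_free_eq free_basis_eq free_gmodule_simps NT_simps
      free_module_simps bvec_smult mult_1_right gens_def
    by (intro arg_cong[where f = "LinearCombinations.module.span poly_ring TF"] arg_cong2[where f = "(\<union>)"]
        Collect_cong ex_cong1 conj_cong_left; elim conjE; simp only: * ** *** ****)
qed

sublocale TFmod: Module.module poly_ring TF
  by (rule free_module_module)

lemma rel_submodule: "LinearCombinations.submodule poly_ring rel TF"
  unfolding rel_eq by (rule TFmod.span_is_submodule[OF gens_subset])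

lemma rel_subset: "rel \<subseteq> free_vectors pairs"
  using rel_submodule by (simp add: LinearCombinations.submodule_def)

lemma rel_closed:
  "0 \<in> rel" "c \<in> rel \<Longrightarrow> c' \<in> rel \<Longrightarrow> c + c' \<in> rel" "r \<in> polys \<Longrightarrow> c \<in> rel \<Longrightarrow> (\<lambda>p. r * c p) \<in> rel"
  using rel_submodule by (auto simp: LinearCombinations.submodule_def free_module_simps)

lemma rel_subspace: "fs.subspace rel"
  by (rule fs.subspaceI) (auto simp: fscale_def rel_closed single_zero_in_poly_ring)

lemma gens_in_rel: "gens \<subseteq> rel"
  unfolding rel_eq by (rule TFmod.in_own_span[OF gens_subset])

lemma rel_bilinear:
  assumes "f \<in> free_vectors I" "n \<in> N"
  shows "f' \<in> free_vectors I \<Longrightarrow> bvec 1 (f + f', n) - (bvec 1 (f, n) + bvec 1 (f', n)) \<in> rel"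
    and "n' \<in> N \<Longrightarrow> bvec 1 (f, n + n') - (bvec 1 (f, n) + bvec 1 (f, n')) \<in> rel"
    and "r \<in> polys \<Longrightarrow> bvec 1 (\<lambda>x. r * f x, n) - bvec r (f, n) \<in> rel"
    and "r \<in> polys \<Longrightarrow> bvec 1 (f, r * n) - bvec r (f, n) \<in> rel"
  using assms by (intro subsetD[OF gens_in_rel]; unfold gens_def; blast)+

lemma rel_induct [consumes 1, case_names zero add smult gens]:
  assumes "c \<in> rel" and "P 0"
    and "\<And>c c'. c \<in> free_vectors pairs \<Longrightarrow> c' \<in> free_vectors pairs \<Longrightarrow> P c \<Longrightarrow> P c' \<Longrightarrow> P (c + c')"
    and "\<And>r c. r \<in> polys \<Longrightarrow> c \<in> free_vectors pairs \<Longrightarrow> P c \<Longrightarrow> P (\<lambda>p. r * c p)"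
    and "\<And>c. c \<in> gens \<Longrightarrow> P c"
  shows "P c"
proof -
  have "LinearCombinations.submodule poly_ring {c \<in> free_vectors pairs. P c} TF"
    unfolding LinearCombinations.submodule_def
  proof (intro conjI allI impI)
    show "Module.module poly_ring TF" by (rule free_module_module)
  qed (use assms(2-4) in \<open>auto simp: free_module_simps free_vectors_closed\<close>)
  from TFmod.span_is_subset[OF _ this, of gens] assms(1,5) gens_subset show ?thesis
    unfolding rel_eq by blast
qed

text \<open>
  The map \<open>f \<otimes> n \<mapsto> g(f) n\<close> is well defined on the tensor product.
\<close>

lemma wsum_rel:
  assumes c: "c \<in> rel"
    and g: "\<And>f f'. f \<in> free_vectors I \<Longrightarrow> f' \<in> free_vectors I \<Longrightarrow> g (f + f') = g f + g f'"
      "\<And>r f. r \<in> polys \<Longrightarrow> f \<in> free_vectors I \<Longrightarrow> g (\<lambda>x. r * f x) = r * g f"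
  shows "wsum (\<lambda>(f, n). g f * n) c = 0"
  using c
proof (induction rule: rel_induct)
  case zero
  show ?case by (rule wsum_zero)
next
  case (add c c')
  show ?case unfolding wsum_add[OF add(1,2)] add(3,4) by simp
next
  case (smult r c)
  show ?case unfolding wsum_smult[OF smult(2)] smult(3) by simp
next
  case (gens c)
  note mem = e_mem free_vectors_closed polys_closed N_closed
  let ?w = "\<lambda>(f, n). g f * n"
  have *: "wsum ?w (bvec 1 p - (bvec 1 q + bvec 1 q')) = ?w p - (?w q + ?w q')"
    if "p \<in> pairs" "q \<in> pairs" "q' \<in> pairs" for p q q'
  proof -
    have m: "bvec 1 p \<in> free_vectors pairs" "bvec 1 q \<in> free_vectors pairs" "bvec 1 q' \<in> free_vectors pairs"
      by (intro bvec_mem polys_closed that)+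
    show ?thesis
      unfolding wsum_diff[OF m(1) free_vectors_closed(2)[OF m(2,3)]] wsum_add[OF m(2,3)] wsum_bvec by simp
  qed
  have **: "wsum ?w (bvec 1 p - bvec r q) = ?w p - r * ?w q"
    if "p \<in> pairs" "q \<in> pairs" "r \<in> polys" for p q r
  proof -
    have m: "bvec 1 p \<in> free_vectors pairs" "bvec r q \<in> free_vectors pairs"
      by (intro bvec_mem polys_closed that)+
    show ?thesis unfolding wsum_diff[OF m] wsum_bvec by simp
  qed
  from gens show ?case
  proof (cases rule: gens_cases)
    case add_left
    then show ?thesis by (simp only: * SigmaI mem prod.case g) (simp add: algebra_simps)
  next
    case add_right
    then show ?thesis by (simp only: * SigmaI mem prod.case) (simp add: algebra_simps)
  next
    case smult_left
    then show ?thesis by (simp only: ** SigmaI mem prod.case g) (simp add: algebra_simps)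
  next
    case smult_right
    then show ?thesis by (simp only: ** SigmaI mem prod.case) (simp add: algebra_simps)
  qed
qed

subsection \<open>The tensor product by representatives\<close>

abbreviation "tcoset c \<equiv> rel +>\<^bsub>TF\<^esub> c"

lemma gtensor_simps:
  "carrier (gtensor poly_ring FI NT) = carrier (quot_module TF rel)"
  "zero (gtensor poly_ring FI NT) = zero (quot_module TF rel)"
  "add (gtensor poly_ring FI NT) = add (quot_module TF rel)"
  "smult (gtensor poly_ring FI NT) = smult (quot_module TF rel)"
  "homog (gtensor poly_ring FI NT) b = generate (add_monoid (quot_module TF rel))
     {tcoset (bvec 1 (f, n)) | f n a a'. f \<in> homog FI a \<and> n \<in> homog NT a' \<and> a + a' = b}"
  by (simp_all add: gtensor_def Let_def tensor_free_eq tensor_elt_def free_basis_eq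
      module.defs gmodule.defs)

lemma represented_quot: "represented (free_vectors pairs) tcoset (quot_module TF rel)"
  using represented.represented_quotient[OF free_module_represented rel_subspace rel_subset] by simp

lemma represented_gtensor: "represented (free_vectors pairs) tcoset (gtensor poly_ring FI NT)"
  by (rule represented_cong[OF represented_quot])
    (simp_all add: gtensor_simps represented.carrier_eq[OF represented_quot])

lemma tcoset_zero_iff: "c \<in> free_vectors pairs \<Longrightarrow> tcoset c = tcoset 0 \<longleftrightarrow> c \<in> rel"
  using represented.coset_eq_iff[OF free_module_represented rel_subspace rel_subset, of c] by simp

lemma tcoset_eq_iff:
  assumes "c \<in> free_vectors pairs" "c' \<in> free_vectors pairs"
  shows "tcoset c = tcoset c' \<longleftrightarrow> c - c' \<in> rel"
proof -
  interpret Q: represented "free_vectors pairs" tcoset "quot_module TF rel" by (rule represented_quot)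
  have d: "c - c' \<in> free_vectors pairs" "- c' \<in> free_vectors pairs"
    using assms by (auto intro: free_vectors_diff free_vectors_closed simp del: fun_diff_def)
  have "tcoset c = tcoset c' \<Longrightarrow> tcoset (c + - c') = tcoset (c' + - c')"
    using Q.add_eq[OF assms(1) d(2)] Q.add_eq[OF assms(2) d(2)] by metis
  moreover have "tcoset (c - c') = tcoset 0 \<Longrightarrow> tcoset ((c - c') + c') = tcoset (0 + c')"
    using Q.add_eq[OF d(1) assms(2)] Q.add_eq[OF Q.mem(1) assms(2)] by metis
  ultimately show ?thesis
    using tcoset_zero_iff[OF d(1)] by (auto simp del: fun_diff_def)
qed

text \<open>
  The factor \<open>t\<close> makes the set closed under scaling.  It does not enlarge the component of the tensor
  product, since it can be moved into \<open>f\<close> modulo the relations.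
\<close>

definition homog_gens :: "int ^ 'n \<Rightarrow> (('x \<Rightarrow> ('k, 'n) laurent) \<times> ('k, 'n) laurent \<Rightarrow> ('k, 'n) laurent) set" where
  "homog_gens b = {bvec (monomial 0 t) (f, n) | t f n a a'.
     f \<in> homog FI a \<and> n \<in> homog NT a' \<and> a + a' = b}"

lemma homog_gens_subset: "homog_gens b \<subseteq> free_vectors pairs"
  by (auto simp: homog_gens_def free_gmodule_simps NT_simps intro!: e_mem single_zero_in_poly_ring)

lemma homog_gens_scale: "s \<in> homog_gens b \<Longrightarrow> fscale c s \<in> homog_gens b"
  unfolding homog_gens_def by (fastforce simp: bvec_scale mult_single)

lemma span_homog_gens_subset: "fs.span (homog_gens b) \<subseteq> free_vectors pairs"
  by (rule fs.span_minimal[OF homog_gens_subset free_vectors_subspace])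

lemma homog_FI_scale: "f \<in> homog FI a \<Longrightarrow> (\<lambda>x. monomial 0 t * f x) \<in> homog FI a"
  by (fastforce simp: free_gmodule_simps free_vectors_closed single_zero_in_poly_ring mult_single)

lemma homog_gtensor: "homog (gtensor poly_ring FI NT) b = tcoset ` fs.span (homog_gens b)"
proof -
  interpret Q: represented "free_vectors pairs" tcoset "quot_module TF rel" by (rule represented_quot)
  let ?E = "{tcoset (bvec 1 (f, n)) | f n a a'. f \<in> homog FI a \<and> n \<in> homog NT a' \<and> a + a' = b}"
  have "tcoset ` homog_gens b = ?E"
  proof (intro equalityI subsetI)
    fix y assume "y \<in> tcoset ` homog_gens b"
    then obtain t f n a a' where y: "y = tcoset (bvec (monomial 0 t) (f, n))"
      and h: "f \<in> homog FI a" "n \<in> homog NT a'" "a + a' = b"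
      by (auto simp: homog_gens_def)
    let ?r = "monomial 0 t :: ('k, 'n) laurent"
    have fn: "f \<in> free_vectors I" "n \<in> N" using h by (auto simp: free_gmodule_simps NT_simps)
    have rp: "?r \<in> polys" by (rule single_zero_in_poly_ring)
    have "tcoset (bvec 1 (\<lambda>x. ?r * f x, n)) = y"
      unfolding y
      by (subst tcoset_eq_iff)
        (auto intro!: e_mem free_vectors_closed polys_closed rel_bilinear fn rp simp del: fun_diff_def)
    with homog_FI_scale[OF h(1), of t] h(2,3) show "y \<in> ?E" by blast
  next
    fix y assume "y \<in> ?E"
    then obtain f n a a' where y: "y = tcoset (bvec (monomial 0 1) (f, n))"
      and h: "f \<in> homog FI a" "n \<in> homog NT a'" "a + a' = b"
      by auto
    then show "y \<in> tcoset ` homog_gens b" unfolding homog_gens_def by blast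
  qed
  then show ?thesis
    using Q.generate_image[OF homog_gens_subset homog_gens_scale, of b] by (simp add: gtensor_simps)
qed

end


subsection \<open>Linear maps out of a free module\<close>

definition linear_to_laurent :: "'x set \<Rightarrow> (('x \<Rightarrow> ('k::field, 'n::finite) laurent) \<Rightarrow> ('k, 'n) laurent) set" where
  "linear_to_laurent I = {g. (\<forall>f\<in>free_vectors I. \<forall>f'\<in>free_vectors I. g (f + f') = g f + g f') \<and>
     (\<forall>r\<in>polys. \<forall>f\<in>free_vectors I. g (\<lambda>x. r * f x) = r * g f)}"

definition linear_of_degree :: "'x set \<Rightarrow> ('x \<Rightarrow> int ^ 'n) \<Rightarrow> int ^ 'n \<Rightarrow>
    (('x \<Rightarrow> ('k::field, 'n::finite) laurent) \<Rightarrow> ('k, 'n) laurent) set" where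
  "linear_of_degree I \<delta> b = {g \<in> linear_to_laurent I.
     \<forall>a. \<forall>f\<in>homog (free_gmodule poly_ring I \<delta>) a. g f \<in> range (monomial (a + b))}"

lemma linear_to_laurentD:
  assumes "g \<in> linear_to_laurent I"
  shows "f \<in> free_vectors I \<Longrightarrow> f' \<in> free_vectors I \<Longrightarrow> g (f + f') = g f + g f'"
    and "r \<in> polys \<Longrightarrow> f \<in> free_vectors I \<Longrightarrow> g (\<lambda>x. r * f x) = r * g f"
  using assms unfolding linear_to_laurent_def by blast+

lemma linear_to_laurent_zero:
  assumes "g \<in> linear_to_laurent I"
  shows "g 0 = 0"
  using linear_to_laurentD(1)[OF assms free_vectors_closed(1) free_vectors_closed(1)] by simp

lemma range_single_closed:
  fixes s t :: "('k::field, 'n::finite) laurent"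
  shows "(0 :: ('k, 'n) laurent) \<in> range (monomial a)"
    and "s \<in> range (monomial a) \<Longrightarrow> t \<in> range (monomial a) \<Longrightarrow>
      s + t \<in> range (monomial a)"
    and "s \<in> range (monomial a) \<Longrightarrow> monomial 0 c * s \<in> range (monomial a)"
proof -
  show "(0 :: ('k, 'n) laurent) \<in> range (monomial a)"
    by (rule range_eqI[of _ _ 0]) simp
qed (auto simp: single_add[symmetric] mult_single)

lemma linear_to_laurent_subspace: "fs.subspace (linear_to_laurent I)"
  by (rule fs.subspaceI) (auto simp: linear_to_laurent_def fscale_def algebra_simps)

lemma linear_of_degree_subspace:
  fixes \<delta> :: "'x \<Rightarrow> int ^ 'n::finite"
  shows "fs.subspace (linear_of_degree I \<delta> b :: (('x \<Rightarrow> ('k::field, 'n) laurent) \<Rightarrow> ('k, 'n) laurent) set)"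
proof (rule fs.subspaceI)
  note sub = fs.subspace_0[OF linear_to_laurent_subspace] fs.subspace_add[OF linear_to_laurent_subspace]
    fs.subspace_scale[OF linear_to_laurent_subspace]
  show "0 \<in> linear_of_degree I \<delta> b"
    using sub(1) by (auto simp: linear_of_degree_def range_single_closed)
  show "g + g' \<in> linear_of_degree I \<delta> b" if "g \<in> linear_of_degree I \<delta> b" "g' \<in> linear_of_degree I \<delta> b"
    for g g' :: "('x \<Rightarrow> ('k, 'n) laurent) \<Rightarrow> ('k, 'n) laurent"
    using that sub(2)[of g I g'] unfolding linear_of_degree_def plus_fun_apply
    by (blast intro: range_single_closed)
  show "fscale c g \<in> linear_of_degree I \<delta> b" if "g \<in> linear_of_degree I \<delta> b"
    for c and g :: "('x \<Rightarrow> ('k, 'n) laurent) \<Rightarrow> ('k, 'n) laurent"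
    using that sub(3)[of g I c] unfolding linear_of_degree_def fscale_apply
    by (blast intro: range_single_closed)
qed

lemma wsum_linear: "wsum v \<in> linear_to_laurent I"
  by (auto simp: linear_to_laurent_def wsum_add[of _ I] wsum_smult[of _ I])

lemma wsum_of_degree:
  fixes v :: "'x \<Rightarrow> ('k::field, 'n::finite) laurent"
  assumes "\<And>x. x \<in> I \<Longrightarrow> v x \<in> range (monomial (\<delta> x + b))"
  shows "wsum v \<in> linear_of_degree I \<delta> b"
  unfolding linear_of_degree_def
proof (intro CollectI conjI allI ballI)
  fix a and f assume f: "f \<in> homog (free_gmodule (poly_ring ::
      ('k, 'n) poly_gmodule) I \<delta>) a"
  have summand: "f x * v x \<in> range (monomial (a + b))" if "f x \<noteq> 0" for x
  proof -
    have x: "x \<in> I" using f that by (auto simp: free_gmodule_simps free_vectors_iff)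
    then obtain s t where "f x = monomial (a - \<delta> x) s" "v x = monomial (\<delta> x + b) t"
      using f assms[of x] by (auto simp: free_gmodule_simps)
    then have "f x * v x = monomial (a + b) (s * t)" by (simp add: mult_single)
    then show ?thesis by blast
  qed
  have "(\<Sum>x\<in>A. f x * v x) \<in> range (monomial (a + b))" if "A \<subseteq> {x. f x \<noteq> 0}" for A
    using that by (induction A rule: infinite_finite_induct) (auto intro!: range_single_closed summand)
  then show "wsum v f \<in> range (monomial (a + b))" by (auto simp: wsum_def)
qed (rule wsum_linear)

definition free_hom :: "'x set \<Rightarrow> 'y set \<Rightarrow> (('x \<Rightarrow> ('k::field, 'n::finite) laurent) \<Rightarrow> 'y \<Rightarrow> ('k, 'n) laurent) \<Rightarrow> bool" where
  "free_hom I J d \<longleftrightarrow> (\<forall>f\<in>free_vectors I. d f \<in> free_vectors J) \<and>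
     (\<forall>f\<in>free_vectors I. \<forall>f'\<in>free_vectors I. d (f + f') = d f + d f') \<and>
     (\<forall>r\<in>polys. \<forall>f\<in>free_vectors I. d (\<lambda>x. r * f x) = (\<lambda>y. r * d f y))"

lemma free_homD:
  assumes "free_hom I J d"
  shows "f \<in> free_vectors I \<Longrightarrow> d f \<in> free_vectors J"
    and "f \<in> free_vectors I \<Longrightarrow> f' \<in> free_vectors I \<Longrightarrow> d (f + f') = d f + d f'"
    and "r \<in> polys \<Longrightarrow> f \<in> free_vectors I \<Longrightarrow> d (\<lambda>x. r * f x) = (\<lambda>y. r * d f y)"
  using assms unfolding free_hom_def by blast+

lemma linear_compose:
  assumes "free_hom I J d" "g \<in> linear_to_laurent J"
  shows "(\<lambda>f. g (d f)) \<in> linear_to_laurent I"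
  unfolding linear_to_laurent_def
proof (intro CollectI conjI ballI)
  note d = free_homD[OF assms(1)] and g = linear_to_laurentD[OF assms(2)]
  show "g (d (f + f')) = g (d f) + g (d f')" if "f \<in> free_vectors I" "f' \<in> free_vectors I" for f f'
    unfolding d(2)[OF that] by (rule g(1)[OF d(1)[OF that(1)] d(1)[OF that(2)]])
  show "g (d (\<lambda>x. r * f x)) = r * g (d f)" if "r \<in> polys" "f \<in> free_vectors I" for r f
    unfolding d(3)[OF that] by (rule g(2)[OF that(1) d(1)[OF that(2)]])
qed

definition degree_preserving :: "'x set \<Rightarrow> ('x \<Rightarrow> int ^ 'n) \<Rightarrow> 'y set \<Rightarrow> ('y \<Rightarrow> int ^ 'n) \<Rightarrow>
    (('x \<Rightarrow> ('k::field, 'n::finite) laurent) \<Rightarrow> 'y \<Rightarrow> ('k, 'n) laurent) \<Rightarrow> bool" where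
  "degree_preserving I \<delta> J \<epsilon> d \<longleftrightarrow>
     (\<forall>a. d ` homog (free_gmodule poly_ring I \<delta>) a \<subseteq> homog (free_gmodule poly_ring J \<epsilon>) a)"

lemma linear_of_degree_compose:
  assumes "free_hom I J d" "degree_preserving I \<delta> J \<epsilon> d" "g \<in> linear_of_degree J \<epsilon> b"
  shows "(\<lambda>f. g (d f)) \<in> linear_of_degree I \<delta> b"
  using assms(2,3) linear_compose[OF assms(1), of g]
  unfolding linear_of_degree_def degree_preserving_def by blast


subsection \<open>The pairing\<close>

text \<open>
  The lift \<open>g\<close> induces \<open>F \<otimes> N \<rightarrow> T \<otimes> N \<rightarrow> T\<close>, and the last step takes the coefficient of the monomial \<open>1\<close>.
\<close>

definition pairing :: "(('x \<Rightarrow> ('k::field, 'n::finite) laurent) \<Rightarrow> ('k, 'n) laurent) \<Rightarrow>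
    (('x \<Rightarrow> ('k, 'n) laurent) \<times> ('k, 'n) laurent \<Rightarrow> ('k, 'n) laurent) \<Rightarrow> 'k" where
  "pairing g c = Poly_Mapping.lookup (wsum (\<lambda>(f, n). g f * n) c) 0"

lemma lookup_scale: "Poly_Mapping.lookup (monomial 0 c * t) a = c * Poly_Mapping.lookup t a"
  for t :: "('k::field, 'n::finite) laurent"
proof -
  have "Poly_Mapping.lookup (monomial 0 c * t) a = Poly_Mapping.lookup (Poly_Mapping.map ((*) c) t) a"
    by (simp add: mult_map_scale_conv_mult)
  then show ?thesis by (simp add: Poly_Mapping.map.rep_eq when_def)
qed

lemma pairing_add_left: "pairing (g + g') c = pairing g c + pairing g' c"
proof -
  have "(\<lambda>(f, n). (g + g') f * n) = (\<lambda>p. (\<lambda>(f, n). g f * n) p + (\<lambda>(f, n). g' f * n) p)"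
    by (auto simp: fun_eq_iff distrib_right)
  then show ?thesis unfolding pairing_def by (simp only: wsum_add_left lookup_add)
qed

lemma pairing_scale_left: "pairing (fscale t g) c = t * pairing g c"
proof -
  have "(\<lambda>(f, n). fscale t g f * n) = (\<lambda>p. monomial 0 t * (\<lambda>(f, n). g f * n) p)"
    by (auto simp: fun_eq_iff fscale_apply mult.assoc)
  then show ?thesis unfolding pairing_def by (simp only: wsum_smult_left lookup_scale)
qed

lemma pairing_add_right:
  "c \<in> free_vectors P \<Longrightarrow> c' \<in> free_vectors P \<Longrightarrow> pairing g (c + c') = pairing g c + pairing g c'"
  unfolding pairing_def by (simp only: wsum_add lookup_add)

lemma pairing_scale_right:
  "c \<in> free_vectors P \<Longrightarrow> pairing g (fscale t c) = t * pairing g c"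
  unfolding pairing_def fscale_def by (simp only: wsum_smult lookup_scale)

lemma pairing_bvec: "pairing g (bvec r (f, n)) = Poly_Mapping.lookup (r * (g f * n)) 0"
  unfolding pairing_def by simp

lemma pairing_zero_right: "pairing g 0 = 0"
  unfolding pairing_def by simp

lemma pairing_free_map:
  assumes "c \<in> free_vectors P"
  shows "pairing g (free_map poly_ring (map_prod d id) c) = pairing (\<lambda>f. g (d f)) c"
proof -
  have "(\<lambda>p. (\<lambda>(f, n). g f * n) (map_prod d id p)) = (\<lambda>(f, n). g (d f) * n)"
    by (auto simp: fun_eq_iff)
  from arg_cong[where f = "\<lambda>w. Poly_Mapping.lookup (wsum w c) 0", OF this]
  show ?thesis unfolding pairing_def wsum_free_map[OF assms] .
qed

lemma (in tensor_with) pairing_rel: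
  assumes "c \<in> rel" "g \<in> linear_to_laurent I"
  shows "pairing g c = 0"
proof -
  have "wsum (\<lambda>(f, n). g f * n) c = 0"
    by (rule wsum_rel[OF assms(1)]) (fact linear_to_laurentD[OF assms(2)])+
  then show ?thesis unfolding pairing_def by (simp only: lookup_zero)
qed

lemma functionalD:
  assumes "functional L"
  shows "L (u + v) = L u + L v" "L (fscale c u) = c * L u" "L 0 = 0" "L (u - v) = L u - L v"
proof -
  show add: "L (u + v) = L u + L v" for u v using assms by (simp add: functional_def)
  show scale: "L (fscale c u) = c * L u" for c u using assms by (simp add: functional_def)
  show "L 0 = 0" using scale[of 0 0] by simp
  show "L (u - v) = L u - L v" using add[of "u - v" v] by (simp del: minus_apply)
qed

context tensor_with
begin

lemma functional_on_rel:
  assumes L: "functional L" and rel: "\<forall>c\<in>rel. L c = 0" and "f \<in> free_vectors I" "n \<in> N"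
  shows "f' \<in> free_vectors I \<Longrightarrow> L (bvec 1 (f + f', n)) = L (bvec 1 (f, n)) + L (bvec 1 (f', n))"
    and "r \<in> polys \<Longrightarrow> L (bvec 1 (\<lambda>x. r * f x, n)) = L (bvec r (f, n))"
    and "r \<in> polys \<Longrightarrow> L (bvec 1 (f, r * n)) = L (bvec r (f, n))"
proof -
  have rel: "L u = L v" if "u - v \<in> rel" for u v
    using bspec[OF rel that] unfolding functionalD(4)[OF L] by (simp only: right_minus_eq)
  show "L (bvec 1 (f + f', n)) = L (bvec 1 (f, n)) + L (bvec 1 (f', n))" if "f' \<in> free_vectors I"
    using rel[OF rel_bilinear(1)[OF assms(3,4) that]] unfolding functionalD(1)[OF L] .
  show "L (bvec 1 (\<lambda>x. r * f x, n)) = L (bvec r (f, n))" if "r \<in> polys"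
    by (rule rel[OF rel_bilinear(3)[OF assms(3,4) that]])
  show "L (bvec 1 (f, r * n)) = L (bvec r (f, n))" if "r \<in> polys"
    by (rule rel[OF rel_bilinear(4)[OF assms(3,4) that]])
qed

text \<open>
  Modulo the relations, \<open>F \<otimes> N\<close> in degree \<open>-b\<close> is spanned by the elements \<open>e\<^sub>x \<otimes> m\<close>, where \<open>m\<close> is a monomial
  of \<open>N\<close> and has degree \<open>-b - \<delta> x\<close>.  The value of \<open>L\<close> at such an element becomes the coefficient of the
  value of \<open>g\<close> at \<open>e\<^sub>x\<close>, whose degree is \<open>\<delta> x + b\<close>.
\<close>

lemma functional_is_pairing:
  assumes L: "functional L" and rel: "\<forall>c\<in>rel. L c = 0"
  obtains g where "g \<in> linear_of_degree I \<delta> b"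
    and "\<And>c. c \<in> fs.span (homog_gens (- b)) \<Longrightarrow> pairing g c = L c"
proof -
  \<comment> \<open>For a monomial outside \<open>N\<close> this is a default value: \<open>N\<close> is \<open>0\<close> in that degree.\<close>
  define v :: "'x \<Rightarrow> ('k, 'n) laurent" where
    "v x = monomial (\<delta> x + b) (L (bvec 1 (bvec 1 x, xpow (- b - \<delta> x))))" for x
  note onrel = functional_on_rel[OF L rel]
  define g where "g = wsum v"
  have g: "g \<in> linear_of_degree I \<delta> b" unfolding g_def by (rule wsum_of_degree) (simp add: v_def)
  then have lin: "g \<in> linear_to_laurent I" by (simp add: linear_of_degree_def)
  have on_homog: "L (bvec 1 (f, n)) = Poly_Mapping.lookup (g f * n) 0"
    if f: "f \<in> free_vectors I" and "f \<in> homog FI a" and n: "n \<in> homog NT a'" and ab: "a + a' = - b" for f n a a'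
    using f that(2)
  proof (induction rule: free_vectors_induct)
    case zero
    have nN: "n \<in> N" using n by (simp add: NT_simps)
    have "L (bvec 1 (\<lambda>x. 0 * (0 :: 'x \<Rightarrow> ('k, 'n) laurent) x, n)) = L (bvec 0 (0, n))"
      by (rule onrel(2)[OF free_vectors_closed(1) nN polys_closed(1)])
    moreover have "bvec 0 (0, n) = (0 :: ('x \<Rightarrow> ('k, 'n) laurent) \<times> ('k, 'n) laurent \<Rightarrow> ('k, 'n) laurent)"
      by (auto simp: bvec_def)
    moreover have "(\<lambda>x. 0 * (0 :: 'x \<Rightarrow> ('k, 'n) laurent) x) = 0" by auto
    ultimately have 1: "L (bvec 1 (0, n)) = 0" using functionalD(3)[OF L] by (simp only:)
    show ?case unfolding 1 linear_to_laurent_zero[OF lin] mult_zero_left lookup_zero ..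
  next
    case (step f r x)
    have nN: "n \<in> N" using n by (simp add: NT_simps)
    have hom: "(f + bvec r x) y \<in> range (monomial (a - \<delta> y))" if "y \<in> I" for y
      using step(6) that by (simp only: free_gmodule_simps mem_Collect_eq)
    have fhom: "f \<in> homog FI a"
      unfolding free_gmodule_simps
    proof (intro CollectI conjI ballI step(1))
      fix y assume "y \<in> I"
      show "f y \<in> range (monomial (a - \<delta> y))"
      proof (cases "y = x")
        case True
        show ?thesis unfolding True step(4) by (rule range_single_closed(1))
      next
        case False
        then have "(f + bvec r x) y = f y" by (simp add: bvec_def)
        with hom[OF \<open>y \<in> I\<close>] show ?thesis by (simp only:)
      qed
    qed
    obtain s where s: "r = monomial (a - \<delta> x) s"
      using hom[OF step(3)] step(4) by (auto simp: bvec_def)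
    obtain t where t: "n = monomial a' t" using n by (auto simp: NT_simps)
    have deg: "a - \<delta> x + a' = - b - \<delta> x" using ab by (simp add: algebra_simps)
    have rn: "r * n = monomial (- b - \<delta> x) (s * t)"
      by (simp only: s t mult_single deg)
    have rnN: "r * n \<in> N" by (rule N_closed(3)[OF step(2) nN])
    have ex: "bvec 1 x \<in> free_vectors I" by (rule bvec_mem[OF polys_closed(2) step(3)])
    have "L (bvec 1 (bvec r x, n)) = Poly_Mapping.lookup (g (bvec r x) * n) 0"
    proof -
      have "L (bvec 1 (bvec r x, n)) = L (bvec 1 (\<lambda>y. r * bvec 1 x y, n))"
        by (simp only: bvec_smult mult_1_right)
      also have "\<dots> = L (bvec 1 (bvec 1 x, r * n))"
        unfolding onrel(2)[OF ex nN step(2)] onrel(3)[OF ex nN step(2)] ..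
      also have "\<dots> = s * t * L (bvec 1 (bvec 1 x, xpow (- b - \<delta> x)))"
      proof (cases "s * t = 0")
        case True
        have "L (bvec 1 (bvec 1 x, 0 * n)) = L (bvec 0 (bvec 1 x, n))"
          by (rule onrel(3)[OF ex nN polys_closed(1)])
        also have "bvec 0 (bvec 1 x, n) = (0 :: ('x \<Rightarrow> ('k, 'n) laurent) \<times> ('k, 'n) laurent \<Rightarrow> ('k, 'n) laurent)"
          by (auto simp: bvec_def)
        also have "L 0 = 0" by (rule functionalD(3)[OF L])
        finally have "L (bvec 1 (bvec 1 x, 0)) = 0" by (simp only: mult_zero_left)
        then show ?thesis unfolding rn True single_zero by simp
      next
        case False
        have p: "xpow (- b - \<delta> x) \<in> N"
          using monomial_module_mem_iff[OF monomial_N, of "r * n"] rnN False by (auto simp: rn)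
        have "L (bvec 1 (bvec 1 x, monomial 0 (s * t) * xpow (- b - \<delta> x)))
            = L (bvec (monomial 0 (s * t)) (bvec 1 x, xpow (- b - \<delta> x)))"
          by (rule onrel(3)[OF ex p single_zero_in_poly_ring])
        also have "\<dots> = L (fscale (s * t) (bvec 1 (bvec 1 x, xpow (- b - \<delta> x))))"
          by (simp add: bvec_scale)
        finally show ?thesis by (simp add: rn mult_single functionalD[OF L])
      qed
      also have "\<dots> = Poly_Mapping.lookup (g (bvec r x) * n) 0"
      proof -
        have "g (bvec r x) * n = r * n * v x" by (simp add: g_def mult_ac)
        also have "\<dots> = monomial 0 (s * t * L (bvec 1 (bvec 1 x, xpow (- b - \<delta> x))))"
          by (simp add: rn v_def mult_single)
        finally show ?thesis by simp
      qed
      finally show ?thesis .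
    qed
    moreover have "L (bvec 1 (f + bvec r x, n)) = L (bvec 1 (f, n)) + L (bvec 1 (bvec r x, n))"
      by (rule onrel(1)[OF step(1) nN bvec_mem[OF step(2,3)]])
    moreover have "g (f + bvec r x) = g f + g (bvec r x)"
      by (rule linear_to_laurentD(1)[OF lin step(1) bvec_mem[OF step(2,3)]])
    ultimately show ?case using step(5)[OF fhom] by (simp only: distrib_right lookup_add)
  qed
  have on_span: "c \<in> free_vectors pairs \<and> pairing g c = L c" if "c \<in> fs.span (homog_gens (- b))" for c
    using that
  proof (induction rule: fs.span_induct_alt)
    case base
    have "pairing g 0 = L 0" unfolding pairing_zero_right functionalD(3)[OF L] ..
    then show ?case using free_vectors_closed(1)[of pairs] by (simp add: zero_fun_def)
  next
    case (step c x y)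
    from step(1) obtain t f n a a' where x: "x = bvec (monomial 0 t) (f, n)"
      and h: "f \<in> homog FI a" "n \<in> homog NT a'" "a + a' = - b" unfolding homog_gens_def by blast
    have fv: "f \<in> free_vectors I" using h by (simp add: free_gmodule_simps)
    have xm: "x \<in> free_vectors pairs" using homog_gens_subset step(1) by blast
    have "x = fscale t (bvec 1 (f, n))" by (simp add: x bvec_scale)
    then have "L x = t * L (bvec 1 (f, n))" by (simp add: functionalD[OF L])
    also have "\<dots> = pairing g x"
      unfolding on_homog[OF fv h] x pairing_bvec by (simp add: lookup_scale)
    finally have "pairing g (fscale c x + y) = L (fscale c x + y)"
      using step(2) xm fs.subspace_scale[OF free_vectors_subspace xm, of c]
      by (simp only: pairing_add_right[of _ pairs] pairing_scale_right[of _ pairs] functionalD[OF L])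
    moreover have "fscale c x + y \<in> free_vectors pairs"
      using step(2) xm by (intro free_vectors_closed fs.subspace_scale[OF free_vectors_subspace]) auto
    ultimately show ?case by (simp add: plus_fun_def)
  qed
  show ?thesis by (rule that[OF g conjunct2[OF on_span]])
qed

end


section \<open>Graded homomorphisms into \<open>T/M\<close>\<close>

locale hom_into =
  fixes I :: "'x set" and \<delta> :: "'x \<Rightarrow> int ^ 'n::finite" and M :: "('k::field, 'n) laurent set"
  assumes monomial_M: "monomial_module M"
begin

abbreviation "FI \<equiv> free_gmodule (poly_ring :: ('k, 'n) poly_gmodule) I \<delta>"
abbreviation "Q \<equiv> gquot laurent_ring M"
abbreviation "mcoset t \<equiv> M +>\<^bsub>laurent_ring\<^esub> t"

lemmas M_closed = monomial_moduleD[OF monomial_M]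

lemma M_uminus: "t \<in> M \<Longrightarrow> - t \<in> M"
  using M_closed(3)[OF polys_closed(5)[OF polys_closed(2)], of t] by simp

lemma M_diff: "s \<in> M \<Longrightarrow> t \<in> M \<Longrightarrow> s - t \<in> M"
  using M_closed(2)[OF _ M_uminus] by (metis diff_conv_add_uminus)

lemma laurent_ring_simps:
  "carrier laurent_ring = UNIV" "add laurent_ring = (+)" "smult laurent_ring = (*)"
  "homog laurent_ring = (\<lambda>b. range (monomial b))"
  by (simp_all add: laurent_ring_def)

lemma mcoset_eq: "mcoset t = {m + t | m. m \<in> M}"
  by (auto simp: a_r_coset_def r_coset_def laurent_ring_simps)

lemma mcoset_eq_iff: "mcoset s = mcoset t \<longleftrightarrow> s - t \<in> M"
proof
  assume "mcoset s = mcoset t"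
  moreover have "s \<in> mcoset s" using M_closed(1) by (auto simp: mcoset_eq intro!: exI[of _ 0])
  ultimately show "s - t \<in> M" by (auto simp: mcoset_eq)
next
  assume *: "s - t \<in> M"
  have "m + s = (m + (s - t)) + t" "m + t = (m - (s - t)) + s" for m by simp_all
  then show "mcoset s = mcoset t"
    unfolding mcoset_eq using M_closed(2)[OF _ *] M_diff[OF _ *] by blast
qed

lemma mcoset_zero: "mcoset 0 = M"
  by (auto simp: mcoset_eq)

lemma mcoset_add: "mcoset s <+>\<^bsub>laurent_ring\<^esub> mcoset t = mcoset (s + t)"
proof -
  have "mcoset s <+>\<^bsub>laurent_ring\<^esub> mcoset t = {(m + s) + (m' + t) | m m'. m \<in> M \<and> m' \<in> M}"
    by (auto simp: set_add_def set_mult_def mcoset_eq laurent_ring_simps)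
  also have "\<dots> = {m + (s + t) | m. m \<in> M}"
  proof (intro equalityI subsetI)
    fix y assume "y \<in> {(m + s) + (m' + t) | m m'. m \<in> M \<and> m' \<in> M}"
    then obtain m m' where "y = (m + m') + (s + t)" "m \<in> M" "m' \<in> M" by (auto simp: add_ac)
    then show "y \<in> {m + (s + t) | m. m \<in> M}" using M_closed(2) by blast
  next
    fix y assume "y \<in> {m + (s + t) | m. m \<in> M}"
    then obtain m where "y = (m + s) + (0 + t)" "m \<in> M" by (auto simp: add_ac)
    then show "y \<in> {(m + s) + (m' + t) | m m'. m \<in> M \<and> m' \<in> M}" using M_closed(1) by blast
  qed
  finally show ?thesis by (simp add: mcoset_eq)
qed

lemma mcoset_smult:
  assumes "r \<in> polys"
  shows "(\<Union>x\<in>mcoset t. mcoset (r * x)) = mcoset (r * t)"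
proof -
  have "mcoset (r * x) = mcoset (r * t)" if "x \<in> mcoset t" for x
    using that M_closed(3)[OF assms] by (auto simp: mcoset_eq_iff mcoset_eq[of t] algebra_simps)
  moreover have "t \<in> mcoset t" using M_closed(1) by (auto simp: mcoset_eq intro!: exI[of _ 0])
  ultimately show ?thesis by blast
qed

lemma Q_simps:
  "carrier Q = range mcoset" "zero Q = mcoset 0" "add Q = set_add laurent_ring"
  "r \<in> polys \<Longrightarrow> r \<odot>\<^bsub>Q\<^esub> mcoset t = mcoset (r * t)"
  "homog Q a = mcoset ` range (monomial a)"
proof -
  show "r \<odot>\<^bsub>Q\<^esub> mcoset t = mcoset (r * t)" if "r \<in> polys"
    using mcoset_smult[OF that] by (simp add: gmodule_record_simps laurent_ring_simps)
  show "zero Q = mcoset 0" by (simp only: gmodule_record_simps mcoset_zero)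
  show "homog Q a = mcoset ` range (monomial a)"
    by (simp only: gmodule_record_simps laurent_ring_simps)
qed (auto simp: gmodule_record_simps A_RCOSETS_def RCOSETS_def a_r_coset_def laurent_ring_simps)

definition hom_of :: "(('x \<Rightarrow> ('k, 'n) laurent) \<Rightarrow> ('k, 'n) laurent) \<Rightarrow> ('x \<Rightarrow> ('k, 'n) laurent) \<Rightarrow> ('k, 'n) laurent set" where
  "hom_of g = (\<lambda>f\<in>free_vectors I. mcoset (g f))"

lemma hom_of_eq_iff: "hom_of g = hom_of g' \<longleftrightarrow> (\<forall>f\<in>free_vectors I. g f - g' f \<in> M)"
  unfolding hom_of_def mcoset_eq_iff[symmetric] by (auto simp: fun_eq_iff restrict_def)

lemma hom_module_simps:
  "zero (hom_module poly_ring FI Q) = hom_of 0"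
  "add (hom_module poly_ring FI Q) = (\<lambda>f g. \<lambda>x\<in>free_vectors I. f x <+>\<^bsub>laurent_ring\<^esub> g x)"
  "smult (hom_module poly_ring FI Q) = (\<lambda>r f. \<lambda>x\<in>free_vectors I. r \<odot>\<^bsub>Q\<^esub> f x)"
  by (simp_all add: hom_module_def hom_of_def free_gmodule_simps Q_simps)

lemma hom_of_mem:
  assumes "g \<in> linear_to_laurent I"
  shows "hom_of g \<in> carrier (hom_module poly_ring FI Q)"
  using linear_to_laurentD[OF assms]
  by (auto simp: hom_module_def module_hom_def hom_of_def free_gmodule_simps Q_simps mcoset_add
      free_vectors_closed)

text \<open>
  Since \<open>F\<close> is free, a homomorphism to \<open>T/M\<close> lifts to \<open>T\<close>: the lift may be prescribed on the basis.
\<close>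

lemma hom_lift:
  assumes \<phi>: "\<phi> \<in> carrier (hom_module poly_ring FI Q)" and v: "\<And>x. x \<in> I \<Longrightarrow> \<phi> (bvec 1 x) = mcoset (v x)"
  shows "\<phi> = hom_of (wsum v)"
proof
  have add: "\<phi> (f + f') = \<phi> f <+>\<^bsub>laurent_ring\<^esub> \<phi> f'" if "f \<in> free_vectors I" "f' \<in> free_vectors I" for f f'
    using \<phi> that by (simp add: hom_module_def module_hom_def free_gmodule_simps Q_simps)
  have smult: "\<phi> (\<lambda>x. r * f x) = r \<odot>\<^bsub>Q\<^esub> \<phi> f" if "r \<in> polys" "f \<in> free_vectors I" for r f
    using \<phi> that by (simp add: hom_module_def module_hom_def free_gmodule_simps)
  have car: "\<phi> f \<in> range mcoset" if "f \<in> free_vectors I" for f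
    using \<phi> that by (auto simp: hom_module_def module_hom_def free_gmodule_simps Q_simps)
  have on_free: "\<phi> f = mcoset (wsum v f)" if "f \<in> free_vectors I" for f
    using that
  proof (induction rule: free_vectors_induct)
    case zero
    have z: "(\<lambda>x. 0 * (0 :: 'x \<Rightarrow> ('k, 'n) laurent) x) = 0" by auto
    obtain t where t: "\<phi> 0 = mcoset t" using car[OF free_vectors_closed(1)] by auto
    have "\<phi> 0 = mcoset 0"
      using smult[OF polys_closed(1) free_vectors_closed(1)[of I], unfolded z] Q_simps(4)[OF polys_closed(1)]
      unfolding t by simp
    then show ?case unfolding wsum_zero .
  next
    case (step f r x)
    have e: "bvec 1 x \<in> free_vectors I" "bvec r x \<in> free_vectors I"
      using step(2,3) polys_closed(2) by (auto intro: bvec_mem)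
    have "\<phi> (bvec r x) = \<phi> (\<lambda>y. r * bvec 1 x y)" by (simp only: bvec_smult mult_1_right)
    also have "\<dots> = mcoset (r * v x)"
      unfolding smult[OF step(2) e(1)] v[OF step(3)] by (rule Q_simps(4)[OF step(2)])
    finally have "\<phi> (f + bvec r x) = mcoset (wsum v f + r * v x)"
      unfolding add[OF step(1) e(2)] step(5) by (simp add: mcoset_add)
    then show ?case unfolding wsum_add[OF step(1) e(2)] wsum_bvec .
  qed
  fix f show "\<phi> f = hom_of (wsum v) f"
  proof (cases "f \<in> free_vectors I")
    case True
    then show ?thesis by (simp add: hom_of_def on_free)
  next
    case False
    then show ?thesis using \<phi>
      by (auto simp: hom_of_def hom_module_def free_gmodule_simps extensional_def)
  qed
qed

lemma bvec_homog:
  assumes "x \<in> I"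
  shows "bvec 1 x \<in> homog FI (\<delta> x)"
  unfolding free_gmodule_simps
proof (intro CollectI conjI ballI)
  show "bvec 1 x \<in> (free_vectors I :: ('x \<Rightarrow> ('k, 'n) laurent) set)"
    by (rule bvec_mem[OF polys_closed(2) assms])
  show "bvec 1 x y \<in> (range (monomial (\<delta> x - \<delta> y)) :: ('k, 'n) laurent set)" for y
  proof (cases "y = x")
    case True
    then show ?thesis by (auto simp: bvec_def intro: range_eqI[of _ _ 1])
  next
    case False
    then show ?thesis using range_single_closed(1) by (auto simp: bvec_def)
  qed
qed

lemma carrier_hom_module: "carrier (hom_module poly_ring FI Q) = hom_of ` linear_to_laurent I"
proof (intro equalityI subsetI)
  fix \<phi> assume \<phi>: "\<phi> \<in> carrier (hom_module poly_ring FI Q)"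
  have "\<exists>t. \<phi> (bvec 1 x) = mcoset t" if "x \<in> I" for x
  proof -
    have "\<phi> \<in> free_vectors I \<rightarrow> range mcoset"
      using \<phi> by (simp add: hom_module_def module_hom_def free_gmodule_simps Q_simps)
    from funcset_mem[OF this bvec_mem[OF polys_closed(2) that]] show ?thesis by blast
  qed
  then obtain v where "\<And>x. x \<in> I \<Longrightarrow> \<phi> (bvec 1 x) = mcoset (v x)" by metis
  from hom_lift[OF \<phi> this] show "\<phi> \<in> hom_of ` linear_to_laurent I" using wsum_linear by blast
qed (use hom_of_mem in auto)

lemma hom_deg_eq: "hom_deg poly_ring FI Q b = hom_of ` linear_of_degree I \<delta> b"
proof (intro equalityI subsetI)
  fix \<phi> assume "\<phi> \<in> hom_deg poly_ring FI Q b"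
  then have \<phi>: "\<phi> \<in> carrier (hom_module poly_ring FI Q)"
    and deg: "\<And>a. \<phi> ` homog FI a \<subseteq> homog Q (a + b)" by (auto simp: hom_deg_def)
  have "\<exists>t. t \<in> range (monomial (\<delta> x + b)) \<and> \<phi> (bvec 1 x) = mcoset t" if "x \<in> I" for x
    using deg[of "\<delta> x"] bvec_homog[OF that] unfolding Q_simps by blast
  then obtain v where v: "\<And>x. x \<in> I \<Longrightarrow> v x \<in> range (monomial (\<delta> x + b))"
    "\<And>x. x \<in> I \<Longrightarrow> \<phi> (bvec 1 x) = mcoset (v x)" by metis
  from hom_lift[OF \<phi> v(2)] wsum_of_degree[of I v \<delta> b, OF v(1)]
  show "\<phi> \<in> hom_of ` linear_of_degree I \<delta> b" by blast
next
  fix \<phi> assume "\<phi> \<in> hom_of ` linear_of_degree I \<delta> b"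
  then obtain g where g: "g \<in> linear_of_degree I \<delta> b" "\<phi> = hom_of g" by auto
  have "hom_of g ` homog FI a \<subseteq> homog Q (a + b)" for a
  proof
    fix y assume "y \<in> hom_of g ` homog FI a"
    then obtain f where f: "f \<in> homog FI a" "y = hom_of g f" by auto
    then have "y = mcoset (g f)" by (simp add: hom_of_def free_gmodule_simps)
    moreover have "g f \<in> range (monomial (a + b))" using g(1) f(1) by (simp add: linear_of_degree_def)
    ultimately show "y \<in> homog Q (a + b)" unfolding Q_simps by blast
  qed
  moreover have "hom_of g \<in> carrier (hom_module poly_ring FI Q)"
    using g by (intro hom_of_mem) (simp add: linear_of_degree_def)
  ultimately show "\<phi> \<in> hom_deg poly_ring FI Q b" unfolding hom_deg_def g(2) by blast
qed

lemma represented_hom_module: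
  "represented (linear_to_laurent I) hom_of (hom_module poly_ring FI Q)"
proof
  show "hom_of a \<oplus>\<^bsub>hom_module poly_ring FI Q\<^esub> hom_of b = hom_of (a + b)" for a b
    by (auto simp: hom_module_simps hom_of_def fun_eq_iff restrict_def mcoset_add)
  show "monomial 0 c \<odot>\<^bsub>hom_module poly_ring FI Q\<^esub> hom_of a = hom_of (fscale c a)" for a c
    by (auto simp: hom_module_simps hom_of_def fun_eq_iff restrict_def fscale_apply
        Q_simps(4)[OF single_zero_in_poly_ring])
qed (simp_all add: linear_to_laurent_subspace carrier_hom_module hom_module_simps)

text \<open>
  The graded Hom contains only the finite sums of homogeneous maps, so not every linear map to \<open>T\<close> is
  admitted as a lift.
\<close>

definition lifts :: "(('x \<Rightarrow> ('k, 'n) laurent) \<Rightarrow> ('k, 'n) laurent) set" where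
  "lifts = fs.span (\<Union>b. linear_of_degree I \<delta> b)"

lemma union_subset: "(\<Union>b. linear_of_degree I \<delta> b) \<subseteq> linear_to_laurent I"
  by (auto simp: linear_of_degree_def)

lemma lifts_subset: "lifts \<subseteq> linear_to_laurent I"
  unfolding lifts_def by (rule fs.span_minimal[OF union_subset linear_to_laurent_subspace])

lemma lifts_subspace: "fs.subspace lifts"
  unfolding lifts_def by (rule fs.subspace_span)

lemma linear_of_degree_lifts: "linear_of_degree I \<delta> b \<subseteq> lifts"
  unfolding lifts_def using fs.span_superset by blast

lemma gHom_simps:
  "carrier (gHom poly_ring FI Q) = hom_of ` lifts"
  "zero (gHom poly_ring FI Q) = zero (hom_module poly_ring FI Q)"
  "add (gHom poly_ring FI Q) = add (hom_module poly_ring FI Q)"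
  "smult (gHom poly_ring FI Q) = smult (hom_module poly_ring FI Q)"
  "homog (gHom poly_ring FI Q) b = hom_of ` linear_of_degree I \<delta> b"
proof -
  interpret H: represented "linear_to_laurent I" hom_of "hom_module poly_ring FI Q"
    by (rule represented_hom_module)
  have eq: "(\<Union>b. hom_deg poly_ring FI Q b) = hom_of ` (\<Union>b. linear_of_degree I \<delta> b)"
    by (auto simp: hom_deg_eq)
  have scale: "fscale c s \<in> (\<Union>b. linear_of_degree I \<delta> b)" if s: "s \<in> (\<Union>b. linear_of_degree I \<delta> b)" for c s
  proof -
    obtain b where "s \<in> linear_of_degree I \<delta> b" using s by auto
    from fs.subspace_scale[OF linear_of_degree_subspace this] show ?thesis by (rule UN_I[OF UNIV_I])
  qed
  have "generate (add_monoid (hom_module poly_ring FI Q)) (\<Union>b. hom_deg poly_ring FI Q b) = hom_of ` lifts"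
    unfolding eq lifts_def by (rule H.generate_image[OF union_subset scale])
  then show "carrier (gHom poly_ring FI Q) = hom_of ` lifts"
    by (simp add: gHom_def module.defs gmodule.defs)
qed (simp_all add: gHom_def module.defs gmodule.defs hom_deg_eq)

lemma represented_gHom: "represented lifts hom_of (gHom poly_ring FI Q)"
proof -
  interpret H: represented "linear_to_laurent I" hom_of "hom_module poly_ring FI Q"
    by (rule represented_hom_module)
  show ?thesis
  proof
    show "hom_of a \<oplus>\<^bsub>gHom poly_ring FI Q\<^esub> hom_of b = hom_of (a + b)" if "a \<in> lifts" "b \<in> lifts" for a b
      using H.add_eq[of a b] that lifts_subset by (simp add: gHom_simps subset_iff)
    show "monomial 0 c \<odot>\<^bsub>gHom poly_ring FI Q\<^esub> hom_of a = hom_of (fscale c a)" if "a \<in> lifts" for a c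
      using H.smult_eq[of a c] that lifts_subset by (simp add: gHom_simps subset_iff)
  qed (simp_all add: lifts_subspace gHom_simps hom_module_simps)
qed

end


section \<open>The duality between cochains and chains\<close>

subsection \<open>Induced maps of tensor products\<close>

abbreviation tmap :: "(('x \<Rightarrow> ('k::field, 'n::finite) laurent) \<Rightarrow> 'y \<Rightarrow> ('k, 'n) laurent) \<Rightarrow>
    (('x \<Rightarrow> ('k, 'n) laurent) \<times> ('k, 'n) laurent \<Rightarrow> ('k, 'n) laurent) \<Rightarrow>
    ('y \<Rightarrow> ('k, 'n) laurent) \<times> ('k, 'n) laurent \<Rightarrow> ('k, 'n) laurent" where
  "tmap d \<equiv> free_map poly_ring (map_prod d id)"

locale tensor_step =
  fixes I :: "'x set" and \<delta> :: "'x \<Rightarrow> int ^ 'n::finite" and J :: "'y set" and \<epsilon> :: "'y \<Rightarrow> int ^ 'n"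
    and d :: "('x \<Rightarrow> ('k::field, 'n) laurent) \<Rightarrow> 'y \<Rightarrow> ('k, 'n) laurent" and N :: "('k, 'n) laurent set"
  assumes monomial_N: "monomial_module N" and hom_d: "free_hom I J d"
    and deg_d: "degree_preserving I \<delta> J \<epsilon> d"
begin

sublocale src: tensor_with I \<delta> N by unfold_locales (rule monomial_N)
sublocale tgt: tensor_with J \<epsilon> N by unfold_locales (rule monomial_N)

lemmas d = free_homD[OF hom_d]

lemma tmap_mem: "c \<in> free_vectors src.pairs \<Longrightarrow> tmap d c \<in> free_vectors tgt.pairs"
  by (rule free_map_mem) (use d(1) in auto)

lemma tmap_gens:
  assumes "c \<in> src.gens"
  shows "tmap d c \<in> tgt.rel"
proof -
  note e = bvec_mem[OF _ UNIV_I] and e1 = bvec_mem[OF polys_closed(2) UNIV_I]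
  have three: "tmap d (bvec 1 p - (bvec 1 q + bvec 1 q'))
      = bvec 1 (map_prod d id p) - (bvec 1 (map_prod d id q) + bvec 1 (map_prod d id q'))" for p q q'
    unfolding free_map_diff[OF e1 free_vectors_closed(2)[OF e1 e1]] free_map_add[OF e1 e1]
      free_map_bvec[OF polys_closed(2)] ..
  have two: "tmap d (bvec 1 p - bvec r q) = bvec 1 (map_prod d id p) - bvec r (map_prod d id q)"
    if "r \<in> polys" for p q r
    unfolding free_map_diff[OF e1 e[OF that]] free_map_bvec[OF polys_closed(2)] free_map_bvec[OF that] ..
  from assms show ?thesis
  proof (cases rule: src.gens_cases)
    case (add_left f f' n)
    show ?thesis
      unfolding add_left(1) three map_prod_simp id_apply d(2)[OF add_left(2,3)]
      by (rule tgt.rel_bilinear(1)[OF d(1)[OF add_left(2)] add_left(4) d(1)[OF add_left(3)]])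
  next
    case (add_right f n n')
    show ?thesis
      unfolding add_right(1) three map_prod_simp id_apply
      by (rule tgt.rel_bilinear(2)[OF d(1)[OF add_right(2)] add_right(3,4)])
  next
    case (smult_left r f n)
    show ?thesis
      unfolding smult_left(1) two[OF smult_left(2)] map_prod_simp id_apply d(3)[OF smult_left(2,3)]
      by (rule tgt.rel_bilinear(3)[OF d(1)[OF smult_left(3)] smult_left(4,2)])
  next
    case (smult_right r f n)
    show ?thesis
      unfolding smult_right(1) two[OF smult_right(2)] map_prod_simp id_apply
      by (rule tgt.rel_bilinear(4)[OF d(1)[OF smult_right(3)] smult_right(4,2)])
  qed
qed

lemma tmap_rel:
  assumes "c \<in> src.rel"
  shows "tmap d c \<in> tgt.rel"
  using assms
proof (induction rule: src.rel_induct)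
  case zero
  show ?case unfolding free_map_zero by (rule tgt.rel_closed(1))
next
  case (add c c')
  show ?case unfolding free_map_add[OF add(1,2)] by (rule tgt.rel_closed(2)[OF add(3,4)])
next
  case (smult r c)
  show ?case unfolding free_map_smult[OF smult(1,2)] by (rule tgt.rel_closed(3)[OF smult(1,3)])
next
  case (gens c)
  then show ?case by (rule tmap_gens)
qed

lemma tmap_scale: "c \<in> free_vectors src.pairs \<Longrightarrow> tmap d (fscale t c) = fscale t (tmap d c)"
  unfolding fscale_def by (rule free_map_smult[OF single_zero_in_poly_ring])

lemma tmap_homog:
  assumes "c \<in> fs.span (src.homog_gens b)"
  shows "tmap d c \<in> fs.span (tgt.homog_gens b)"
proof -
  have "c \<in> free_vectors src.pairs \<and> tmap d c \<in> fs.span (tgt.homog_gens b)"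
    using assms
  proof (induction rule: fs.span_induct_alt)
    case base
    have "tmap d 0 \<in> fs.span (tgt.homog_gens b)" unfolding free_map_zero by (rule fs.span_zero)
    with free_vectors_closed(1)[of src.pairs] show ?case unfolding zero_fun_def by (rule conjI)
  next
    case (step t c c')
    obtain u f n a a' where c: "c = bvec (monomial 0 u) (f, n)"
      and h: "f \<in> homog src.FI a" "n \<in> homog src.NT a'" "a + a' = b"
      using step(1) unfolding src.homog_gens_def by blast
    have cm: "c \<in> free_vectors src.pairs" using src.homog_gens_subset step(1) by blast
    have "tmap d c = bvec (monomial 0 u) (d f, n)"
      unfolding c free_map_bvec[OF single_zero_in_poly_ring] by simp
    moreover have "d f \<in> homog tgt.FI a" using deg_d h(1) unfolding degree_preserving_def by blast
    ultimately have "tmap d c \<in> tgt.homog_gens b" unfolding tgt.homog_gens_def using h by blast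
    then have 1: "fscale t (tmap d c) + tmap d c' \<in> fs.span (tgt.homog_gens b)"
      using conjunct2[OF step(2)] by (intro fs.span_add fs.span_scale) (rule fs.span_base)
    have tc: "fscale t c \<in> free_vectors src.pairs" by (rule fs.subspace_scale[OF free_vectors_subspace cm])
    have c': "c' \<in> free_vectors src.pairs" using step(2) by blast
    have 2: "tmap d (fscale t c + c') = fscale t (tmap d c) + tmap d c'"
      unfolding free_map_add[OF tc c'] tmap_scale[OF cm] ..
    from free_vectors_closed(2)[OF tc c'] 1[folded 2] show ?case by (simp only: plus_fun_def) 
  qed
  then show ?thesis ..
qed

lemma tensor_map_tcoset:
  assumes "c \<in> free_vectors src.pairs"
  shows "tensor_map poly_ring tgt.FI src.NT d (src.tcoset c) = tgt.tcoset (tmap d c)"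
proof -
  have coset: "src.tcoset c = (\<lambda>k. k + c) ` src.rel"
    using represented.coset_eq[OF free_module_represented src.rel_subspace src.rel_subset assms] by simp
  have "tgt.tcoset (tmap d (k + c)) = tgt.tcoset (tmap d c)" if k: "k \<in> src.rel" for k
  proof -
    have kf: "k \<in> free_vectors src.pairs" using src.rel_subset k by blast
    have eq: "tmap d (k + c) = tmap d k + tmap d c" by (rule free_map_add[OF kf assms])
    have "tmap d (k + c) - tmap d c = tmap d k" unfolding eq by (rule add_diff_cancel_right')
    with tmap_rel[OF k] show ?thesis
      by (subst tgt.tcoset_eq_iff[OF tmap_mem[OF free_vectors_closed(2)[OF kf assms]] tmap_mem[OF assms]])
        (simp only:)
  qed
  then show ?thesis
    unfolding tensor_map_def tgt.tensor_free_eq coset using src.rel_closed(1) by blast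
qed

end

text \<open>
  The well-definedness of the pairing of \<open>T/M\<close> with \<open>N\<close>: no monomial of \<open>T_dual M\<close> is inverse to a monomial
  of \<open>M\<close>, so that a product cannot have a constant term.
\<close>

lemma lookup_mult_T_dual:
  assumes M: "monomial_module M" and m: "m \<in> M" and n: "n \<in> T_dual M"
  shows "Poly_Mapping.lookup (m * n) 0 = 0"
proof (rule ccontr)
  assume "Poly_Mapping.lookup (m * n) 0 \<noteq> 0"
  then have "0 \<in> Poly_Mapping.keys (m * n)" by (simp add: in_keys_iff)
  then obtain a b where ab: "0 = a + b" "a \<in> Poly_Mapping.keys m" "b \<in> Poly_Mapping.keys n"
    using keys_mult[of m n] by auto
  then have "a = - b" by (simp add: eq_neg_iff_add_eq_0)
  then have "xpow a \<notin> M" using n ab(3) by (simp add: T_dual_def)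
  then show False using monomial_module_mem_iff[OF M, of m] m ab(2) by blast
qed

lemma pairing_eq_0_of_M:
  assumes M: "monomial_module M" and g: "\<And>f. f \<in> free_vectors I \<Longrightarrow> g f \<in> M"
    and c: "c \<in> free_vectors (free_vectors I \<times> T_dual M)"
  shows "pairing g c = 0"
proof -
  have "Poly_Mapping.lookup (c (f, n) * (g f * n)) 0 = 0" if "c (f, n) \<noteq> 0" for f n
  proof -
    have fn: "f \<in> free_vectors I" "n \<in> T_dual M" using free_vectorsD(3)[OF c that] by auto
    have "c (f, n) * g f \<in> M" by (rule monomial_moduleD(3)[OF M free_vectorsD(1)[OF c] g[OF fn(1)]])
    from lookup_mult_T_dual[OF M this fn(2)] show ?thesis by (simp add: mult.assoc)
  qed
  then show ?thesis unfolding pairing_def wsum_def by (auto simp: lookup_sum intro!: sum.neutral)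
qed


subsection \<open>Complexes of graded free modules\<close>

locale graded_complex =
  fixes I :: "nat \<Rightarrow> 'x set" and \<delta> :: "nat \<Rightarrow> 'x \<Rightarrow> int ^ 'n::finite"
    and d :: "nat \<Rightarrow> ('x \<Rightarrow> ('k::field, 'n) laurent) \<Rightarrow> 'x \<Rightarrow> ('k, 'n) laurent"
    and M :: "('k, 'n) laurent set" and b :: "int ^ 'n"
  assumes monomial_M: "monomial_module M" and hom_d: "free_hom (I (Suc i)) (I i) (d i)"
    and deg_d: "degree_preserving (I (Suc i)) (\<delta> (Suc i)) (I i) (\<delta> i) (d i)"
begin

abbreviation "N \<equiv> T_dual M"
abbreviation "NT \<equiv> gsub laurent_ring N"
abbreviation "F i \<equiv> free_gmodule (poly_ring :: ('k, 'n) poly_gmodule) (I i) (\<delta> i)"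
abbreviation "pairs i \<equiv> (free_vectors (I i) :: ('x \<Rightarrow> ('k, 'n) laurent) set) \<times> N"
abbreviation "rel i \<equiv> tensor_rel poly_ring (F i) NT"
abbreviation "tcoset i c \<equiv> rel i +>\<^bsub>free_module poly_ring (pairs i)\<^esub> c"
abbreviation "graded_chains i \<equiv> fs.span (tensor_with.homog_gens (I i) (\<delta> i) N (- b))"
abbreviation "hom_of i \<equiv> hom_into.hom_of (I i) M"
abbreviation "lifts i \<equiv> (hom_into.lifts (I i) (\<delta> i) :: (('x \<Rightarrow> ('k, 'n) laurent) \<Rightarrow> ('k, 'n) laurent) set)"

lemma hom_loc: "hom_into M" by unfold_locales (rule monomial_M)

lemma ten_loc: "tensor_with N"
  by unfold_locales (rule monomial_module_T_dual[OF monomial_M])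

lemma step_loc: "tensor_step (I (Suc i)) (\<delta> (Suc i)) (I i) (\<delta> i) (d i) N"
  by unfold_locales (rule monomial_module_T_dual[OF monomial_M], rule hom_d, rule deg_d)

text \<open>
  Cocycles and cycles are representatives in the single degree \<open>b\<close> or \<open>-b\<close>.  Coboundaries and boundaries
  are the images of whole modules, of all degrees, as in the definitions of Ext and Tor.  The case
  distinctions account for \<open>F\<^sub>-\<^sub>1 = 0\<close>.
\<close>

definition cocycles :: "nat \<Rightarrow> (('x \<Rightarrow> ('k, 'n) laurent) \<Rightarrow> ('k, 'n) laurent) set" where
  "cocycles i = {g \<in> linear_of_degree (I i) (\<delta> i) b. \<forall>f\<in>free_vectors (I (Suc i)). g (d i f) \<in> M}"

definition coboundaries :: "nat \<Rightarrow> (('x \<Rightarrow> ('k, 'n) laurent) \<Rightarrow> ('k, 'n) laurent) set" where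
  "coboundaries i = (case i of 0 \<Rightarrow> {0} | Suc j \<Rightarrow> (\<lambda>g f. g (d j f)) ` lifts j)"

definition cycles :: "nat \<Rightarrow> (('x \<Rightarrow> ('k, 'n) laurent) \<times> ('k, 'n) laurent \<Rightarrow> ('k, 'n) laurent) set" where
  "cycles i = {c \<in> graded_chains i. case i of 0 \<Rightarrow> True | Suc j \<Rightarrow> tmap (d j) c \<in> rel j}"

definition boundaries :: "nat \<Rightarrow> (('x \<Rightarrow> ('k, 'n) laurent) \<times> ('k, 'n) laurent \<Rightarrow> ('k, 'n) laurent) set" where
  "boundaries i = tmap (d i) ` free_vectors (pairs (Suc i))"

lemma chains_subset: "graded_chains i \<subseteq> free_vectors (pairs i)"
  using tensor_with.span_homog_gens_subset[OF ten_loc] .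

lemma degree_b_linear: "linear_of_degree (I i) (\<delta> i) b \<subseteq> linear_to_laurent (I i)"
  by (auto simp: linear_of_degree_def)

text \<open>
  If a monomial does not lie in \<open>M\<close>, its inverse lies in \<open>N\<close>, and multiplying by it moves the coefficient
  of the monomial to the place where the pairing reads it off.  So a lift of degree \<open>b\<close> that pairs to zero
  with the chains represents the zero map to \<open>T/M\<close>.
\<close>

lemma values_in_M:
  assumes g: "g \<in> linear_of_degree (I i) (\<delta> i) b" and zero: "\<And>c. c \<in> graded_chains i \<Longrightarrow> pairing g c = 0"
    and f: "f \<in> free_vectors (I i)"
  shows "g f \<in> M"
  using f
proof (induction rule: free_vectors_induct)
  case zero
  have "g 0 = 0" using degree_b_linear g by (intro linear_to_laurent_zero) auto
  then show ?case using monomial_moduleD(1)[OF monomial_M] by (simp only:)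
next
  case (step f r x)
  have lin: "g \<in> linear_to_laurent (I i)" using degree_b_linear g by auto
  have e: "bvec 1 x \<in> free_vectors (I i)" "bvec r x \<in> free_vectors (I i)"
    by (intro bvec_mem polys_closed step)+
  have hom: "bvec 1 x \<in> homog (F i) (\<delta> i x)" by (rule hom_into.bvec_homog[OF hom_loc step(3)])
  then have "g (bvec 1 x) \<in> range (monomial (\<delta> i x + b))"
    using g unfolding linear_of_degree_def by blast
  then obtain t where t: "g (bvec 1 x) = monomial (\<delta> i x + b) t" by auto
  have ge: "g (bvec 1 x) \<in> M"
  proof (cases "xpow (\<delta> i x + b) \<in> M")
    case True
    have "monomial 0 t * xpow (\<delta> i x + b) \<in> M"
      by (rule monomial_moduleD(3)[OF monomial_M single_zero_in_poly_ring True])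
    then show ?thesis by (simp add: t mult_single)
  next
    case False
    define n :: "('k, 'n) laurent" where "n = xpow (- (\<delta> i x + b))"
    have n: "n \<in> homog NT (- (\<delta> i x + b))"
      unfolding tensor_with.NT_simps[OF ten_loc] n_def
      using False by (auto simp: xpow_in_T_dual_iff simp del: minus_add_distrib)
    have "\<delta> i x + - (\<delta> i x + b) = - b" by simp
    with hom n have "bvec (monomial 0 1) (bvec 1 x, n) \<in> tensor_with.homog_gens (I i) (\<delta> i) N (- b)"
      unfolding tensor_with.homog_gens_def[OF ten_loc] by blast
    from zero[OF fs.span_base[OF this]] have "t = 0"
      unfolding pairing_bvec t n_def by (simp add: mult_single)
    then show ?thesis using monomial_moduleD(1)[OF monomial_M] by (simp add: t)
  qed
  have "g (bvec r x) = r * g (bvec 1 x)"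
    using linear_to_laurentD(2)[OF lin step(2) e(1)] by (simp only: bvec_smult mult_1_right)
  then have "g (bvec r x) \<in> M" using monomial_moduleD(3)[OF monomial_M step(2) ge] by simp
  then show ?case
    unfolding linear_to_laurentD(1)[OF lin step(1) e(2)] by (rule monomial_moduleD(2)[OF monomial_M step(5)])
qed

lemma compose_degree_b:
  "g \<in> linear_of_degree (I i) (\<delta> i) b \<Longrightarrow> (\<lambda>f. g (d i f)) \<in> linear_of_degree (I (Suc i)) (\<delta> (Suc i)) b"
  by (rule linear_of_degree_compose[OF hom_d deg_d])

text \<open>
  Coboundaries pair to zero with cycles because the induced map of tensor products is adjoint to
  composition.  Conversely, if \<open>g\<close> pairs to zero with the cycles, then the pairing with \<open>g\<close> factors through the
  differential of chains, the resulting functional on its image extends, and the extension is the pairing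
  with some \<open>h'\<close>; then \<open>g\<close> and the composite of \<open>h'\<close> with the differential represent the same map.
\<close>

lemma coboundaries_radical:
  assumes g: "g \<in> cocycles i"
  shows "(\<exists>h\<in>coboundaries i. hom_of i g = hom_of i h) \<longleftrightarrow> (\<forall>c\<in>cycles i. pairing g c = 0)"
proof
  assume "\<exists>h\<in>coboundaries i. hom_of i g = hom_of i h"
  then obtain h where h: "h \<in> coboundaries i" and eq: "hom_of i g = hom_of i h" by auto
  have diff: "(g - h) f \<in> M" if "f \<in> free_vectors (I i)" for f
    using eq that unfolding hom_into.hom_of_eq_iff[OF hom_loc] by simp
  show "\<forall>c\<in>cycles i. pairing g c = 0"
  proof
    fix c assume c: "c \<in> cycles i"
    then have cf: "c \<in> free_vectors (pairs i)" using chains_subset by (auto simp: cycles_def)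
    have "pairing (g - h) c = 0" by (rule pairing_eq_0_of_M[OF monomial_M diff cf])
    moreover have "pairing g c = pairing (g - h) c + pairing h c"
      using pairing_add_left[of "g - h" h c] unfolding diff_add_cancel .
    moreover have "pairing h c = 0"
    proof (cases i)
      case 0
      then have "h = 0" using h by (simp add: coboundaries_def)
      then show ?thesis by (simp add: pairing_def wsum_def case_prod_beta)
    next
      case (Suc j)
      then obtain h' where h': "h' \<in> lifts j" "h = (\<lambda>f. h' (d j f))" using h by (auto simp: coboundaries_def)
      have "pairing h c = pairing h' (tmap (d j) c)" unfolding h'(2) by (rule pairing_free_map[OF cf, symmetric])
      also have "\<dots> = 0"
        using c h'(1) hom_into.lifts_subset[OF hom_loc] Suc
        by (intro tensor_with.pairing_rel[OF ten_loc]) (auto simp: cycles_def)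
      finally show ?thesis .
    qed
    ultimately show "pairing g c = 0" by simp
  qed
next
  assume zero: "\<forall>c\<in>cycles i. pairing g c = 0"
  have gd: "g \<in> linear_of_degree (I i) (\<delta> i) b" using g by (simp add: cocycles_def)
  show "\<exists>h\<in>coboundaries i. hom_of i g = hom_of i h"
  proof (cases i)
    case 0
    have "g f \<in> M" if "f \<in> free_vectors (I i)" for f
      by (rule values_in_M[OF gd _ that]) (use zero 0 in \<open>auto simp: cycles_def\<close>)
    then have "hom_of i g = hom_of i 0" unfolding hom_into.hom_of_eq_iff[OF hom_loc] by simp
    then show ?thesis using 0 by (auto simp: coboundaries_def)
  next
    case (Suc j)
    interpret st: tensor_step "I (Suc j)" "\<delta> (Suc j)" "I j" "\<delta> j" "d j" N by (rule step_loc)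
    \<comment> \<open>The graph of the functional on boundaries and relations through which the pairing with \<open>g\<close> factors.\<close>
    define R where "R = {(tmap (d j) c + k, pairing g c) | c k. c \<in> graded_chains i \<and> k \<in> rel j}"
    have cf: "c \<in> free_vectors (pairs (Suc j))" if "c \<in> graded_chains i" for c
      using that chains_subset Suc by blast
    have R: "(tmap (d j) c + k, pairing g c) \<in> R" if "c \<in> graded_chains i" "k \<in> rel j" for c k
      using that unfolding R_def by blast
    have R_cases: "\<exists>c k. u = tmap (d j) c + k \<and> s = pairing g c \<and> c \<in> graded_chains i \<and> k \<in> rel j" if "(u, s) \<in> R" for u s
      using that unfolding R_def by blast
    have "\<exists>L. functional L \<and> (\<forall>(u, s)\<in>R. L u = s)"
    proof (rule functional_extending_graph)
      show "(0, 0) \<in> R"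
        using R[OF fs.span_zero st.tgt.rel_closed(1)] unfolding free_map_zero pairing_zero_right by simp
    next
      fix u s v t assume "(u, s) \<in> R" "(v, t) \<in> R"
      then obtain c k c' k' where *: "u = tmap (d j) c + k" "s = pairing g c" "c \<in> graded_chains i" "k \<in> rel j"
        "v = tmap (d j) c' + k'" "t = pairing g c'" "c' \<in> graded_chains i" "k' \<in> rel j"
        using R_cases by metis
      have "u + v = tmap (d j) (c + c') + (k + k')"
        unfolding free_map_add[OF cf[OF *(3)] cf[OF *(7)]] *(1,5) by (simp only: add_ac)
      moreover have "s + t = pairing g (c + c')"
        unfolding *(2,6) by (rule pairing_add_right[OF cf[OF *(3)] cf[OF *(7)], symmetric])
      ultimately show "(u + v, s + t) \<in> R"
        using R[OF fs.span_add[OF *(3,7)] st.tgt.rel_closed(2)[OF *(4,8)]] by (simp only:)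
    next
      fix r u s assume "(u, s) \<in> R"
      then obtain c k where *: "u = tmap (d j) c + k" "s = pairing g c" "c \<in> graded_chains i" "k \<in> rel j"
        using R_cases by metis
      have "fscale r u = tmap (d j) (fscale r c) + fscale r k"
        unfolding st.tmap_scale[OF cf[OF *(3)]] *(1) by (rule fs.scale_right_distrib)
      moreover have "r * s = pairing g (fscale r c)"
        unfolding *(2) by (rule pairing_scale_right[OF cf[OF *(3)], symmetric])
      ultimately show "(fscale r u, r * s) \<in> R"
        using R[OF fs.span_scale[OF *(3)] fs.subspace_scale[OF st.tgt.rel_subspace *(4)]] by (simp only:)
    next
      fix s assume "(0, s) \<in> R"
      then obtain c k where *: "0 = tmap (d j) c + k" "s = pairing g c" "c \<in> graded_chains i" "k \<in> rel j"
        using R_cases by metis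
      have "tmap (d j) c = - k" using *(1) by (metis eq_neg_iff_add_eq_0)
      then have "tmap (d j) c \<in> rel j" using fs.subspace_neg[OF st.tgt.rel_subspace *(4)] by (simp only:)
      then have "c \<in> cycles i" using *(3) Suc by (simp add: cycles_def)
      then show "s = 0" using zero *(2) by simp
    qed
    then obtain L where func: "functional L" and graph: "\<forall>(u, s)\<in>R. L u = s" by blast
    have L: "functional L" "\<And>u s. (u, s) \<in> R \<Longrightarrow> L u = s"
      using func bspec[OF graph] by auto
    have Lt: "L (tmap (d j) c) = pairing g c" if "c \<in> graded_chains i" for c
      using L(2)[OF R[OF that st.tgt.rel_closed(1)]] by (simp only: add_0_right)
    have "L k = 0" if "k \<in> rel j" for k
      using L(2)[OF R[OF fs.span_zero that]] unfolding free_map_zero pairing_zero_right by (simp only: add_0_left)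
    then have "\<forall>k\<in>rel j. L k = 0" by blast
    from st.tgt.functional_is_pairing[OF L(1) this, where b = b]
    obtain h' where h': "h' \<in> linear_of_degree (I j) (\<delta> j) b"
      "\<And>c. c \<in> graded_chains j \<Longrightarrow> pairing h' c = L c" by blast
    define h where "h = (\<lambda>f. h' (d j f))"
    have hd: "h \<in> linear_of_degree (I i) (\<delta> i) b"
      unfolding h_def Suc by (rule compose_degree_b[OF h'(1)])
    have dd: "g - h \<in> linear_of_degree (I i) (\<delta> i) b"
      by (rule fs.subspace_diff[OF linear_of_degree_subspace gd hd])
    have "pairing (g - h) c = 0" if c: "c \<in> graded_chains i" for c
    proof -
      have "pairing h c = pairing h' (tmap (d j) c)"
        unfolding h_def by (rule pairing_free_map[OF cf[OF c], symmetric])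
      also have "\<dots> = L (tmap (d j) c)"
        using c Suc by (intro h'(2) st.tmap_homog) simp
      also have "\<dots> = pairing g c" by (rule Lt[OF c])
      finally show ?thesis using pairing_add_left[of "g - h" h c] unfolding diff_add_cancel by simp
    qed
    then have "(g - h) f \<in> M" if "f \<in> free_vectors (I i)" for f
      using values_in_M[OF dd _ that] by blast
    then have "hom_of i g = hom_of i h" unfolding hom_into.hom_of_eq_iff[OF hom_loc] by simp
    moreover have "h \<in> coboundaries i"
      unfolding coboundaries_def Suc h_def nat.case
      using h'(1) hom_into.linear_of_degree_lifts[OF hom_loc] by blast
    ultimately show ?thesis by blast
  qed
qed

lemma boundaries_subset: "boundaries i \<subseteq> free_vectors (pairs i)"
  unfolding boundaries_def using tensor_step.tmap_mem[OF step_loc] by blast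

text \<open>
  A chain \<open>c\<close> that is not a boundary is detected by a functional that vanishes on boundaries and
  relations and takes the value \<open>1\<close> at \<open>c\<close>.  Written as the pairing with some \<open>g\<close>, its vanishing on
  boundaries says that \<open>g\<close> is a cocycle.
\<close>

lemma boundaries_radical:
  assumes c: "c \<in> cycles i"
  shows "(\<exists>h\<in>boundaries i. tcoset i c = tcoset i h) \<longleftrightarrow> (\<forall>g\<in>cocycles i. pairing g c = 0)"
proof -
  interpret st: tensor_step "I (Suc i)" "\<delta> (Suc i)" "I i" "\<delta> i" "d i" N by (rule step_loc)
  have cc: "c \<in> graded_chains i" using c by (simp add: cycles_def)
  then have cf: "c \<in> free_vectors (pairs i)" using chains_subset by blast
  show ?thesis
  proof
    assume "\<exists>h\<in>boundaries i. tcoset i c = tcoset i h"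
    then obtain c' where c': "c' \<in> free_vectors (pairs (Suc i))" and eq: "tcoset i c = tcoset i (tmap (d i) c')"
      by (auto simp: boundaries_def)
    have diff: "c - tmap (d i) c' \<in> rel i"
      using eq st.tgt.tcoset_eq_iff[OF cf st.tmap_mem[OF c']] by simp
    show "\<forall>g\<in>cocycles i. pairing g c = 0"
    proof
      fix g assume g: "g \<in> cocycles i"
      have "g \<in> linear_to_laurent (I i)" using g degree_b_linear by (auto simp: cocycles_def)
      then have "pairing g (c - tmap (d i) c') = 0" by (rule st.tgt.pairing_rel[OF diff])
      moreover have "pairing g (tmap (d i) c') = 0"
        unfolding pairing_free_map[OF c']
        by (rule pairing_eq_0_of_M[OF monomial_M _ c']) (use g in \<open>auto simp: cocycles_def\<close>)
      ultimately show "pairing g c = 0"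
        using pairing_add_right[OF subsetD[OF st.tgt.rel_subset diff] st.tmap_mem[OF c'], of g]
        unfolding diff_add_cancel by simp
    qed
  next
    assume zero: "\<forall>g\<in>cocycles i. pairing g c = 0"
    define Y where "Y = {tmap (d i) c' + k | c' k. c' \<in> free_vectors (pairs (Suc i)) \<and> k \<in> rel i}"
    have Y: "fs.subspace Y"
    proof (rule fs.subspaceI)
      have "tmap (d i) 0 + 0 \<in> Y" unfolding Y_def using free_vectors_closed(1) st.tgt.rel_closed(1) by blast
      then show "0 \<in> Y" unfolding free_map_zero by simp
      show "u + v \<in> Y" if uv: "u \<in> Y" "v \<in> Y" for u v
      proof -
        obtain p k p' k' where *: "u = tmap (d i) p + k" "p \<in> free_vectors (pairs (Suc i))" "k \<in> rel i"
          "v = tmap (d i) p' + k'" "p' \<in> free_vectors (pairs (Suc i))" "k' \<in> rel i"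
          using uv unfolding Y_def by blast
        have "u + v = tmap (d i) (p + p') + (k + k')"
          unfolding free_map_add[OF *(2,5)] *(1,4) by (simp only: add_ac)
        then show ?thesis
          unfolding Y_def using free_vectors_closed(2)[OF *(2,5)] st.tgt.rel_closed(2)[OF *(3,6)] by blast
      qed
      show "fscale r u \<in> Y" if u: "u \<in> Y" for r u
      proof -
        obtain p k where *: "u = tmap (d i) p + k" "p \<in> free_vectors (pairs (Suc i))" "k \<in> rel i"
          using u unfolding Y_def by blast
        have "fscale r u = tmap (d i) (fscale r p) + fscale r k"
          unfolding st.tmap_scale[OF *(2)] *(1) by (rule fs.scale_right_distrib)
        then show ?thesis
          unfolding Y_def using fs.subspace_scale[OF free_vectors_subspace *(2)]
            fs.subspace_scale[OF st.tgt.rel_subspace *(3)] by blast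
      qed
    qed
    have "c \<in> Y"
    proof (rule ccontr)
      assume "c \<notin> Y"
      define R where "R = {(y + fscale t c, t) | y t. y \<in> Y}"
      have R: "(y + fscale t c, t) \<in> R" if "y \<in> Y" for y t using that unfolding R_def by blast
      have R_cases: "\<exists>y. y \<in> Y \<and> u = y + fscale t c" if "(u, t) \<in> R" for u t
        using that unfolding R_def by blast
      have "\<exists>L. functional L \<and> (\<forall>(u, s)\<in>R. L u = s)"
      proof (rule functional_extending_graph)
        show "(0, 0) \<in> R" using R[OF fs.subspace_0[OF Y], of 0] by simp
      next
        fix u s v t assume "(u, s) \<in> R" "(v, t) \<in> R"
        then obtain y z where *: "y \<in> Y" "u = y + fscale s c" "z \<in> Y" "v = z + fscale t c"
          using R_cases by metis
        have "u + v = (y + z) + fscale (s + t) c"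
          unfolding *(2,4) fs.scale_left_distrib by (simp only: add_ac)
        then show "(u + v, s + t) \<in> R" using R[OF fs.subspace_add[OF Y *(1,3)]] by (simp only:)
      next
        fix r u s assume "(u, s) \<in> R"
        then obtain y where *: "y \<in> Y" "u = y + fscale s c" using R_cases by metis
        have "fscale r u = fscale r y + fscale (r * s) c"
          unfolding *(2) fs.scale_right_distrib fs.scale_scale ..
        then show "(fscale r u, r * s) \<in> R" using R[OF fs.subspace_scale[OF Y *(1)]] by (simp only:)
      next
        fix s assume "(0, s) \<in> R"
        then obtain y where *: "y \<in> Y" "0 = y + fscale s c" using R_cases by metis
        then have sc: "fscale s c = - y" by (metis eq_neg_iff_add_eq_0 add.commute)
        show "s = 0"
        proof (rule ccontr)
          assume "s \<noteq> 0"
          then have "c = fscale (inverse s) (fscale s c)" by simp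
          also have "\<dots> \<in> Y" unfolding sc by (rule fs.subspace_scale[OF Y fs.subspace_neg[OF Y *(1)]])
          finally show False using \<open>c \<notin> Y\<close> by simp
        qed
      qed
      then obtain L where func: "functional L" and graph: "\<forall>(u, s)\<in>R. L u = s" by blast
      have L: "functional L" "\<And>u s. (u, s) \<in> R \<Longrightarrow> L u = s"
        using func bspec[OF graph] by auto
      have LY: "L y = 0" if "y \<in> Y" for y using L(2)[OF R[OF that, of 0]] by simp
      have Lc: "L c = 1" using L(2)[OF R[OF fs.subspace_0[OF Y], of 1]] by simp
      have "rel i \<subseteq> Y"
      proof
        fix k assume "k \<in> rel i"
        then have "tmap (d i) 0 + k \<in> Y" unfolding Y_def using free_vectors_closed(1) by blast
        then show "k \<in> Y" unfolding free_map_zero by simp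
      qed
      then have "\<forall>k\<in>rel i. L k = 0" using LY by blast
      from st.tgt.functional_is_pairing[OF L(1) this, where b = b]
      obtain g where g: "g \<in> linear_of_degree (I i) (\<delta> i) b" "\<And>c. c \<in> graded_chains i \<Longrightarrow> pairing g c = L c" by blast
      have "g (d i f) \<in> M" if f: "f \<in> free_vectors (I (Suc i))" for f
      proof (rule values_in_M[OF compose_degree_b[OF g(1)] _ f])
        fix p assume p: "p \<in> graded_chains (Suc i)"
        have pf: "p \<in> free_vectors (pairs (Suc i))" using p chains_subset by blast
        have "pairing (\<lambda>f. g (d i f)) p = pairing g (tmap (d i) p)" by (rule pairing_free_map[OF pf, symmetric])
        also have "\<dots> = L (tmap (d i) p)" by (rule g(2)[OF st.tmap_homog[OF p]])
        also have "\<dots> = 0"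
        proof (rule LY)
          have "tmap (d i) p + 0 \<in> Y" unfolding Y_def using pf st.tgt.rel_closed(1) by blast
          then show "tmap (d i) p \<in> Y" by simp
        qed
        finally show "pairing (\<lambda>f. g (d i f)) p = 0" .
      qed
      then have "g \<in> cocycles i" using g(1) by (simp add: cocycles_def)
      then have "pairing g c = 0" using zero by simp
      then show False using g(2)[OF cc] Lc by simp
    qed
    then obtain c' k where *: "c = tmap (d i) c' + k" "c' \<in> free_vectors (pairs (Suc i))" "k \<in> rel i"
      unfolding Y_def by blast
    have "c - tmap (d i) c' \<in> rel i" using *(3) unfolding *(1) by simp
    then have "tcoset i c = tcoset i (tmap (d i) c')"
      using st.tgt.tcoset_eq_iff[OF cf st.tmap_mem[OF *(2)]] by simp
    then show "\<exists>h\<in>boundaries i. tcoset i c = tcoset i h" unfolding boundaries_def using *(2) by blast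
  qed
qed

end


subsection \<open>Ext and Tor by representatives\<close>

context graded_complex
begin

abbreviation "Q \<equiv> gquot laurent_ring M"

abbreviation "hom_complex i \<equiv> gHom poly_ring (F i) Q"
abbreviation "hom_diff j \<equiv> \<lambda>\<phi>. \<lambda>x\<in>carrier (F (Suc j)). \<phi> (d j x)"
abbreviation "hom_kernel i \<equiv> a_kernel (hom_complex i) (hom_complex (Suc i)) (hom_diff i)"
abbreviation "hom_image i \<equiv> (case i of 0 \<Rightarrow> {\<zero>\<^bsub>hom_complex 0\<^esub>} | Suc j \<Rightarrow> hom_diff j ` carrier (hom_complex j))"

abbreviation "tensor_complex i \<equiv> gtensor poly_ring (F i) NT"
abbreviation "tensor_diff j \<equiv> tensor_map poly_ring (F j) NT (d j)"
abbreviation "tensor_kernel i \<equiv> (case i of 0 \<Rightarrow> carrier (tensor_complex 0)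
  | Suc j \<Rightarrow> a_kernel (tensor_complex (Suc j)) (tensor_complex j) (tensor_diff j))"
abbreviation "tensor_image i \<equiv> tensor_diff i ` carrier (tensor_complex (Suc i))"

lemma hom_diff_hom_of: "hom_diff i (hom_of i g) = hom_of (Suc i) (\<lambda>f. g (d i f))"
  using free_homD(1)[OF hom_d]
  by (auto simp: hom_into.hom_of_def[OF hom_loc] free_gmodule_simps fun_eq_iff restrict_def)

lemma compose_lifts:
  assumes "g \<in> lifts j"
  shows "(\<lambda>f. g (d j f)) \<in> lifts (Suc j)"
proof -
  note sub = hom_into.lifts_subspace[OF hom_loc, where I = "I (Suc j)" and \<delta> = "\<delta> (Suc j)"]
  have "g \<in> fs.span (\<Union>a. linear_of_degree (I j) (\<delta> j) a)"
    using assms unfolding hom_into.lifts_def[OF hom_loc] .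
  then show ?thesis
  proof (induction rule: fs.span_induct_alt)
    case base
    show ?case using fs.subspace_0[OF sub] by (simp add: zero_fun_def)
  next
    case (step c x y)
    obtain a where "x \<in> linear_of_degree (I j) (\<delta> j) a" using step(1) by auto
    then have "(\<lambda>f. x (d j f)) \<in> linear_of_degree (I (Suc j)) (\<delta> (Suc j)) a"
      by (rule linear_of_degree_compose[OF hom_d deg_d])
    then have "(\<lambda>f. x (d j f)) \<in> lifts (Suc j)" using hom_into.linear_of_degree_lifts[OF hom_loc] by blast
    from fs.subspace_add[OF sub fs.subspace_scale[OF sub this] step(2)]
    show ?case by (simp add: plus_fun_def fscale_def)
  qed
qed

lemma coboundaries_subset: "coboundaries i \<subseteq> lifts i"
  using compose_lifts fs.subspace_0[OF hom_into.lifts_subspace[OF hom_loc]]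
  by (cases i) (auto simp: coboundaries_def)

lemma coboundaries_subspace: "fs.subspace (coboundaries i)"
proof (cases i)
  case 0
  then show ?thesis by (simp add: coboundaries_def fs.subspace_def)
next
  case (Suc j)
  note sub = hom_into.lifts_subspace[OF hom_loc, where I = "I j" and \<delta> = "\<delta> j"]
  show ?thesis
    unfolding coboundaries_def Suc nat.case
  proof (rule fs.subspaceI)
    show "0 \<in> (\<lambda>g f. g (d j f)) ` lifts j"
      by (rule image_eqI[OF _ fs.subspace_0[OF sub]]) (simp add: fun_eq_iff)
  next
    fix u v assume "u \<in> (\<lambda>g f. g (d j f)) ` lifts j" "v \<in> (\<lambda>g f. g (d j f)) ` lifts j"
    then obtain g h where *: "g \<in> lifts j" "h \<in> lifts j" "u = (\<lambda>f. g (d j f))" "v = (\<lambda>f. h (d j f))" by auto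
    show "u + v \<in> (\<lambda>g f. g (d j f)) ` lifts j"
      by (rule image_eqI[OF _ fs.subspace_add[OF sub *(1,2)]]) (simp add: fun_eq_iff *(3,4))
  next
    fix c u assume "u \<in> (\<lambda>g f. g (d j f)) ` lifts j"
    then obtain g where *: "g \<in> lifts j" "u = (\<lambda>f. g (d j f))" by auto
    show "fscale c u \<in> (\<lambda>g f. g (d j f)) ` lifts j"
      by (rule image_eqI[OF _ fs.subspace_scale[OF sub *(1), of c]]) (simp add: fun_eq_iff *(2) fscale_apply)
  qed
qed

lemma cocycles_subspace: "fs.subspace (cocycles i)"
proof (rule fs.subspaceI)
  note sub = linear_of_degree_subspace[of "I i" "\<delta> i" b]
  show "0 \<in> cocycles i"
    using fs.subspace_0[OF sub] monomial_moduleD(1)[OF monomial_M] by (simp add: cocycles_def)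
  show "u + v \<in> cocycles i" if "u \<in> cocycles i" "v \<in> cocycles i" for u v
    using that fs.subspace_add[OF sub, of u v] monomial_moduleD(2)[OF monomial_M] by (simp add: cocycles_def)
  show "fscale c u \<in> cocycles i" if "u \<in> cocycles i" for c u
    using that fs.subspace_scale[OF sub, of u c] monomial_moduleD(3)[OF monomial_M single_zero_in_poly_ring]
    by (simp add: cocycles_def fscale_apply)
qed

lemma cocycles_subset: "cocycles i \<subseteq> lifts i"
  using hom_into.linear_of_degree_lifts[OF hom_loc] by (auto simp: cocycles_def)

lemma hom_kernel_homog: "hom_kernel i \<inter> homog (hom_complex i) b = hom_of i ` cocycles i"
proof -
  note simps = hom_into.gHom_simps[OF hom_loc] hom_into.hom_module_simps(1)[OF hom_loc]
  have ker: "hom_of i g \<in> hom_kernel i \<longleftrightarrow> g \<in> cocycles i" if g: "g \<in> linear_of_degree (I i) (\<delta> i) b" for g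
  proof -
    have "hom_of i g \<in> carrier (hom_complex i)"
      unfolding simps using hom_into.linear_of_degree_lifts[OF hom_loc] g by blast
    then have "hom_of i g \<in> hom_kernel i \<longleftrightarrow> hom_diff i (hom_of i g) = \<zero>\<^bsub>hom_complex (Suc i)\<^esub>"
      by (simp add: a_kernel_def kernel_def)
    also have "\<dots> \<longleftrightarrow> g \<in> cocycles i"
      unfolding hom_diff_hom_of simps hom_into.hom_of_eq_iff[OF hom_loc] using g by (simp add: cocycles_def)
    finally show ?thesis .
  qed
  have "cocycles i \<subseteq> linear_of_degree (I i) (\<delta> i) b" by (auto simp: cocycles_def)
  with ker show ?thesis unfolding hom_into.gHom_simps(5)[OF hom_loc] by blast
qed

lemma hom_image_eq: "hom_image i = hom_of i ` coboundaries i"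
proof (cases i)
  case 0
  then show ?thesis
    by (simp add: coboundaries_def hom_into.gHom_simps[OF hom_loc] hom_into.hom_module_simps[OF hom_loc])
next
  case (Suc j)
  show ?thesis
    unfolding Suc nat.case coboundaries_def hom_into.gHom_simps(1)[OF hom_loc] image_image hom_diff_hom_of ..
qed

lemma ext_presented:
  "presents (cocycles i) (\<lambda>g. hom_image i +>\<^bsub>hom_complex i\<^esub> hom_of i g)
     (component (gquot (gsub (hom_complex i) (hom_kernel i)) (hom_image i)) b)"
  by (rule presents_component_subquotient[OF hom_into.represented_gHom[OF hom_loc] coboundaries_subspace
        coboundaries_subset cocycles_subspace cocycles_subset hom_kernel_homog hom_image_eq])

lemma ext_class_zero_iff:
  assumes "g \<in> cocycles i"
  shows "hom_image i +>\<^bsub>hom_complex i\<^esub> hom_of i g = hom_image i +>\<^bsub>hom_complex i\<^esub> hom_of i 0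
    \<longleftrightarrow> (\<exists>h\<in>coboundaries i. hom_of i g = hom_of i h)"
  unfolding hom_image_eq
  by (rule represented.coset_eq_iff[OF hom_into.represented_gHom[OF hom_loc] coboundaries_subspace
        coboundaries_subset subsetD[OF cocycles_subset assms]])

lemma tensor_diff_tcoset:
  "c \<in> free_vectors (pairs (Suc i)) \<Longrightarrow> tensor_diff i (tcoset (Suc i) c) = tcoset i (tmap (d i) c)"
  by (rule tensor_step.tensor_map_tcoset[OF step_loc])

lemma carrier_tensor_complex: "carrier (tensor_complex i) = tcoset i ` free_vectors (pairs i)"
  by (rule represented.carrier_eq[OF tensor_with.represented_gtensor[OF ten_loc]])

lemma boundaries_subspace: "fs.subspace (boundaries i)"
proof (rule fs.subspaceI)
  note sub = free_vectors_subspace[of "pairs (Suc i)"]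
  show "0 \<in> boundaries i"
    unfolding boundaries_def by (rule image_eqI[of _ _ 0]) (rule free_map_zero[symmetric], rule free_vectors_closed(1))
  show "u + v \<in> boundaries i" if uv: "u \<in> boundaries i" "v \<in> boundaries i" for u v
  proof -
    obtain p q where *: "p \<in> free_vectors (pairs (Suc i))" "q \<in> free_vectors (pairs (Suc i))"
      "u = tmap (d i) p" "v = tmap (d i) q" using uv unfolding boundaries_def by blast
    show ?thesis
      unfolding boundaries_def *(3,4)
      by (rule image_eqI[of _ _ "p + q"])
        (rule free_map_add[OF *(1,2), symmetric], rule free_vectors_closed(2)[OF *(1,2)])
  qed
  show "fscale c u \<in> boundaries i" if u: "u \<in> boundaries i" for c u
  proof -
    obtain p where *: "p \<in> free_vectors (pairs (Suc i))" "u = tmap (d i) p"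
      using u unfolding boundaries_def by blast
    show ?thesis
      unfolding boundaries_def *(2)
      by (rule image_eqI[of _ _ "fscale c p"])
        (rule tensor_step.tmap_scale[OF step_loc *(1), symmetric], rule fs.subspace_scale[OF sub *(1)])
  qed
qed

lemma cycles_subspace: "fs.subspace (cycles i)"
proof (cases i)
  case 0
  then show ?thesis by (simp add: cycles_def fs.subspace_span)
next
  case (Suc j)
  interpret st: tensor_step "I (Suc j)" "\<delta> (Suc j)" "I j" "\<delta> j" "d j" N by (rule step_loc)
  have cyc: "c \<in> cycles i \<longleftrightarrow> c \<in> graded_chains (Suc j) \<and> tmap (d j) c \<in> rel j" for c
    by (simp add: cycles_def Suc)
  have cf: "c \<in> free_vectors (pairs (Suc j))" if "c \<in> graded_chains (Suc j)" for c
    using that chains_subset by blast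
  show ?thesis
  proof (rule fs.subspaceI)
    show "0 \<in> cycles i"
      unfolding cyc free_map_zero by (intro conjI fs.span_zero st.tgt.rel_closed(1))
    show "u + v \<in> cycles i" if "u \<in> cycles i" "v \<in> cycles i" for u v
    proof -
      have *: "u \<in> graded_chains (Suc j)" "v \<in> graded_chains (Suc j)" "tmap (d j) u \<in> rel j" "tmap (d j) v \<in> rel j"
        using that by (simp_all add: cyc)
      show ?thesis
        unfolding cyc free_map_add[OF cf[OF *(1)] cf[OF *(2)]]
        by (intro conjI fs.span_add st.tgt.rel_closed(2) *)
    qed
    show "fscale c u \<in> cycles i" if "u \<in> cycles i" for c u
    proof -
      have *: "u \<in> graded_chains (Suc j)" "tmap (d j) u \<in> rel j" using that by (simp_all add: cyc)
      show ?thesis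
        unfolding cyc st.tmap_scale[OF cf[OF *(1)]]
        by (intro conjI fs.span_scale fs.subspace_scale[OF st.tgt.rel_subspace] *)
    qed
  qed
qed

lemma cycles_subset: "cycles i \<subseteq> free_vectors (pairs i)"
  using chains_subset by (auto simp: cycles_def)

lemma tensor_kernel_homog: "tensor_kernel i \<inter> homog (tensor_complex i) (- b) = tcoset i ` cycles i"
proof -
  have homog: "homog (tensor_complex i) (- b) = tcoset i ` graded_chains i"
    by (rule tensor_with.homog_gtensor[OF ten_loc])
  have ker: "tcoset i c \<in> tensor_kernel i \<longleftrightarrow> c \<in> cycles i" if c: "c \<in> graded_chains i" for c
  proof -
    have cf: "c \<in> free_vectors (pairs i)" using c chains_subset by blast
    then have car: "tcoset i c \<in> carrier (tensor_complex i)" unfolding carrier_tensor_complex by blast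
    show ?thesis
    proof (cases i)
      case 0
      then show ?thesis using car c by (simp add: cycles_def)
    next
      case (Suc j)
      interpret st: tensor_step "I (Suc j)" "\<delta> (Suc j)" "I j" "\<delta> j" "d j" N by (rule step_loc)
      have cj: "c \<in> free_vectors (pairs (Suc j))" using cf Suc by simp
      have "tcoset i c \<in> tensor_kernel i \<longleftrightarrow> tensor_diff j (tcoset (Suc j) c) = \<zero>\<^bsub>tensor_complex j\<^esub>"
        using car by (simp add: Suc a_kernel_def kernel_def)
      also have "\<dots> \<longleftrightarrow> tcoset j (tmap (d j) c) = tcoset j 0"
        unfolding tensor_diff_tcoset[OF cj] represented.zero_eq[OF tensor_with.represented_gtensor[OF ten_loc]] ..
      also have "\<dots> \<longleftrightarrow> tmap (d j) c \<in> rel j" by (rule st.tgt.tcoset_zero_iff[OF st.tmap_mem[OF cj]])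
      also have "\<dots> \<longleftrightarrow> c \<in> cycles i" using c by (simp add: cycles_def Suc)
      finally show ?thesis .
    qed
  qed
  have "cycles i \<subseteq> graded_chains i" by (auto simp: cycles_def)
  with ker show ?thesis unfolding homog by blast
qed

lemma tensor_image_eq: "tensor_image i = tcoset i ` boundaries i"
  unfolding carrier_tensor_complex boundaries_def image_image
  by (rule image_cong[OF refl tensor_diff_tcoset])

lemma tor_presented:
  "presents (cycles i) (\<lambda>c. tensor_image i +>\<^bsub>tensor_complex i\<^esub> tcoset i c)
     (component (gquot (gsub (tensor_complex i) (tensor_kernel i)) (tensor_image i)) (- b))"
  by (rule presents_component_subquotient[OF tensor_with.represented_gtensor[OF ten_loc] boundaries_subspace
        boundaries_subset cycles_subspace cycles_subset tensor_kernel_homog tensor_image_eq])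

lemma tor_class_zero_iff:
  assumes "c \<in> cycles i"
  shows "tensor_image i +>\<^bsub>tensor_complex i\<^esub> tcoset i c = tensor_image i +>\<^bsub>tensor_complex i\<^esub> tcoset i 0
    \<longleftrightarrow> (\<exists>h\<in>boundaries i. tcoset i c = tcoset i h)"
  unfolding tensor_image_eq
  by (rule represented.coset_eq_iff[OF tensor_with.represented_gtensor[OF ten_loc] boundaries_subspace
        boundaries_subset subsetD[OF cycles_subset assms]])

theorem cohomology_dual_to_homology:
  "kdim (component (gquot (gsub (hom_complex i) (hom_kernel i)) (hom_image i)) b)
   = kdim (component (gquot (gsub (tensor_complex i) (tensor_kernel i)) (tensor_image i)) (- b))"
proof (rule kdim_eq_by_pairing_of_representatives[OF ext_presented tor_presented, where \<beta> = pairing])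
  note in_free = subsetD[OF cycles_subset]
  show "pairing (u + v) c = pairing u c + pairing v c" for u v c by (rule pairing_add_left)
  show "pairing (fscale t u) c = t * pairing u c" for t u c by (rule pairing_scale_left)
  show "pairing u (c + c') = pairing u c + pairing u c'" if "c \<in> cycles i" "c' \<in> cycles i" for u c c'
    by (rule pairing_add_right[OF in_free in_free, OF that])
  show "pairing u (fscale t c) = t * pairing u c" if "c \<in> cycles i" for t u c
    by (rule pairing_scale_right[OF in_free, OF that])
  show "hom_image i +>\<^bsub>hom_complex i\<^esub> hom_of i g = hom_image i +>\<^bsub>hom_complex i\<^esub> hom_of i 0
      \<longleftrightarrow> (\<forall>c\<in>cycles i. pairing g c = 0)" if "g \<in> cocycles i" for g
    unfolding ext_class_zero_iff[OF that] by (rule coboundaries_radical[OF that])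
  show "tensor_image i +>\<^bsub>tensor_complex i\<^esub> tcoset i c = tensor_image i +>\<^bsub>tensor_complex i\<^esub> tcoset i 0
      \<longleftrightarrow> (\<forall>g\<in>cocycles i. pairing g c = 0)" if "c \<in> cycles i" for c
    unfolding tor_class_zero_iff[OF that] by (rule boundaries_radical[OF that])
qed

end


section \<open>A free resolution of the residue field\<close>

lemma xpow_in_polys: "monomial a t \<in> polys" if "\<And>j. 0 \<le> vec_nth a j"
  using that by (simp add: poly_ring_def gsub_def)

lemma polys_keys: "r \<in> polys \<Longrightarrow> a \<in> Poly_Mapping.keys r \<Longrightarrow> 0 \<le> vec_nth a j"
  by (simp add: poly_ring_def gsub_def)

lemma bvec_add: "bvec (r + s) x = bvec r x + bvec s x"
  by (auto simp: bvec_def fun_eq_iff)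

lemma bvec_zero: "bvec 0 x = 0"
  by (auto simp: bvec_def fun_eq_iff)

lemma sum_monomials:
  "(\<Sum>a\<in>Poly_Mapping.keys r. monomial a (Poly_Mapping.lookup r a)) = r" for r :: "('k::field, 'n::finite) laurent"
  by (rule poly_mapping_eqI) (simp add: lookup_sum lookup_single when_def in_keys_iff)

lemma polys_induct [consumes 1, case_names zero step]:
  assumes r: "r \<in> polys" and zero: "P 0"
    and step: "\<And>s a t. P s \<Longrightarrow> (\<And>j. 0 \<le> vec_nth a j) \<Longrightarrow> P (s + monomial a t)"
  shows "P r"
proof -
  have "P (\<Sum>a\<in>A. monomial a (Poly_Mapping.lookup r a))" if "finite A" "A \<subseteq> Poly_Mapping.keys r" for A
    using that
  proof (induction A rule: finite_induct)
    case empty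
    then show ?case using zero by simp
  next
    case (insert a A)
    have "P ((\<Sum>a\<in>A. monomial a (Poly_Mapping.lookup r a)) + monomial a (Poly_Mapping.lookup r a))"
      by (rule step) (use insert polys_keys[OF r] in auto)
    then show ?case using insert.hyps by (simp add: add.commute)
  qed
  from this[OF finite_keys order_refl]
  have "P (\<Sum>a\<in>Poly_Mapping.keys r. monomial a (Poly_Mapping.lookup r a))" .
  moreover have "(\<Sum>a\<in>Poly_Mapping.keys r. monomial a (Poly_Mapping.lookup r a)) = r" by (rule sum_monomials)
  ultimately show ?thesis by simp
qed

lemma free_vectors_monomial_induct [consumes 1, case_names zero step]:
  assumes "c \<in> free_vectors I" and zero: "P 0"
    and step: "\<And>c a t x. c \<in> free_vectors I \<Longrightarrow> P c \<Longrightarrow> (\<And>j. 0 \<le> vec_nth a j) \<Longrightarrow> x \<in> I \<Longrightarrow>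
      P (c + bvec (monomial a t) x)"
  shows "P c"
  using assms(1)
proof (induction rule: free_vectors_induct)
  case zero
  show ?case by (rule \<open>P 0\<close>)
next
  case (step f r x)
  have "r \<in> polys \<Longrightarrow> f + bvec r x \<in> free_vectors I \<and> P (f + bvec r x)"
    unfolding atomize_imp
  proof
    assume r: "r \<in> polys"
    then show "f + bvec r x \<in> free_vectors I \<and> P (f + bvec r x)"
    proof (induction rule: polys_induct)
      case zero
      show ?case unfolding bvec_zero add_0_right using step by blast
    next
      case (step s a t)
      have "f + bvec (s + monomial a t) x = (f + bvec s x) + bvec (monomial a t) x"
        unfolding bvec_add by (simp only: add.assoc)
      moreover have "bvec (monomial a t) x \<in> free_vectors I"
        by (rule bvec_mem[OF xpow_in_polys[OF step(2)] \<open>x \<in> I\<close>])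
      ultimately show ?case
        using assms(3)[of "f + bvec s x" a x t] step free_vectors_closed(2)[of "f + bvec s x"] \<open>x \<in> I\<close> by metis
    qed
  qed
  then show ?case using step(2) by blast
qed

lemma lookup_zero_mult:
  fixes r q :: "('k::field, 'n::finite) laurent"
  assumes "r \<in> polys" "q \<in> polys" "Poly_Mapping.lookup q 0 = 0"
  shows "Poly_Mapping.lookup (r * q) 0 = 0"
proof (rule ccontr)
  assume "Poly_Mapping.lookup (r * q) 0 \<noteq> 0"
  then have "0 \<in> Poly_Mapping.keys (r * q)" by (simp add: in_keys_iff)
  then obtain a b where ab: "0 = a + b" "a \<in> Poly_Mapping.keys r" "b \<in> Poly_Mapping.keys q"
    using keys_mult[of r q] by auto
  have "b = 0"
  proof (rule Finite_Cartesian_Product.vec_eq_iff[THEN iffD2], rule allI)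
    fix j
    have "vec_nth (0 :: int ^ 'n) j = vec_nth a j + vec_nth b j" unfolding ab(1) by simp
    then show "vec_nth b j = vec_nth 0 j"
      using polys_keys[OF assms(1) ab(2), of j] polys_keys[OF assms(2) ab(3), of j] by simp
  qed
  then show False using ab(3) assms(3) by (simp add: in_keys_iff)
qed

text \<open>
  The basis of the bar resolution in homological degree \<open>n\<close> consists of the sequences of \<open>n\<close> monomials.
  The index type is left open, because the resolution has to live on a prescribed type: sequences are
  presented by an empty sequence and an injective \<open>cons\<close> with its two inverses.
\<close>

locale bar_indices =
  fixes nil :: 'x and cons :: "int ^ 'n::finite \<Rightarrow> 'x \<Rightarrow> 'x" and head :: "'x \<Rightarrow> int ^ 'n" and tail :: "'x \<Rightarrow> 'x"
  assumes head_cons [simp]: "head (cons a w) = a" and tail_cons [simp]: "tail (cons a w) = w"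
    and cons_nil [simp]: "cons a w \<noteq> nil"
begin

primrec level :: "nat \<Rightarrow> 'x set" where
  "level 0 = {nil}"
| "level (Suc n) = {cons a w | a w. (\<forall>j. 0 \<le> vec_nth a j) \<and> w \<in> level n}"

lemma level_SucD:
  assumes "x \<in> level (Suc n)"
  shows "tail x \<in> level n" "0 \<le> vec_nth (head x) j"
  using assms by auto

primrec degree :: "nat \<Rightarrow> 'x \<Rightarrow> int ^ 'n" where
  "degree 0 x = 0"
| "degree (Suc n) x = head x + degree n (tail x)"

text \<open>
  The \<open>k\<close>-linear map that takes \<open>x\<^sup>a e\<^sub>w\<close> to the basis element of the sequence \<open>a, w\<close>.
\<close>

definition contraction :: "('x \<Rightarrow> ('k::field, 'n) laurent) \<Rightarrow> 'x \<Rightarrow> ('k, 'n) laurent" where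
  "contraction c y = (if y = cons (head y) (tail y)
     then monomial 0 (Poly_Mapping.lookup (c (tail y)) (head y)) else 0)"

text \<open>
  The differential of a basis element.  The recursion is forced by the homotopy identity: with \<open>s\<close> the
  contraction, \<open>d s(x\<^sup>a e\<^sub>w) = x\<^sup>a e\<^sub>w - s(x\<^sup>a d e\<^sub>w)\<close>, corrected in degree \<open>0\<close> by the constant term that the
  augmentation sees.
\<close>

primrec boundary :: "nat \<Rightarrow> 'x \<Rightarrow> 'x \<Rightarrow> ('k::field, 'n) laurent" where
  "boundary 0 x = 0"
| "boundary (Suc n) x = bvec (xpow (head x)) (tail x)
     - contraction (\<lambda>y. xpow (head x) * boundary n (tail x) y)
     - (if n = 0 \<and> head x = 0 then bvec 1 nil else 0)"

definition bar :: "nat \<Rightarrow> ('x \<Rightarrow> ('k::field, 'n) laurent) \<Rightarrow> 'x \<Rightarrow> ('k, 'n) laurent" where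
  "bar n c = (\<lambda>y. wsum (\<lambda>x. boundary n x y) c)"

lemma boundary_Suc_Suc:
  "boundary (Suc (Suc n)) x = bvec (xpow (head x)) (tail x)
     - contraction (\<lambda>y. xpow (head x) * boundary (Suc n) (tail x) y)"
  using boundary.simps(2)[of "Suc n" x] by (simp only: nat.distinct simp_thms if_False diff_zero)

lemma contraction_add: "contraction (c + c') = contraction c + contraction c'"
  by (auto simp: contraction_def fun_eq_iff lookup_add single_add)

lemma contraction_zero: "contraction 0 = 0"
  by (auto simp: contraction_def fun_eq_iff)

lemma contraction_scale: "contraction (fscale t c) = fscale t (contraction c)"
  by (auto simp: contraction_def fun_eq_iff fscale_apply lookup_scale mult_single)

lemma contraction_monomial: "contraction (bvec (xpow a) w) = bvec 1 (cons a w)"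
proof
  fix y show "contraction (bvec (xpow a) w) y = (bvec 1 (cons a w) :: 'x \<Rightarrow> ('k::field, 'n) laurent) y"
  proof (cases "y = cons a w")
    case True
    then show ?thesis by (simp add: contraction_def bvec_def)
  next
    case False
    then show ?thesis by (auto simp: contraction_def bvec_def lookup_single when_def)
  qed
qed

lemma contraction_mem:
  assumes c: "c \<in> free_vectors (level n)"
  shows "contraction c \<in> free_vectors (level (Suc n))"
proof -
  have sub: "{y. contraction c y \<noteq> 0} \<subseteq> (\<lambda>(w, a). cons a w) ` (SIGMA w:{w. c w \<noteq> 0}. Poly_Mapping.keys (c w))"
  proof
    fix y assume "y \<in> {y. contraction c y \<noteq> 0}"
    then have y: "y = cons (head y) (tail y)" and l: "Poly_Mapping.lookup (c (tail y)) (head y) \<noteq> 0"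
      by (auto simp: contraction_def split: if_splits)
    then have "(tail y, head y) \<in> (SIGMA w:{w. c w \<noteq> 0}. Poly_Mapping.keys (c w))"
      by (auto simp: in_keys_iff)
    then show "y \<in> (\<lambda>(w, a). cons a w) ` (SIGMA w:{w. c w \<noteq> 0}. Poly_Mapping.keys (c w))"
      using y by (intro image_eqI[of _ _ "(tail y, head y)"]) auto
  qed
  have fin: "finite {y. contraction c y \<noteq> 0}"
    by (rule finite_subset[OF sub]) (use free_vectorsD(2)[OF c] in auto)
  have "{y. contraction c y \<noteq> 0} \<subseteq> level (Suc n)"
  proof
    fix y assume "y \<in> {y. contraction c y \<noteq> 0}"
    with sub obtain w a where *: "y = cons a w" "c w \<noteq> 0" "a \<in> Poly_Mapping.keys (c w)" by auto
    then show "y \<in> level (Suc n)"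
      using polys_keys[OF free_vectorsD(1)[OF c] *(3)] free_vectorsD(3)[OF c *(2)] by auto
  qed
  then show ?thesis
    unfolding free_vectors_iff using fin by (auto simp: contraction_def single_zero_in_poly_ring polys_closed)
qed

lemma boundary_mem:
  "x \<in> level (Suc n) \<Longrightarrow> (boundary (Suc n) x :: 'x \<Rightarrow> ('k::field, 'n) laurent) \<in> free_vectors (level n)"
proof (induction n arbitrary: x)
  case 0
  then have "(xpow (head x) :: ('k, 'n) laurent) \<in> polys" "tail x = nil" by (auto intro: xpow_in_polys)
  moreover have "contraction (\<lambda>y. xpow (head x) * boundary 0 (tail x) y) = (0 :: 'x \<Rightarrow> ('k, 'n) laurent)"
    by (auto simp: contraction_def fun_eq_iff)
  ultimately show ?case
    unfolding boundary.simps(2)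
    by (intro free_vectors_diff) (auto intro!: bvec_mem free_vectors_closed(1) polys_closed)
next
  case (Suc n)
  then have x: "(xpow (head x) :: ('k, 'n) laurent) \<in> polys" "tail x \<in> level (Suc n)"
    by (blast intro: xpow_in_polys dest: level_SucD)+
  have "contraction (\<lambda>y. xpow (head x) * boundary (Suc n) (tail x) y) \<in> (free_vectors (level (Suc n)) :: ('x \<Rightarrow> ('k, 'n) laurent) set)"
    by (rule contraction_mem[OF free_vectors_closed(3)[OF x(1) Suc.IH[OF x(2)]]])
  from free_vectors_diff[OF bvec_mem[OF x] this] show ?case
    unfolding boundary_Suc_Suc .
qed

lemma bar_apply: "bar n c y = wsum (\<lambda>x. boundary n x y) c"
  by (simp add: bar_def)

lemma bar_zero: "bar n 0 = 0"
  by (auto simp: bar_def fun_eq_iff)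

lemma bar_add: "c \<in> free_vectors I \<Longrightarrow> c' \<in> free_vectors I \<Longrightarrow> bar n (c + c') = bar n c + bar n c'"
  by (auto simp: bar_def fun_eq_iff wsum_add)

lemma bar_smult: "c \<in> free_vectors I \<Longrightarrow> bar n (\<lambda>x. r * c x) = (\<lambda>y. r * bar n c y)"
  by (auto simp: bar_def fun_eq_iff wsum_smult)

lemma bar_diff:
  assumes "c \<in> free_vectors I" "c' \<in> free_vectors I"
  shows "bar n (c - c') = bar n c - bar n c'"
proof
  show "bar n (c - c') y = (bar n c - bar n c') y" for y
    unfolding minus_apply[of "bar n c" "bar n c'"] bar_apply by (rule wsum_diff[OF assms])
qed

lemma bar_bvec: "bar n (bvec r x) = (\<lambda>y. r * boundary n x y)"
  by (auto simp: bar_def fun_eq_iff)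

lemma bar_0: "bar 0 c = 0"
  by (auto simp: bar_def fun_eq_iff wsum_def)

lemma bar_mem:
  assumes "c \<in> free_vectors (level (Suc n))"
  shows "bar (Suc n) c \<in> free_vectors (level n)"
  using assms
proof (induction rule: free_vectors_induct)
  case zero
  show ?case unfolding bar_zero by (rule free_vectors_closed)
next
  case (step f r x)
  show ?case
    unfolding bar_add[OF step(1) bvec_mem[OF step(2,3)]] bar_bvec
    by (intro free_vectors_closed(2,3) step(2,5) boundary_mem step(3))
qed

definition constant_part :: "nat \<Rightarrow> ('x \<Rightarrow> ('k::field, 'n) laurent) \<Rightarrow> 'x \<Rightarrow> ('k, 'n) laurent" where
  "constant_part n c = (if n = 0 then bvec (monomial 0 (Poly_Mapping.lookup (c nil) 0)) nil else 0)"

lemma constant_part_add: "constant_part n (c + c') = constant_part n c + constant_part n c'"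
  by (auto simp: constant_part_def fun_eq_iff bvec_def lookup_add single_add)

text \<open>
  Both sides are \<open>k\<close>-linear in \<open>c\<close>, and on the monomial multiples of basis elements the identity is the
  recursion that defines \<open>boundary\<close>.
\<close>

lemma homotopy:
  fixes c :: "'x \<Rightarrow> ('k::field, 'n) laurent"
  assumes "c \<in> free_vectors (level n)"
  shows "bar (Suc n) (contraction c) + contraction (bar n c) + constant_part n c = c"
  using assms
proof (induction rule: free_vectors_monomial_induct)
  case zero
  show ?case unfolding contraction_zero bar_zero by (auto simp: constant_part_def bvec_def)
next
  case (step c a t w)
  define m :: "'x \<Rightarrow> ('k, 'n) laurent" where "m = bvec (xpow a) w"
  have mono: "bvec (monomial a t) w = fscale t m"
    by (simp add: m_def bvec_scale mult_single)
  have sm: "contraction (fscale t m) = bvec (monomial 0 t) (cons a w)"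
    unfolding contraction_scale unfolding m_def contraction_monomial bvec_scale mult_1_right ..
  have bm: "bar n (fscale t m) = fscale t (\<lambda>y. xpow a * boundary n w y)"
    unfolding mono[symmetric] bar_bvec by (auto simp: fun_eq_iff fscale_apply mult.assoc[symmetric] mult_single)
  have cp: "constant_part n (fscale t m) = fscale t (if n = 0 \<and> a = 0 then bvec 1 nil else 0)"
    using step(3)
    by (auto simp: constant_part_def fun_eq_iff fscale_apply m_def bvec_def mult_single lookup_scale lookup_single when_def)
  have main: "bar (Suc n) (contraction (fscale t m)) + contraction (bar n (fscale t m)) + constant_part n (fscale t m)
      = fscale t m"
    unfolding sm bm cp bar_bvec unfolding contraction_scale
    by (auto simp: fun_eq_iff fscale_apply m_def algebra_simps)
  have mm: "fscale t m \<in> free_vectors (level n)"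
    unfolding mono[symmetric] by (rule bvec_mem[OF xpow_in_polys[OF step(2)] step(3)])
  have "bar (Suc n) (contraction (c + fscale t m)) + contraction (bar n (c + fscale t m)) + constant_part n (c + fscale t m)
    = (bar (Suc n) (contraction c) + contraction (bar n c) + constant_part n c)
      + (bar (Suc n) (contraction (fscale t m)) + contraction (bar n (fscale t m)) + constant_part n (fscale t m))"
    unfolding contraction_add constant_part_add bar_add[OF step(1) mm]
      bar_add[OF contraction_mem[OF step(1)] contraction_mem[OF mm]]
    by (simp only: add_ac)
  then show ?case unfolding mono main step(4) by (simp only:)
qed

lemma boundary_1_constant: "x \<in> level (Suc 0) \<Longrightarrow> Poly_Mapping.lookup (boundary (Suc 0) x nil) 0 = 0"
  by (auto simp: bvec_def contraction_def lookup_single when_def lookup_minus)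

lemma bar_1_constant:
  assumes "c \<in> free_vectors (level (Suc 0))"
  shows "Poly_Mapping.lookup (bar (Suc 0) c nil) 0 = 0"
  using assms
proof (induction rule: free_vectors_induct)
  case zero
  show ?case unfolding bar_zero by simp
next
  case (step f r x)
  have "Poly_Mapping.lookup (r * boundary (Suc 0) x nil) 0 = 0"
    by (rule lookup_zero_mult[OF step(2) free_vectorsD(1)[OF boundary_mem[OF step(3)]] boundary_1_constant[OF step(3)]])
  then show ?case
    unfolding bar_add[OF step(1) bvec_mem[OF step(2,3)]] bar_bvec
    unfolding plus_fun_apply lookup_add step(5) by (simp only: add_0_left)
qed

text \<open>
  Let \<open>c = x\<^sup>a d e\<^sub>w\<close>.  By the homotopy identity for \<open>c\<close>, the double differential of the basis element of the
  sequence \<open>a, w\<close> is \<open>s d c\<close> plus the constant part of \<open>c\<close>.  The first vanishes by induction, and the second because the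
  differential of degree \<open>1\<close> takes values without constant term.
\<close>

lemma bar_boundary: "x \<in> level (Suc n) \<Longrightarrow> bar n (boundary (Suc n) x) = (0 :: 'x \<Rightarrow> ('k::field, 'n) laurent)"
proof (induction n arbitrary: x)
  case 0
  show ?case by (rule bar_0)
next
  case (Suc m)
  have x: "(xpow (head x) :: ('k, 'n) laurent) \<in> polys" "tail x \<in> level (Suc m)"
    using Suc.prems by (blast intro: xpow_in_polys dest: level_SucD)+
  define c :: "'x \<Rightarrow> ('k, 'n) laurent" where "c = (\<lambda>y. xpow (head x) * boundary (Suc m) (tail x) y)"
  have c: "c \<in> free_vectors (level m)"
    unfolding c_def by (rule free_vectors_closed(3)[OF x(1) boundary_mem[OF x(2)]])
  have bc: "bar m c = 0"
    unfolding c_def bar_smult[OF boundary_mem[OF x(2)]] Suc.IH[OF x(2)] by (simp add: fun_eq_iff)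
  have cp: "constant_part m c = 0"
  proof (cases m)
    case 0
    have "Poly_Mapping.lookup (c nil) 0 = 0"
      unfolding c_def using x boundary_1_constant[of "tail x"] free_vectorsD(1)[OF boundary_mem[OF x(2)]] 0
      by (intro lookup_zero_mult) auto
    then show ?thesis by (simp add: constant_part_def bvec_zero)
  qed (simp add: constant_part_def)
  have bnd: "boundary (Suc (Suc m)) x = bvec (xpow (head x)) (tail x) - contraction c"
    unfolding boundary_Suc_Suc c_def ..
  have "bar (Suc m) (bvec (xpow (head x)) (tail x)) = c" unfolding bar_bvec c_def ..
  then have "bar (Suc m) (boundary (Suc (Suc m)) x) = c - bar (Suc m) (contraction c)"
    unfolding bnd bar_diff[OF bvec_mem[OF x] contraction_mem[OF c]] by (simp only:)
  also have "\<dots> = 0"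
    using homotopy[OF c] unfolding bc cp contraction_zero by simp
  finally show ?case .
qed

lemma bar_bar:
  assumes "c \<in> free_vectors (level (Suc n))"
  shows "bar n (bar (Suc n) c) = 0"
  using assms
proof (induction rule: free_vectors_induct)
  case zero
  show ?case unfolding bar_zero ..
next
  case (step f r x)
  have e: "bar (Suc n) (bvec r x) \<in> free_vectors (level n)" by (rule bar_mem[OF bvec_mem[OF step(2,3)]])
  have "bar n (bar (Suc n) (bvec r x)) = 0"
    unfolding bar_bvec bar_smult[OF boundary_mem[OF step(3)]] bar_boundary[OF step(3)] by (simp add: fun_eq_iff)
  then show ?case
    unfolding bar_add[OF step(1) bvec_mem[OF step(2,3)]] bar_add[OF bar_mem[OF step(1)] e] step(5) by simp
qed

lemma bar_exact:
  assumes "c \<in> free_vectors (level n)" "bar n c = 0" "constant_part n c = 0"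
  shows "c \<in> bar (Suc n) ` free_vectors (level (Suc n))"
proof (rule image_eqI[OF _ contraction_mem[OF assms(1)]])
  show "c = bar (Suc n) (contraction c)"
    using homotopy[OF assms(1)] unfolding assms(2,3) contraction_zero by simp
qed

lemma boundary_homog:
  assumes "x \<in> level (Suc n)" "y \<in> level n"
  shows "boundary (Suc n) x y \<in> (range (monomial (degree (Suc n) x - degree n y)) :: ('k::field, 'n) laurent set)"
  using assms
proof (induction n arbitrary: x y)
  case 0
  then have "y = nil" "tail x = nil" by auto
  moreover have "range (monomial (head x)) = (range (monomial (degree (Suc 0) x - degree 0 y)) :: ('k, 'n) laurent set)"
    by simp
  moreover have "boundary (Suc 0) x nil = (monomial (head x) (if head x = 0 then 0 else 1) :: ('k, 'n) laurent)"
    using \<open>tail x = nil\<close> by (auto simp: bvec_def contraction_def)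
  ultimately show ?case by (metis rangeI)
next
  case (Suc n)
  obtain a u where y: "y = cons a u" "u \<in> level n" using Suc.prems(2) by auto
  have tx: "tail x \<in> level (Suc n)" using Suc.prems(1) by (rule level_SucD(1))
  obtain t where t: "boundary (Suc n) (tail x) u = (monomial (degree (Suc n) (tail x) - degree n u) t :: ('k, 'n) laurent)"
    using Suc.IH[OF tx y(2)] by auto
  let ?e = "degree (Suc (Suc n)) x - degree (Suc n) y"
  have deg: "?e = head x + (degree (Suc n) (tail x) - degree n u) - a" using y by (simp add: algebra_simps)
  have "bvec (xpow (head x)) (tail x) y \<in> (range (monomial ?e) :: ('k, 'n) laurent set)"
  proof (cases "y = tail x")
    case True
    then show ?thesis by (auto simp: bvec_def)
  next
    case False
    then show ?thesis using range_single_closed(1) by (auto simp: bvec_def)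
  qed
  moreover have "contraction (\<lambda>y. xpow (head x) * boundary (Suc n) (tail x) y) y
      \<in> (range (monomial ?e) :: ('k, 'n) laurent set)"
  proof (cases "?e = 0")
    case True
    then show ?thesis unfolding True contraction_def using range_single_closed(1) by auto
  next
    case False
    have "contraction (\<lambda>y. xpow (head x) * boundary (Suc n) (tail x) y) y
      = (monomial 0 (Poly_Mapping.lookup (xpow (head x) * boundary (Suc n) (tail x) u) a) :: ('k, 'n) laurent)"
      using y by (simp add: contraction_def del: boundary.simps)
    also have "\<dots> = 0"
      using False unfolding t deg by (simp add: mult_single lookup_single when_def)
    finally show ?thesis using range_single_closed(1) by (simp only:)
  qed
  ultimately have "bvec (xpow (head x)) (tail x) y - contraction (\<lambda>y. xpow (head x) * boundary (Suc n) (tail x) y) y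
      \<in> (range (monomial ?e) :: ('k, 'n) laurent set)"
    by (auto simp: single_diff[symmetric])
  then show ?case unfolding boundary_Suc_Suc minus_apply .
qed

end


subsection \<open>Augmentation\<close>

definition irrelevant_ideal :: "('k::field, 'n::finite) laurent set" where
  "irrelevant_ideal = {r \<in> polys. Poly_Mapping.lookup r 0 = 0}"

lemma irrelevant_ideal_ideal: "ideal irrelevant_ideal poly_ring"
proof -
  interpret cring "poly_ring :: ('k::field, 'n::finite) poly_gmodule"
    by (rule poly_ring_cring)
  have minus: "\<ominus>\<^bsub>poly_ring\<^esub> r = - r" if "r \<in> polys" for r :: "('k, 'n) laurent"
    by (rule minus_equality) (use that polys_closed in \<open>simp_all add: poly_ring_simps\<close>)
  show "ideal (irrelevant_ideal :: ('k, 'n) laurent set) poly_ring"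
  proof (rule idealI)
    show "ring (poly_ring :: ('k, 'n) poly_gmodule)" by (rule ring_axioms)
    show "subgroup (irrelevant_ideal :: ('k, 'n) laurent set) (add_monoid poly_ring)"
      by (rule add.subgroupI)
        (auto simp: irrelevant_ideal_def poly_ring_simps polys_closed lookup_add minus a_inv_def[symmetric]
          intro!: exI[of _ 0])
    fix r s :: "('k, 'n) laurent" assume "r \<in> irrelevant_ideal" "s \<in> polys"
    then show "s \<otimes>\<^bsub>poly_ring\<^esub> r \<in> irrelevant_ideal" "r \<otimes>\<^bsub>poly_ring\<^esub> s \<in> irrelevant_ideal"
      using lookup_zero_mult[of s r]
      by (simp_all add: irrelevant_ideal_def poly_ring_simps polys_closed mult.commute[of r s])
  qed
qed

lemma monomial_irrelevant_ideal:
  "monomial_module (irrelevant_ideal :: ('k::field, 'n::finite) laurent set)"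
  unfolding monomial_module_def
proof (intro conjI ballI allI)
  interpret Module.module poly_ring "laurent_ring :: ('k, 'n) poly_gmodule"
    by (rule laurent_ring_module)
  show "Module.submodule (irrelevant_ideal :: ('k, 'n) laurent set) poly_ring laurent_ring"
    by (rule submoduleI)
      (auto simp: irrelevant_ideal_def laurent_ring_uminus polys_closed lookup_add lookup_zero_mult,
       auto simp: laurent_ring_def polys_closed lookup_add lookup_zero_mult)
next
  fix f :: "('k, 'n) laurent" and b
  assume f: "f \<in> irrelevant_ideal"
  show "monomial b (Poly_Mapping.lookup f b) \<in> irrelevant_ideal"
  proof (cases "b \<in> Poly_Mapping.keys f")
    case True
    then have "b \<noteq> 0" using f by (auto simp: irrelevant_ideal_def in_keys_iff)
    moreover have "monomial b (Poly_Mapping.lookup f b) \<in> polys"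
      using f True by (intro xpow_in_polys polys_keys) (auto simp: irrelevant_ideal_def)
    ultimately show ?thesis by (simp add: irrelevant_ideal_def lookup_single when_def)
  next
    case False
    then show ?thesis by (simp add: irrelevant_ideal_def in_keys_iff polys_closed)
  qed
qed

text \<open>
  A monomial of degree other than \<open>0\<close> with nonnegative exponents is a multiple of a variable.
\<close>

lemma genideal_variables:
  "Idl\<^bsub>poly_ring\<^esub> (range (\<lambda>j. xpow (axis j 1))) = (irrelevant_ideal :: ('k::field, 'n::finite) laurent set)"
proof
  interpret cring "poly_ring :: ('k, 'n) poly_gmodule"
    by (rule poly_ring_cring)
  let ?X = "range (\<lambda>j. xpow (axis j 1)) :: ('k, 'n) laurent set"
  have X: "?X \<subseteq> irrelevant_ideal"
  proof
    fix r assume "r \<in> ?X"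
    then obtain j where r: "r = xpow (axis j 1)" by auto
    have "axis j (1 :: int) \<noteq> 0" by (simp add: axis_eq_0_iff)
    then show "r \<in> irrelevant_ideal"
      unfolding r irrelevant_ideal_def
      by (auto simp: lookup_single when_def intro!: xpow_in_polys) (simp add: axis_def)
  qed
  then have Xp: "?X \<subseteq> polys" by (auto simp: irrelevant_ideal_def)
  show "Idl\<^bsub>poly_ring\<^esub> ?X \<subseteq> irrelevant_ideal"
    by (rule genideal_minimal[OF irrelevant_ideal_ideal X])
  interpret J: ideal "Idl\<^bsub>poly_ring\<^esub> ?X" poly_ring by (rule genideal_ideal[OF Xp])
  have zero: "0 \<in> Idl\<^bsub>poly_ring\<^esub> ?X" using J.zero_closed by (simp add: poly_ring_simps)
  have add: "r + s \<in> Idl\<^bsub>poly_ring\<^esub> ?X" if "r \<in> Idl\<^bsub>poly_ring\<^esub> ?X" "s \<in> Idl\<^bsub>poly_ring\<^esub> ?X" for r s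
    using J.a_closed[OF that] by (simp add: poly_ring_simps)
  have mono: "monomial a t \<in> Idl\<^bsub>poly_ring\<^esub> ?X" if a: "\<And>j. 0 \<le> vec_nth a j" "a \<noteq> 0" for a t
  proof -
    obtain j where j: "vec_nth a j \<noteq> 0" using a(2) by (auto simp: Finite_Cartesian_Product.vec_eq_iff)
    have "monomial (a - axis j 1) t \<in> polys"
    proof (rule xpow_in_polys)
      fix i show "0 \<le> vec_nth (a - axis j 1) i" using a(1)[of i] j by (auto simp: axis_def)
    qed
    moreover have "xpow (axis j 1) \<in> Idl\<^bsub>poly_ring\<^esub> ?X" using genideal_self[OF Xp] by blast
    ultimately have "monomial (a - axis j 1) t * xpow (axis j 1) \<in> Idl\<^bsub>poly_ring\<^esub> ?X"
      using J.I_l_closed by (simp add: poly_ring_simps)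
    then show ?thesis by (simp add: mult_single)
  qed
  show "irrelevant_ideal \<subseteq> Idl\<^bsub>poly_ring\<^esub> ?X"
  proof
    fix r :: "('k, 'n) laurent" assume r: "r \<in> irrelevant_ideal"
    have "(\<Sum>a\<in>A. monomial a (Poly_Mapping.lookup r a)) \<in> Idl\<^bsub>poly_ring\<^esub> ?X"
      if "finite A" "A \<subseteq> Poly_Mapping.keys r" for A
      using that
    proof (induction A rule: finite_induct)
      case empty
      then show ?case using zero by simp
    next
      case (insert a A)
      have "a \<noteq> 0" "r \<in> polys" using r insert.prems by (auto simp: irrelevant_ideal_def in_keys_iff)
      then have "monomial a (Poly_Mapping.lookup r a) \<in> Idl\<^bsub>poly_ring\<^esub> ?X"
        using insert.prems by (intro mono polys_keys) auto
      then show ?case using insert add by simp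
    qed
    from this[OF finite_keys order_refl]
    have "(\<Sum>a\<in>Poly_Mapping.keys r. monomial a (Poly_Mapping.lookup r a)) \<in> Idl\<^bsub>poly_ring\<^esub> ?X" .
    moreover have "(\<Sum>a\<in>Poly_Mapping.keys r. monomial a (Poly_Mapping.lookup r a)) = r"
      by (rule poly_mapping_eqI) (simp add: lookup_sum lookup_single when_def in_keys_iff)
    ultimately show "r \<in> Idl\<^bsub>poly_ring\<^esub> ?X" by simp
  qed
qed

abbreviation residue :: "('k::field, 'n::finite) laurent \<Rightarrow> ('k, 'n) laurent set" where
  "residue r \<equiv> irrelevant_ideal +>\<^bsub>laurent_ring\<^esub> r"

lemma hom_into_residue: "hom_into irrelevant_ideal"
  by unfold_locales (rule monomial_irrelevant_ideal)

lemma residue_module_simps: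
  fixes r t :: "('k::field, 'n::finite) laurent"
  shows "carrier residue_module = (residue ` polys :: ('k, 'n) laurent set set)"
    and "zero residue_module = (residue 0 :: ('k, 'n) laurent set)"
    and "add residue_module = (set_add laurent_ring :: ('k, 'n) laurent set \<Rightarrow> _)"
    and "r \<in> polys \<Longrightarrow> r \<odot>\<^bsub>residue_module\<^esub> residue t = residue (r * t)"
    and "homog residue_module a = (residue ` homog poly_ring a :: ('k, 'n) laurent set set)"
proof -
  have coset: "H +>\<^bsub>poly_ring\<^esub> x = H +>\<^bsub>laurent_ring\<^esub> x" for H and x :: "('k, 'n) laurent"
    unfolding poly_ring_def by (rule coset_gsub)
  have sm: "smult poly_ring = ((*) :: ('k, 'n) laurent \<Rightarrow> ('k, 'n) laurent \<Rightarrow> ('k, 'n) laurent)"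
    by (simp add: poly_ring_def gsub_def laurent_ring_def)
  show "r \<odot>\<^bsub>residue_module\<^esub> residue t = residue (r * t)" if "r \<in> polys"
    unfolding residue_module_def genideal_variables gmodule_record_simps coset sm
    by (rule hom_into.mcoset_smult[OF hom_into_residue that])
  show "zero residue_module = (residue 0 :: ('k, 'n) laurent set)"
    unfolding residue_module_def genideal_variables gmodule_record_simps
    by (rule hom_into.mcoset_zero[OF hom_into_residue, symmetric])
  show "add residue_module = (set_add laurent_ring :: ('k, 'n) laurent set \<Rightarrow> _)"
    unfolding residue_module_def gmodule_record_simps unfolding poly_ring_def by (rule set_add_gsub)
  show "homog residue_module a = (residue ` homog poly_ring a :: ('k, 'n) laurent set set)"
    unfolding residue_module_def genideal_variables gmodule_record_simps coset ..
  have "carrier residue_module = (\<Union>x\<in>polys. {irrelevant_ideal +>\<^bsub>poly_ring\<^esub> x} :: ('k, 'n) laurent set set)"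
    unfolding residue_module_def genideal_variables gmodule_record_simps A_RCOSETS_def RCOSETS_def
      a_r_coset_def partial_object.simps ..
  then show "carrier residue_module = (residue ` polys :: ('k, 'n) laurent set set)"
    unfolding coset by blast
qed

context bar_indices
begin

definition bar_resolution :: "('x, ('k::field, 'n) laurent, ('k, 'n) laurent set, int ^ 'n) resolution" where
  "bar_resolution = \<lparr>base = level, deg = degree,
     diff = (\<lambda>n. \<lambda>c\<in>free_vectors (level (Suc n)). bar (Suc n) c),
     aug = (\<lambda>c\<in>free_vectors (level 0). residue (c nil))\<rparr>"

lemma bar_homog:
  fixes c :: "'x \<Rightarrow> ('k::field, 'n) laurent"
  assumes "c \<in> homog (free_gmodule poly_ring (level (Suc n)) (degree (Suc n))) a"
  shows "bar (Suc n) c \<in> homog (free_gmodule (poly_ring ::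
    ('k, 'n) poly_gmodule) (level n) (degree n)) a"
proof -
  have c: "c \<in> free_vectors (level (Suc n))"
    "\<And>x. x \<in> level (Suc n) \<Longrightarrow> c x \<in> range (monomial (a - degree (Suc n) x))"
    using assms by (simp_all only: free_gmodule_simps mem_Collect_eq)
  have "bar (Suc n) c y \<in> range (monomial (a - degree n y))" if y: "y \<in> level n" for y
  proof -
    have summand: "c x * boundary (Suc n) x y \<in> range (monomial (a - degree n y))" if "c x \<noteq> 0" for x
    proof -
      have x: "x \<in> level (Suc n)" using free_vectorsD(3)[OF c(1) that] .
      obtain s t :: 'k where "c x = monomial (a - degree (Suc n) x) s"
        "boundary (Suc n) x y = monomial (degree (Suc n) x - degree n y) t"
        using c(2)[OF x] boundary_homog[OF x y] by blast
      then have "c x * boundary (Suc n) x y = monomial (a - degree n y) (s * t)"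
        by (simp add: mult_single del: boundary.simps degree.simps)
      then show ?thesis by blast
    qed
    have "(\<Sum>x\<in>A. c x * boundary (Suc n) x y) \<in> range (monomial (a - degree n y))"
      if "A \<subseteq> {x. c x \<noteq> 0}" for A
      using that
      by (induction A rule: infinite_finite_induct)
        (auto intro!: range_single_closed(1,2) summand simp del: boundary.simps degree.simps)
    then show ?thesis unfolding bar_apply wsum_def by blast
  qed
  with bar_mem[OF c(1)] show ?thesis unfolding free_gmodule_simps by blast
qed

lemma res_module_bar: "res_module poly_ring bar_resolution i = free_gmodule poly_ring (level i) (degree i)"
  by (simp add: res_module_def bar_resolution_def)

lemma bar_resolution_diff:
  "diff bar_resolution n \<in> hom_deg poly_ring (free_gmodule poly_ring (level (Suc n)) (degree (Suc n)))
     (free_gmodule (poly_ring :: ('k::field, 'n) poly_gmodule) (level n) (degree n)) 0"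
proof -
  have "diff bar_resolution n \<in> carrier (hom_module poly_ring (free_gmodule poly_ring (level (Suc n)) (degree (Suc n)))
     (free_gmodule (poly_ring :: ('k, 'n) poly_gmodule) (level n) (degree n)))"
    unfolding hom_module_def module_hom_def free_gmodule_simps bar_resolution_def
    using bar_mem bar_add bar_smult
    by (auto simp: free_vectors_closed simp del: level.simps)
  moreover have "diff bar_resolution n ` homog (free_gmodule poly_ring (level (Suc n)) (degree (Suc n))) a
    \<subseteq> homog (free_gmodule (poly_ring :: ('k, 'n) poly_gmodule) (level n) (degree n)) (a + 0)" for a
  proof
    fix y :: "'x \<Rightarrow> ('k, 'n) laurent"
    assume "y \<in> diff bar_resolution n ` homog (free_gmodule poly_ring (level (Suc n)) (degree (Suc n))) a"
    then obtain c :: "'x \<Rightarrow> ('k, 'n) laurent" where c: "c \<in> homog (free_gmodule poly_ring (level (Suc n)) (degree (Suc n))) a"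
      "y = diff bar_resolution n c" by blast
    have "c \<in> free_vectors (level (Suc n))" using c(1) by (simp only: free_gmodule_simps mem_Collect_eq)
    then have "y = bar (Suc n) c" unfolding c(2) by (simp add: bar_resolution_def del: level.simps)
    with bar_homog[OF c(1)]
    show "y \<in> homog (free_gmodule poly_ring (level n) (degree n)) (a + 0)" by (simp only: add_0_right)
  qed
  ultimately show ?thesis unfolding hom_deg_def by blast
qed

lemma aug_eq: "c \<in> free_vectors (level 0) \<Longrightarrow> aug bar_resolution c = residue (c nil)"
  by (simp add: bar_resolution_def del: level.simps)

lemma aug_in: "c \<in> free_vectors (level 0) \<Longrightarrow> aug bar_resolution c \<in> residue ` polys"
  unfolding aug_eq by (rule imageI[OF free_vectorsD(1)])

lemma bar_resolution_aug:
  "aug bar_resolution \<in> hom_deg poly_ring (free_gmodule poly_ring (level 0) (degree 0))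
     (residue_module :: (('k::field, 'n) laurent, ('k, 'n) laurent set, int ^ 'n) gmodule) 0"
proof -
  have "aug bar_resolution \<in> carrier (hom_module poly_ring (free_gmodule poly_ring (level 0) (degree 0))
     (residue_module :: (('k, 'n) laurent, ('k, 'n) laurent set, int ^ 'n) gmodule))"
    unfolding hom_module_def module_hom_def free_gmodule_simps residue_module_simps(1,3)
  proof (simp del: level.simps, intro conjI allI impI)
    show "aug bar_resolution \<in> free_vectors (level 0) \<rightarrow> (residue ` polys :: ('k, 'n) laurent set set)"
      using aug_in by blast
    show "aug bar_resolution (c + c') = aug bar_resolution c <+>\<^bsub>laurent_ring\<^esub> aug bar_resolution c'"
      if "c \<in> free_vectors (level 0) \<and> c' \<in> free_vectors (level 0)" for c c' :: "'x \<Rightarrow> ('k, 'n) laurent"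
    proof -
      have c: "c \<in> free_vectors (level 0)" "c' \<in> free_vectors (level 0)" using that by auto
      show ?thesis
        unfolding aug_eq[OF free_vectors_closed(2)[OF c]] aug_eq[OF c(1)] aug_eq[OF c(2)]
          hom_into.mcoset_add[OF hom_into_residue]
        by (simp only: plus_fun_apply)
    qed
    show "aug bar_resolution (\<lambda>x. r * c x) = r \<odot>\<^bsub>residue_module\<^esub> aug bar_resolution c"
      if "r \<in> polys \<and> c \<in> free_vectors (level 0)" for r and c :: "'x \<Rightarrow> ('k, 'n) laurent"
      using that by (simp add: aug_eq free_vectors_closed residue_module_simps(4) del: level.simps)
    show "aug bar_resolution \<in> extensional (free_vectors (level 0))"
      by (simp add: bar_resolution_def del: level.simps)
  qed
  moreover have "aug bar_resolution ` homog (free_gmodule poly_ring (level 0) (degree 0)) a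
      \<subseteq> homog (residue_module :: (('k, 'n) laurent, ('k, 'n) laurent set, int ^ 'n) gmodule) (a + 0)" for a
  proof
    fix y :: "('k, 'n) laurent set"
    assume "y \<in> aug bar_resolution ` homog (free_gmodule poly_ring (level 0) (degree 0)) a"
    then obtain c :: "'x \<Rightarrow> ('k, 'n) laurent" where c: "c \<in> free_vectors (level 0)"
      "\<forall>x\<in>level 0. c x \<in> range (monomial (a - degree 0 x))" "y = aug bar_resolution c"
      unfolding free_gmodule_simps by blast
    have "c nil \<in> homog poly_ring (a + 0)"
      unfolding poly_ring_simps using c(2) free_vectorsD(1)[OF c(1)] by simp
    then show "y \<in> homog residue_module (a + 0)"
      unfolding c(3) aug_eq[OF c(1)] residue_module_simps by blast
  qed
  ultimately show ?thesis unfolding hom_deg_def by blast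
qed

lemma aug_surjective: "aug bar_resolution ` free_vectors (level 0) = (residue ` polys :: ('k::field, 'n) laurent set set)"
proof (intro equalityI subsetI)
  fix y :: "('k, 'n) laurent set"
  assume "y \<in> residue ` polys"
  then obtain r :: "('k, 'n) laurent" where r: "r \<in> polys" "y = residue r" by auto
  have b: "bvec r nil \<in> free_vectors (level 0)" by (rule bvec_mem[OF r(1)]) simp
  have "y = aug bar_resolution (bvec r nil)" unfolding aug_eq[OF b] r(2) by (simp add: bvec_def)
  with b show "y \<in> aug bar_resolution ` free_vectors (level 0)" by blast
next
  fix y :: "('k, 'n) laurent set"
  assume "y \<in> aug bar_resolution ` free_vectors (level 0)"
  then show "y \<in> residue ` polys" using aug_in by blast
qed

lemma aug_zero_iff:
  assumes "c \<in> free_vectors (level 0)"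
  shows "aug bar_resolution c = residue 0 \<longleftrightarrow> constant_part 0 c = 0"
proof -
  have "aug bar_resolution c = residue 0 \<longleftrightarrow> c nil \<in> irrelevant_ideal"
    unfolding aug_eq[OF assms] hom_into.mcoset_eq_iff[OF hom_into_residue] by simp
  also have "\<dots> \<longleftrightarrow> Poly_Mapping.lookup (c nil) 0 = 0"
    using free_vectorsD(1)[OF assms] by (simp add: irrelevant_ideal_def)
  also have "\<dots> \<longleftrightarrow> constant_part 0 c = 0"
    by (auto simp: constant_part_def fun_eq_iff bvec_def) (metis lookup_single_eq lookup_zero)
  finally show ?thesis .
qed

lemma diff_image:
  "diff bar_resolution n ` free_vectors (level (Suc n)) = bar (Suc n) ` free_vectors (level (Suc n))"
  by (rule image_cong[OF refl]) (simp add: bar_resolution_def del: level.simps)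

lemma bar_image_iff:
  assumes "c \<in> free_vectors (level n)"
  shows "c \<in> bar (Suc n) ` free_vectors (level (Suc n)) \<longleftrightarrow> bar n c = 0 \<and> constant_part n c = 0"
proof
  assume "c \<in> bar (Suc n) ` free_vectors (level (Suc n))"
  then obtain c' where c': "c' \<in> free_vectors (level (Suc n))" "c = bar (Suc n) c'" by blast
  have "constant_part n c = 0"
  proof (cases n)
    case 0
    then have "Poly_Mapping.lookup (c nil) 0 = 0" using c' bar_1_constant[of c'] by (simp del: level.simps)
    then show ?thesis unfolding constant_part_def by (simp add: bvec_zero)
  qed (simp add: constant_part_def)
  then show "bar n c = 0 \<and> constant_part n c = 0" using bar_bar[OF c'(1)] c'(2) by simp
next
  assume "bar n c = 0 \<and> constant_part n c = 0"
  then show "c \<in> bar (Suc n) ` free_vectors (level (Suc n))" using bar_exact[OF assms] by blast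
qed

theorem free_resolution_bar:
  "free_resolution poly_ring (residue_module :: (('k::field, 'n) laurent, ('k, 'n) laurent set, int ^ 'n) gmodule)
     bar_resolution"
proof -
  have mem: "bar (Suc n) ` free_vectors (level (Suc n)) \<subseteq> (free_vectors (level n) :: ('x \<Rightarrow> ('k, 'n) laurent) set)" for n
    using bar_mem by blast
  have ker0: "diff bar_resolution 0 ` free_vectors (level (Suc 0))
      = {c \<in> free_vectors (level 0). aug bar_resolution c = (residue 0 :: ('k, 'n) laurent set)}"
  proof -
    have "c \<in> bar (Suc 0) ` free_vectors (level (Suc 0)) \<longleftrightarrow> aug bar_resolution c = residue 0"
      if "c \<in> free_vectors (level 0)" for c :: "'x \<Rightarrow> ('k, 'n) laurent"
      unfolding aug_zero_iff[OF that] bar_image_iff[OF that] bar_0 by simp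
    then show ?thesis unfolding diff_image using mem[of 0] by blast
  qed
  have ker: "diff bar_resolution (Suc n) ` free_vectors (level (Suc (Suc n)))
      = {c \<in> free_vectors (level (Suc n)). diff bar_resolution n c = (0 :: 'x \<Rightarrow> ('k, 'n) laurent)}" for n
  proof -
    have "c \<in> bar (Suc (Suc n)) ` free_vectors (level (Suc (Suc n))) \<longleftrightarrow> diff bar_resolution n c = 0"
      if "c \<in> free_vectors (level (Suc n))" for c :: "'x \<Rightarrow> ('k, 'n) laurent"
      unfolding bar_image_iff[OF that] using that
      by (simp add: bar_resolution_def constant_part_def del: level.simps)
    then show ?thesis unfolding diff_image using mem[of "Suc n"] by blast
  qed
  show ?thesis
    unfolding free_resolution_def Let_def res_module_bar free_gmodule_simps a_kernel_def kernel_def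
      monoid.simps partial_object.simps residue_module_simps One_nat_def
    by (intro conjI allI; rule bar_resolution_aug bar_resolution_diff aug_surjective ker0 ker)
qed

end

text \<open>
  A sequence of exponent vectors is coded by a natural number, where \<open>0\<close> is the code of the empty
  sequence and the successor keeps the codes of the other sequences apart from it; the second component
  of the index is constant.
\<close>

lemma ex_free_resolution_residue_module:
  "\<exists>P :: (nat \<times> 'm, ('k::field, 'n::finite) laurent, ('k, 'n) laurent set, int ^ 'n) resolution.
     free_resolution poly_ring residue_module P"
proof -
  define u where "u = (undefined :: 'm)"
  interpret bar_indices "(0, u) :: nat \<times> 'm" "\<lambda>(a :: int ^ 'n) (k, m). (Suc (to_nat (a, k)), m)"
    "\<lambda>(k, m). fst (from_nat (k - 1) :: (int ^ 'n) \<times> nat)"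
    "\<lambda>(k, m). (snd (from_nat (k - 1) :: (int ^ 'n) \<times> nat), m)"
    by unfold_locales (auto split: prod.splits)
  from free_resolution_bar show ?thesis by blast
qed


section \<open>Bass and Betti numbers\<close>

lemma hom_deg_zeroD:
  fixes \<delta> :: "'x \<Rightarrow> int ^ 'n::finite" and d :: "('x \<Rightarrow> ('k::field, 'n) laurent) \<Rightarrow> 'y \<Rightarrow> ('k, 'n) laurent"
  assumes "d \<in> hom_deg poly_ring (free_gmodule poly_ring I \<delta>) (free_gmodule poly_ring J \<epsilon>) 0"
  shows "free_hom I J d" "degree_preserving I \<delta> J \<epsilon> d"
proof -
  have hom: "d \<in> module_hom poly_ring (free_gmodule poly_ring I \<delta>) (free_gmodule poly_ring J \<epsilon>)"
    and deg: "\<forall>a. d ` homog (free_gmodule poly_ring I \<delta>) a \<subseteq> homog (free_gmodule poly_ring J \<epsilon>) (a + 0)"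
    using assms by (simp_all add: hom_deg_def hom_module_def)
  show "free_hom I J d"
    using hom unfolding module_hom_def free_gmodule_simps free_hom_def by blast
  show "degree_preserving I \<delta> J \<epsilon> d"
    using deg unfolding degree_preserving_def add_0_right .
qed

theorem corollary3p6:
  fixes M :: "('k::field, 'n::finite) laurent set"
    and i :: nat and b :: "int ^ 'n"
  assumes "CARD('n) \<ge> 2"
    and "monomial_module M"
  shows "bass_number i b (gquot laurent_ring M) =
         betti_number i (- b) (gsub laurent_ring (T_dual M))"
proof -
  define P where "P = some_resolution (poly_ring :: ('k, 'n) poly_gmodule) residue_module"
  have P: "free_resolution poly_ring residue_module P"
    unfolding P_def some_resolution_def by (rule someI_ex[OF ex_free_resolution_residue_module])
  have F: "res_module poly_ring P i = free_gmodule poly_ring (base P i) (deg P i)" for i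
    by (simp add: res_module_def)
  have "diff P i \<in> hom_deg poly_ring (free_gmodule poly_ring (base P (Suc i)) (deg P (Suc i)))
      (free_gmodule poly_ring (base P i) (deg P i)) 0" for i
    using P unfolding free_resolution_def Let_def F by blast
  note d = hom_deg_zeroD[OF this]
  interpret graded_complex "base P" "deg P" "diff P" M b
    by unfold_locales (rule assms(2), rule d(1), rule d(2))
  show ?thesis
    unfolding bass_number_def betti_number_def gExt_def gTor_def Let_def P_def[symmetric] F
    by (rule cohomology_dual_to_homology)
qed

end
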